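(* Let $R$ be a $GL(m)$-type R-matrix, $\{R,F\}$ a compatible pair of strictly skew-invertible R-matrices, $\eta\in\mathbb K\setminus\{0\}$, and let $\mathcal B_r(\mathcal L(R),\mathcal M)$ be the braided differential algebra generated by the reflection equation algebra $\mathcal L(R)$ (generating matrix $L$) and the quantum matrix algebra $\mathcal M(R,F)$ (generating matrix $M$). Then the rule $a\triangleright 1=\varepsilon(a)1$ for all $a\in\mathcal L(R)$, together with the relation $R_1L_1R_1M_1=\eta M_1L_{\overline 2}$, defines a left $\mathcal L(R)$-module structure on the subalgebra $\mathcal M(R,F)$. For every $p\ge 1$ the action of the generators $L_i^{\,j}$ on the $p$-th order homogeneous component $\mathcal M^p(R,F)$ is given by $$L_1\triangleright R_{1\to p}\,M_{\overline 1}M_{\overline 2}\cdots M_{\overline p}=\eta^p\,R^{-1}_{1\to p}\,M_{\overline 1}M_{\overline 2}\cdots M_{\overline p},$$ where $M_{\overline 1}=M_1$, $M_{\overline k}=F_{k-1}M_{\overline{k-1}}F_{k-1}^{-1}$, $R_{1\to p}=R_1R_2\cdots R_p$ and $R^{-1}_{1\to p}=R_1^{-1}R_2^{-1}\cdots R_p^{-1}$.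
   Context: $\mathbb K$ is $\mathbb C$ or $\mathbb R$; $V$ is a vector space over $\mathbb K$ of finite dimension $n$ with basis $x_1,\dots,x_n$; operators on $V^{\otimes k}$ are identified with numerical matrices by $R(x_i\otimes x_j)=R_{ij}^{\,rs}x_r\otimes x_s$, and matrices multiply by $(AB)_i^{\,j}=\sum_kA_i^{\,k}B_k^{\,j}$. For $X\in\mathrm{End}(V^{\otimes 2})$, $X_i$ denotes $X$ acting in the tensor factors $i,i+1$ (identity elsewhere); for an $n\times n$ matrix $A$ with entries in an algebra, $A_1=A\otimes I\otimes\cdots\otimes I$ acts in the first factor. R-matrix: an invertible $R\in\mathrm{End}(V^{\otimes 2})$ with $R_1R_2R_1=R_2R_1R_2$. Hecke type: in addition $(R-qI)(R+q^{-1}I)=0$, with $q\in\mathbb K\setminus\{0\}$ generic (either $q=1$ or $q^k\ne1$ for all $k\in\mathbb N$); $k_q=q^{k-1}+q^{k-3}+\dots+q^{1-k}$. The $q$-antisymmetrizers are $A_1(R)=I$, $A_{k+1}(R)=\frac{1}{(k+1)_q}A_k(R)\,(q^kI-k_qR_k)\,A_k(R)\in\mathrm{End}(V^{\otimes(k+1)})$. A Hecke type $R$ is of $GL(m)$-type if $A_m(R)$ is a rank one projector and $A_{m+1}(R)=0$. $R$ is skew-invertible if there is $\Psi_R\in\mathrm{End}(V^{\otimes2})$ with $\mathrm{Tr}_{(2)}R_{12}(\Psi_R)_{23}=P_{13}=\mathrm{Tr}_{(2)}(\Psi_R)_{12}R_{23}$ ($P$ the flip); strictly skew-invertible if moreover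 $B_R=\mathrm{Tr}_{(1)}(\Psi_R)_{12}$ (or $C_R=\mathrm{Tr}_{(2)}(\Psi_R)_{12}$) is invertible. Every $GL(m)$-type R-matrix is strictly skew-invertible. The pair $\{R,F\}$ is compatible if $R_1F_2F_1=F_2F_1R_2$ and $F_1F_2R_1=R_2F_1F_2$. The quantum matrix algebra $\mathcal M(R,F)$ is the unital associative $\mathbb K$-algebra generated by the entries of $M=\|M_i^{\,j}\|_{1\le i,j\le n}$ with relations $R_1M_{\overline1}M_{\overline2}=M_{\overline1}M_{\overline2}R_1$, where $M_{\overline 1}=M_1$, $M_{\overline{k+1}}=F_kM_{\overline k}F_k^{-1}$. It is graded by degree in the generators, with components $\mathcal M^p(R,F)$. The reflection equation algebra $\mathcal L(R)$ is the unital associative algebra generated by the entries of $L=\|L_i^{\,j}\|$ with relations $R_1L_1R_1L_1=L_1R_1L_1R_1$. Its counit $\varepsilon:\mathcal L(R)\to\mathbb K$ is the algebra homomorphism with $\varepsilon(L_i^{\,j})=\delta_i^{\,j}$. The braided differential algebra $\mathcal B_r(\mathcal L(R),\mathcal M)$ is the unital associative algebra generated by the $L_i^{\,j}$ and $M_i^{\,j}$ with relations $$R_1M_1M_{\overline2}=M_1M_{\overline2}R_1,\quad R_1L_1R_1L_1=L_1R_1L_1R_1,\quad R_1L_1R_1M_1=\eta M_1L_{\overline2},$$ where $L_{\overline2}=F_1L_1F_1^{-1}$, $M_{\overline2}=F_1M_1F_1^{-1}$. Action: for $a\in\mathcal L(R)$ and $b\in\mathcal M(R,F)$, one uses the third relation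 to write $ab=\sum_i b_ia_i$ in $\mathcal B_r$ with $b_i\in\mathcal M(R,F)$, $a_i\in\mathcal L(R)$, and sets $a\triangleright b=(ab)\triangleright 1=\sum_ib_i\,\varepsilon(a_i)$. In matrix formulas $\triangleright$ is applied entrywise, numerical matrices being moved freely through $\triangleright$. *)

theory Defs
  imports
    "HOL-Analysis.Cartesian_Space"
    "HOL-Library.Poly_Mapping"
    "HOL-Library.Function_Algebras"
    "HOL-Algebra.QuotRing"
    "HOL-Algebra.Module"
begin

section \<open>Matrices on tensor powers\<close>

text \<open>
  The basis of $V$ is indexed by a finite type \<open>'n\<close>, that of $V^{\otimes k}$ by the lists of
  length $k$. A \<open>tmat\<close> is a family of matrices, one on each $V^{\otimes k}$; only its values
  at pairs of lists of equal length matter, and \<open>A \<cdot> B\<close> multiplies the families levelwise.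
  An element of $\mathrm{End}(V^{\otimes 2})$ is a library matrix indexed by pairs, with
  \<open>R $ (i,j) $ (r,s)\<close> for $R_{ij}^{\,rs}$; both index conventions agree with
  $(AB)_i^{\,j}=\sum_k A_i^{\,k}B_k^{\,j}$.
\<close>

type_synonym ('n, 'a) tmat = "'n list \<Rightarrow> 'n list \<Rightarrow> 'a"
type_synonym ('n, 'k) mat2 = "'k ^ ('n \<times> 'n) ^ ('n \<times> 'n)"

definition tidx :: "nat \<Rightarrow> 'n list set" where
  "tidx k = {xs. length xs = k}"

definition tmul :: "('n, 'a::semiring_0) tmat \<Rightarrow> ('n, 'a) tmat \<Rightarrow> ('n, 'a) tmat"
    (infixl \<open>\<cdot>\<close> 75) where
  "(A \<cdot> B) xs ys = (\<Sum>zs\<in>tidx (length xs). A xs zs * B zs ys)"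

definition tone :: "('n, 'a::zero_neq_one) tmat" where
  "tone xs ys = (if xs = ys then 1 else 0)"

definition teq :: "nat \<Rightarrow> ('n, 'a) tmat \<Rightarrow> ('n, 'a) tmat \<Rightarrow> bool" where
  "teq k A B \<longleftrightarrow> (\<forall>xs\<in>tidx k. \<forall>ys\<in>tidx k. A xs ys = B xs ys)"

text \<open>$X_i$: tensor factors are numbered from 1, list positions from 0.\<close>

definition leg :: "nat \<Rightarrow> ('n::finite, 'k::zero) mat2 \<Rightarrow> ('n, 'k) tmat" where
  "leg i X xs ys =
     (if take (i - 1) xs = take (i - 1) ys \<and> drop (i + 1) xs = drop (i + 1) ys
      then X $ (xs ! (i - 1), xs ! i) $ (ys ! (i - 1), ys ! i) else 0)"

definition first_leg :: "('n \<Rightarrow> 'n \<Rightarrow> 'a::zero) \<Rightarrow> ('n, 'a) tmat" where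
  "first_leg X xs ys = (if tl xs = tl ys then X (hd xs) (hd ys) else 0)"

text \<open>An operator on $V^{\otimes k}$ acting in the first $k$ factors of a longer tensor power.\<close>

definition extend_tail :: "nat \<Rightarrow> ('n, 'k::zero) tmat \<Rightarrow> ('n, 'k) tmat" where
  "extend_tail k A xs ys = (if drop k xs = drop k ys then A (take k xs) (take k ys) else 0)"

text \<open>$\mathrm{Tr}_{(i)}$; the remaining factors are renumbered consecutively.\<close>

definition ptrace :: "nat \<Rightarrow> ('n::finite, 'k::comm_monoid_add) tmat \<Rightarrow> ('n, 'k) tmat" where
  "ptrace i A xs ys =
     (\<Sum>a\<in>UNIV. A (take (i - 1) xs @ a # drop (i - 1) xs) (take (i - 1) ys @ a # drop (i - 1) ys))"

definition flip :: "('n::finite, 'k::zero_neq_one) mat2" where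
  "flip = (\<chi> x y. if y = (snd x, fst x) then 1 else 0)"

text \<open>$X_{1\to p} = X_1 X_2 \cdots X_p$\<close>

primrec leg_chain :: "('n::finite, 'k::{semiring_0,zero_neq_one}) mat2 \<Rightarrow> nat \<Rightarrow> ('n, 'k) tmat" where
  "leg_chain X 0 = tone"
| "leg_chain X (Suc p) = leg_chain X p \<cdot> leg (Suc p) X"

text \<open>
  Rank on $V^{\otimes k}$: dimension of the image. The rows are the images of the basis vectors,
  since $A(x_I) = \sum_J A_I^{\,J} x_J$.
\<close>

definition trank :: "nat \<Rightarrow> ('n, 'k::field) tmat \<Rightarrow> nat" where
  "trank k A =
     vector_space.dim (\<lambda>c v ys. c * v ys)
       ((\<lambda>xs ys. if ys \<in> tidx k then A xs ys else 0) ` tidx k)"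


section \<open>R-matrices\<close>

definition R_matrix :: "('n::finite, 'k::field) mat2 \<Rightarrow> bool" where
  "R_matrix R \<longleftrightarrow> invertible R \<and> teq 3 (leg 1 R \<cdot> leg 2 R \<cdot> leg 1 R) (leg 2 R \<cdot> leg 1 R \<cdot> leg 2 R)"

definition generic :: "'k::field \<Rightarrow> bool" where
  "generic q \<longleftrightarrow> q \<noteq> 0 \<and> (q = 1 \<or> (\<forall>k\<ge>1. q ^ k \<noteq> 1))"

text \<open>\<open>mat c\<close> is the scalar matrix $cI$.\<close>

definition Hecke_type :: "'k::field \<Rightarrow> ('n::finite, 'k) mat2 \<Rightarrow> bool" where
  "Hecke_type q R \<longleftrightarrow> R_matrix R \<and> generic q \<and> (R - mat q) ** (R + mat (inverse q)) = 0"

definition qnum :: "'k::field \<Rightarrow> nat \<Rightarrow> 'k" where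
  "qnum q k = (\<Sum>i<k. q powi (int k - 1 - 2 * int i))"

text \<open>Only the values at \<open>k \<ge> 1\<close> are meaningful.\<close>

primrec antisymmetrizer :: "'k::field \<Rightarrow> ('n::finite, 'k) mat2 \<Rightarrow> nat \<Rightarrow> ('n, 'k) tmat" where
  "antisymmetrizer q R 0 = tone"
| "antisymmetrizer q R (Suc k) =
     (if k = 0 then tone
      else (\<lambda>xs ys. inverse (qnum q (Suc k)) *
              (extend_tail k (antisymmetrizer q R k)
                \<cdot> (\<lambda>us vs. q ^ k * tone us vs - qnum q k * leg k R us vs)
                \<cdot> extend_tail k (antisymmetrizer q R k)) xs ys))"

definition GL_type :: "nat \<Rightarrow> 'k::field \<Rightarrow> ('n::finite, 'k) mat2 \<Rightarrow> bool" where
  "GL_type m q R \<longleftrightarrow>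
     Hecke_type q R \<and> m \<ge> 1 \<and>
     teq m (antisymmetrizer q R m \<cdot> antisymmetrizer q R m) (antisymmetrizer q R m) \<and>
     trank m (antisymmetrizer q R m) = 1 \<and>
     teq (Suc m) (antisymmetrizer q R (Suc m)) (\<lambda>_ _. 0)"

text \<open>
  After $\mathrm{Tr}_{(2)}$ the factors 1 and 3 become 1 and 2, so $P_{13}$ is \<open>leg 1 flip\<close>.
\<close>

definition skew_inverse :: "('n::finite, 'k::field) mat2 \<Rightarrow> ('n, 'k) mat2 \<Rightarrow> bool" where
  "skew_inverse R \<Psi> \<longleftrightarrow>
     teq 2 (ptrace 2 (leg 1 R \<cdot> leg 2 \<Psi>)) (leg 1 flip) \<and>
     teq 2 (ptrace 2 (leg 1 \<Psi> \<cdot> leg 2 R)) (leg 1 flip)"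

definition B_matrix :: "('n::finite, 'k::field) mat2 \<Rightarrow> 'k ^ 'n ^ 'n" where
  "B_matrix \<Psi> = (\<chi> i j. ptrace 1 (leg 1 \<Psi>) [i] [j])"

definition C_matrix :: "('n::finite, 'k::field) mat2 \<Rightarrow> 'k ^ 'n ^ 'n" where
  "C_matrix \<Psi> = (\<chi> i j. ptrace 2 (leg 1 \<Psi>) [i] [j])"

definition strictly_skew_invertible :: "('n::finite, 'k::field) mat2 \<Rightarrow> bool" where
  "strictly_skew_invertible R \<longleftrightarrow>
     (\<exists>\<Psi>. skew_inverse R \<Psi> \<and> (invertible (B_matrix \<Psi>) \<or> invertible (C_matrix \<Psi>)))"

definition compatible_pair :: "('n::finite, 'k::field) mat2 \<Rightarrow> ('n, 'k) mat2 \<Rightarrow> bool" where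
  "compatible_pair R F \<longleftrightarrow>
     teq 3 (leg 1 R \<cdot> leg 2 F \<cdot> leg 1 F) (leg 2 F \<cdot> leg 1 F \<cdot> leg 2 R) \<and>
     teq 3 (leg 1 F \<cdot> leg 2 F \<cdot> leg 1 R) (leg 2 R \<cdot> leg 1 F \<cdot> leg 2 F)"


section \<open>Algebras given by generators and relations\<close>

text \<open>
  Words form a monoid under concatenation, so that \<open>'x list \<Rightarrow>\<^sub>0 'k\<close> with the convolution
  product is the free unital associative algebra on \<open>'x\<close>.
\<close>

instantiation list :: (type) monoid_add
begin

definition zero_list :: "'a list" where "zero_list = []"
definition plus_list :: "'a list \<Rightarrow> 'a list \<Rightarrow> 'a list" where "plus_list = (@)"

instance by standard (simp_all add: zero_list_def plus_list_def)

end

type_synonym ('x, 'k) free_alg = "'x list \<Rightarrow>\<^sub>0 'k"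

definition fa_const :: "'k::zero \<Rightarrow> ('x, 'k) free_alg" where
  "fa_const c = Poly_Mapping.single [] c"

definition fa_var :: "'x \<Rightarrow> ('x, 'k::zero_neq_one) free_alg" where
  "fa_var x = Poly_Mapping.single [x] 1"

text \<open>
  The homomorphism from the free algebra that maps the generators by \<open>f\<close>; the map \<open>\<phi>\<close>
  embeds the scalars into the target.
\<close>

definition fa_eval :: "('k::field \<Rightarrow> 'a::ring_1) \<Rightarrow> ('x \<Rightarrow> 'a) \<Rightarrow> ('x, 'k) free_alg \<Rightarrow> 'a" where
  "fa_eval \<phi> f x =
     (\<Sum>w\<in>Poly_Mapping.keys x. \<phi> (Poly_Mapping.lookup x w) * prod_list (map f w))"

definition free_ring :: "('x, 'k::field) free_alg ring" where
  "free_ring = \<lparr>carrier = UNIV, mult = (*), one = 1, zero = 0, add = (+)\<rparr>"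

definition rel_ideal :: "('x, 'k::field) free_alg set \<Rightarrow> ('x, 'k) free_alg set" where
  "rel_ideal S = Idl\<^bsub>free_ring\<^esub> S"

definition cls :: "('x, 'k::field) free_alg set \<Rightarrow> ('x, 'k) free_alg \<Rightarrow> ('x, 'k) free_alg set" where
  "cls S x = rel_ideal S +>\<^bsub>free_ring\<^esub> x"

definition presented :: "('x, 'k::field) free_alg set \<Rightarrow> ('k, ('x, 'k) free_alg set) module" where
  "presented S =
     ring.extend (free_ring Quot rel_ideal S)
       (module.fields (\<lambda>c X. cls S (fa_const c) \<otimes>\<^bsub>free_ring Quot rel_ideal S\<^esub> X))"

text \<open>
  \<open>A\<close>-module structures, for a \<open>'k\<close>-algebra \<open>A\<close>, on the \<open>'k\<close>-vector space underlying \<open>N\<close>.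
\<close>

definition left_module_structure ::
    "('k, 'a) module \<Rightarrow> ('k, 'b) module \<Rightarrow> ('a \<Rightarrow> 'b \<Rightarrow> 'b) \<Rightarrow> bool" where
  "left_module_structure A N act \<longleftrightarrow>
     (\<forall>a\<in>carrier A. \<forall>b\<in>carrier N. act a b \<in> carrier N) \<and>
     (\<forall>b\<in>carrier N. act \<one>\<^bsub>A\<^esub> b = b) \<and>
     (\<forall>a\<in>carrier A. \<forall>a'\<in>carrier A. \<forall>b\<in>carrier N.
        act (a \<otimes>\<^bsub>A\<^esub> a') b = act a (act a' b) \<and>
        act (a \<oplus>\<^bsub>A\<^esub> a') b = act a b \<oplus>\<^bsub>N\<^esub> act a' b) \<and>
     (\<forall>a\<in>carrier A. \<forall>b\<in>carrier N. \<forall>b'\<in>carrier N.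
        act a (b \<oplus>\<^bsub>N\<^esub> b') = act a b \<oplus>\<^bsub>N\<^esub> act a b') \<and>
     (\<forall>c. \<forall>a\<in>carrier A. \<forall>b\<in>carrier N.
        act (c \<odot>\<^bsub>A\<^esub> a) b = c \<odot>\<^bsub>N\<^esub> act a b \<and> act a (c \<odot>\<^bsub>N\<^esub> b) = c \<odot>\<^bsub>N\<^esub> act a b)"


section \<open>The quantum matrix, reflection equation and braided differential algebras\<close>

definition num :: "('n, 'k::zero) tmat \<Rightarrow> ('n, ('x, 'k) free_alg) tmat" where
  "num A xs ys = fa_const (A xs ys)"

definition tscale :: "'k::field \<Rightarrow> ('n, ('x, 'k) free_alg) tmat \<Rightarrow> ('n, ('x, 'k) free_alg) tmat" where
  "tscale c A xs ys = fa_const c * A xs ys"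

text \<open>The relations expressing \<open>A = B\<close> on $V^{\otimes k}$.\<close>

definition entry_rels :: "nat \<Rightarrow> ('n, 'a::minus) tmat \<Rightarrow> ('n, 'a) tmat \<Rightarrow> 'a set" where
  "entry_rels k A B = {A xs ys - B xs ys | xs ys. xs \<in> tidx k \<and> ys \<in> tidx k}"

text \<open>$X_{\overline k}$ for \<open>k \<ge> 1\<close>; the value at 0 is irrelevant.\<close>

primrec bar :: "('n::finite, 'k::field) mat2 \<Rightarrow> ('n \<Rightarrow> 'n \<Rightarrow> ('x, 'k) free_alg) \<Rightarrow> nat
    \<Rightarrow> ('n, ('x, 'k) free_alg) tmat" where
  "bar F X 0 = tone"
| "bar F X (Suc k) =
     (if k = 0 then first_leg X
      else num (leg k F) \<cdot> bar F X k \<cdot> num (leg k (matrix_inv F)))"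

text \<open>$X_{\overline 1} X_{\overline 2} \cdots X_{\overline p}$\<close>

primrec bar_prod :: "('n::finite, 'k::field) mat2 \<Rightarrow> ('n \<Rightarrow> 'n \<Rightarrow> ('x, 'k) free_alg) \<Rightarrow> nat
    \<Rightarrow> ('n, ('x, 'k) free_alg) tmat" where
  "bar_prod F X 0 = tone"
| "bar_prod F X (Suc p) = bar_prod F X p \<cdot> bar F X (Suc p)"

definition QMA_rels :: "('n::finite, 'k::field) mat2 \<Rightarrow> ('n, 'k) mat2
    \<Rightarrow> ('n \<Rightarrow> 'n \<Rightarrow> ('x, 'k) free_alg) \<Rightarrow> ('x, 'k) free_alg set" where
  "QMA_rels R F M =
     entry_rels 2 (num (leg 1 R) \<cdot> bar F M 1 \<cdot> bar F M 2) (bar F M 1 \<cdot> bar F M 2 \<cdot> num (leg 1 R))"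

definition REA_rels :: "('n::finite, 'k::field) mat2
    \<Rightarrow> ('n \<Rightarrow> 'n \<Rightarrow> ('x, 'k) free_alg) \<Rightarrow> ('x, 'k) free_alg set" where
  "REA_rels R L =
     entry_rels 2
       (num (leg 1 R) \<cdot> first_leg L \<cdot> num (leg 1 R) \<cdot> first_leg L)
       (first_leg L \<cdot> num (leg 1 R) \<cdot> first_leg L \<cdot> num (leg 1 R))"

definition cross_rels :: "'k \<Rightarrow> ('n::finite, 'k::field) mat2 \<Rightarrow> ('n, 'k) mat2
    \<Rightarrow> ('n \<Rightarrow> 'n \<Rightarrow> ('x, 'k) free_alg) \<Rightarrow> ('n \<Rightarrow> 'n \<Rightarrow> ('x, 'k) free_alg)
    \<Rightarrow> ('x, 'k) free_alg set" where
  "cross_rels \<eta> R F L M =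
     entry_rels 2
       (num (leg 1 R) \<cdot> first_leg L \<cdot> num (leg 1 R) \<cdot> first_leg M)
       (tscale \<eta> (first_leg M \<cdot> bar F L 2))"

text \<open>
  The generating matrix of $\mathcal M(R,F)$ and, likewise, of $\mathcal L(R)$; in
  $\mathcal B_r$ the generators $L_i^{\,j}$ are tagged \<open>Inl\<close>, the generators $M_i^{\,j}$ \<open>Inr\<close>.
\<close>

definition gen :: "'n \<Rightarrow> 'n \<Rightarrow> ('n \<times> 'n, 'k::field) free_alg" where
  "gen i j = fa_var (i, j)"

definition genL :: "'n \<Rightarrow> 'n \<Rightarrow> (('n \<times> 'n) + ('n \<times> 'n), 'k::field) free_alg" where
  "genL i j = fa_var (Inl (i, j))"

definition genM :: "'n \<Rightarrow> 'n \<Rightarrow> (('n \<times> 'n) + ('n \<times> 'n), 'k::field) free_alg" where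
  "genM i j = fa_var (Inr (i, j))"

definition BR_rels :: "'k \<Rightarrow> ('n::finite, 'k::field) mat2 \<Rightarrow> ('n, 'k) mat2
    \<Rightarrow> (('n \<times> 'n) + ('n \<times> 'n), 'k) free_alg set" where
  "BR_rels \<eta> R F = QMA_rels R F genM \<union> REA_rels R genL \<union> cross_rels \<eta> R F genL genM"

definition QMA where "QMA R F = presented (QMA_rels R F gen)"

definition REA where "REA R = presented (REA_rels R gen)"

definition BR where "BR \<eta> R F = presented (BR_rels \<eta> R F)"

definition QMA_cls where "QMA_cls R F = cls (QMA_rels R F gen)"

definition REA_cls where "REA_cls R = cls (REA_rels R gen)"

text \<open>The homogeneous component $\mathcal M^p(R,F)$.\<close>

definition QMA_component :: "('n::finite, 'k::field) mat2 \<Rightarrow> ('n, 'k) mat2 \<Rightarrow> nat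
    \<Rightarrow> ('n \<times> 'n, 'k) free_alg set set" where
  "QMA_component R F p = QMA_cls R F ` {x. \<forall>w\<in>Poly_Mapping.keys x. length w = p}"

text \<open>
  The maps below are induced by homomorphisms on the free algebras; these are constant on each
  coset (up to the relations of the target), so the images are singletons.
\<close>

definition counit :: "('n::finite, 'k::field) mat2 \<Rightarrow> ('n \<times> 'n, 'k) free_alg set \<Rightarrow> 'k" where
  "counit R X = the_elem (fa_eval id (\<lambda>(i, j). if i = j then 1 else 0) ` X)"

definition REA_to_BR :: "'k \<Rightarrow> ('n::finite, 'k::field) mat2 \<Rightarrow> ('n, 'k) mat2
    \<Rightarrow> ('n \<times> 'n, 'k) free_alg set \<Rightarrow> (('n \<times> 'n) + ('n \<times> 'n), 'k) free_alg set" where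
  "REA_to_BR \<eta> R F X =
     the_elem ((\<lambda>x. cls (BR_rels \<eta> R F) (fa_eval fa_const (\<lambda>(i, j). genL i j) x)) ` X)"

definition QMA_to_BR :: "'k \<Rightarrow> ('n::finite, 'k::field) mat2 \<Rightarrow> ('n, 'k) mat2
    \<Rightarrow> ('n \<times> 'n, 'k) free_alg set \<Rightarrow> (('n \<times> 'n) + ('n \<times> 'n), 'k) free_alg set" where
  "QMA_to_BR \<eta> R F X =
     the_elem ((\<lambda>x. cls (BR_rels \<eta> R F) (fa_eval fa_const (\<lambda>(i, j). genM i j) x)) ` X)"


section \<open>The action\<close>

text \<open>
  \<open>c\<close> is a possible value of $a \triangleright b$: there is an expression
  $ab = \sum_i b_i a_i$ in $\mathcal B_r$ with $b_i \in \mathcal M(R,F)$,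
  $a_i \in \mathcal L(R)$ and $c = \sum_i b_i\,\varepsilon(a_i)$.
\<close>

definition action_value :: "'k \<Rightarrow> ('n::finite, 'k::field) mat2 \<Rightarrow> ('n, 'k) mat2
    \<Rightarrow> ('n \<times> 'n, 'k) free_alg set \<Rightarrow> ('n \<times> 'n, 'k) free_alg set
    \<Rightarrow> ('n \<times> 'n, 'k) free_alg set \<Rightarrow> bool" where
  "action_value \<eta> R F a b c \<longleftrightarrow>
     (\<exists>(N::nat) bs as.
        (\<forall>i<N. bs i \<in> carrier (QMA R F) \<and> as i \<in> carrier (REA R)) \<and>
        REA_to_BR \<eta> R F a \<otimes>\<^bsub>BR \<eta> R F\<^esub> QMA_to_BR \<eta> R F b =
          (\<Oplus>\<^bsub>BR \<eta> R F\<^esub>i\<in>{..<N}. QMA_to_BR \<eta> R F (bs i) \<otimes>\<^bsub>BR \<eta> R F\<^esub> REA_to_BR \<eta> R F (as i)) \<and>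
        c = (\<Oplus>\<^bsub>QMA R F\<^esub>i\<in>{..<N}. counit R (as i) \<odot>\<^bsub>QMA R F\<^esub> bs i))"

definition action :: "'k \<Rightarrow> ('n::finite, 'k::field) mat2 \<Rightarrow> ('n, 'k) mat2
    \<Rightarrow> ('n \<times> 'n, 'k) free_alg set \<Rightarrow> ('n \<times> 'n, 'k) free_alg set
    \<Rightarrow> ('n \<times> 'n, 'k) free_alg set" where
  "action \<eta> R F a b = (THE c. action_value \<eta> R F a b c)"

text \<open>
  $L_1 \triangleright X$ for a matrix \<open>X\<close> over $\mathcal M(R,F)$ (given by representatives):
  the matrix product in which entries are multiplied by $\triangleright$.
\<close>

definition L1_action :: "'k \<Rightarrow> ('n::finite, 'k::field) mat2 \<Rightarrow> ('n, 'k) mat2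
    \<Rightarrow> ('n, ('n \<times> 'n, 'k) free_alg) tmat \<Rightarrow> ('n, ('n \<times> 'n, 'k) free_alg set) tmat" where
  "L1_action \<eta> R F X xs ys =
     (\<Oplus>\<^bsub>QMA R F\<^esub>zs\<in>tidx (length xs).
        action \<eta> R F (REA_cls R (first_leg gen xs zs)) (QMA_cls R F (X zs ys)))"

end

theory Submission
  imports Defs
begin

text \<open>
  The algebra $\mathcal B_r$ is made to act on $\mathcal M(R,F)$. The generators $M_i^{\,j}$ act by left
  multiplication; since $R$ is skew-invertible, the relation
  $L_1R_1M_1=\eta R_1^{-1}M_1L_{\overline 2}$ can be solved for the products $L_i^{\,a}M_b^{\,k}$, and
  together with $L_i^{\,j}\triangleright 1=\delta_i^{\,j}$ this defines operators $L_i^{\,j}$ on the free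
  algebra in the $M_i^{\,j}$. Let $Q=R_1M_{\overline 1}M_{\overline 2}-M_{\overline 1}M_{\overline 2}R_1$ and
  $E=R_1L_1R_1L_1-L_1R_1L_1R_1$. The braid relations and compatibility give
  $L_1R_1R_2\,Q=\eta^2R_1^{-1}R_2^{-1}\,Q\,L_{\overline 3}$, so that the operators preserve the ideal generated
  by $Q$, and $E\,R_2R_1M_1=\eta^2R_2^{-1}R_1^{-1}M_1F_1F_2\,E\,F_2^{-1}F_1^{-1}$, so that, by induction on the
  degree, $E$ maps the free algebra into that ideal. Hence $\mathcal B_r$ acts on $\mathcal M(R,F)$.
  As $b\in\mathcal M(R,F)$ sends $1$ to $b$, the algebra $\mathcal M(R,F)$ embeds into $\mathcal B_r$, and
  applying $ab=\sum_ib_ia_i$ to $1$ shows that $\sum_ib_i\,\varepsilon(a_i)$ depends only on $a$ and $b$.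
  The formula for $\mathcal M^p(R,F)$ is the iterated exchange relation
  $L_1R_{1\to p}M_{\overline 1}\cdots M_{\overline p}
  =\eta^pR^{-1}_{1\to p}M_{\overline 1}\cdots M_{\overline p}L_{\overline{p+1}}$ applied to $1$, and
  skew-invertibility of $F$ shows that the entries of $M_{\overline 1}\cdots M_{\overline p}$ span
  $\mathcal M^p(R,F)$.
\<close>

section \<open>Free algebras and quotients\<close>

text \<open>No normal form for elements of B_r is at hand, so independence of a \<triangleright> b
  from the chosen expression has to come from a representation. On the free algebra in the M_i^j
  operators can be prescribed word by word, so the exchange relation holds there exactly, while the
  quadratic relations of M and of L hold only modulo the ideal. Exact operators together with
  membership in the ideal keep the computations out of the quotient. A second obstacle: the exchange
  relations control only combinations of the values L_i^a(M_b^k x), with coefficients from R_1,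
  R_1R_2 or R_2R_1, whereas each single value is needed. Skew-invertibility says that R is
  invertible after a partial transposition of indices; hence, if all combinations lie in a subspace,
  so does each value, one tensor factor being treated at a time. The same argument, run with left
  multiplications in the free algebra on both kinds of generators, shows that every product ab can
  be rewritten as a sum of products b_i a_i, so that a value of a \<triangleright> b exists.\<close>

lemma single_mult: "Poly_Mapping.single (u::'x list) (a::'k::field) * Poly_Mapping.single v b
    = Poly_Mapping.single (u @ v) (a * b)"
  by (simp add: mult_single plus_list_def)

lemma one_free: "(1 :: ('x, 'k::field) free_alg) = Poly_Mapping.single [] 1"
  by (metis single_one zero_list_def)

lemma fa_const_simps [simp]:
  "fa_const 0 = (0 :: ('x, 'k::field) free_alg)"
  "fa_const 1 = (1 :: ('x, 'k) free_alg)"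
  by (simp_all add: fa_const_def one_free)

lemma fa_const_add: "fa_const (a + b) = (fa_const a + fa_const b :: ('x, 'k::field) free_alg)"
  by (simp add: fa_const_def single_add)

lemma fa_const_mult: "fa_const (a * b) = (fa_const a * fa_const b :: ('x, 'k::field) free_alg)"
  by (simp add: fa_const_def single_mult)

lemma fa_sum_words:
  "x = (\<Sum>w\<in>Poly_Mapping.keys x. Poly_Mapping.single w (Poly_Mapping.lookup x w))"
  by (rule poly_mapping_eqI) (auto simp: lookup_sum lookup_single when_def
      not_in_keys_iff_lookup_eq_zero)

lemma fa_additive_induct:
  fixes x :: "('x, 'k::field) free_alg"
  assumes "\<And>x y. P x \<Longrightarrow> P y \<Longrightarrow> P (x + y)" "\<And>w c. P (Poly_Mapping.single w c)"
  shows "P x"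
proof -
  have "P (\<Sum>w\<in>A. Poly_Mapping.single w (Poly_Mapping.lookup x w))" if "finite A" for A
    using that
  proof (induction A)
    case empty
    show ?case using assms(2)[of "[]" 0] by simp
  qed (simp add: assms)
  then show ?thesis using fa_sum_words[of x] by (metis finite_keys)
qed

lemma fa_const_central: "fa_const c * x = x * (fa_const c :: ('x, 'k::field) free_alg)"
  by (induction x rule: fa_additive_induct) (simp_all add: algebra_simps fa_const_def single_mult)

lemma single_eq_const_mult: "Poly_Mapping.single w c
    = fa_const c * (Poly_Mapping.single w 1 :: ('x, 'k::field) free_alg)"
  by (simp add: fa_const_def single_mult)

lemma single_Cons: "Poly_Mapping.single (v # w) 1
    = fa_var v * (Poly_Mapping.single w 1 :: ('x, 'k::field) free_alg)"
  by (simp add: fa_var_def single_mult)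

text \<open>Words grow on the left, the side from which all operators act.\<close>

lemma fa_induct [case_names add scale one var]:
  fixes x :: "('x, 'k::field) free_alg"
  assumes "\<And>x y. P x \<Longrightarrow> P y \<Longrightarrow> P (x + y)" "\<And>c x. P x \<Longrightarrow> P (fa_const c * x)"
    and "P 1" "\<And>v x. P x \<Longrightarrow> P (fa_var v * x)"
  shows "P x"
proof -
  have 1: "P (Poly_Mapping.single w 1)" for w
    by (induction w) (use assms in \<open>simp_all add: single_Cons flip: one_free\<close>)
  have "P (Poly_Mapping.single w c)" for w c
    by (subst single_eq_const_mult) (rule assms(2)[OF 1])
  with assms(1) show ?thesis
    by (induction x rule: fa_additive_induct) auto
qed

definition fa_lin :: "('x list \<Rightarrow> ('y, 'k) free_alg) \<Rightarrow> ('x, 'k::field) free_alg \<Rightarrow>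
    ('y, 'k) free_alg" where
  "fa_lin g x = (\<Sum>w\<in>Poly_Mapping.keys x. fa_const (Poly_Mapping.lookup x w) * g w)"

lemma fa_lin_superset:
  assumes "finite A" "Poly_Mapping.keys x \<subseteq> A"
  shows "fa_lin g x = (\<Sum>w\<in>A. fa_const (Poly_Mapping.lookup x w) * g w)"
  unfolding fa_lin_def using assms
  by (intro sum.mono_neutral_left) (auto simp: not_in_keys_iff_lookup_eq_zero)

lemma fa_lin_add: "fa_lin g (x + y) = fa_lin g x + fa_lin g y"
proof -
  let ?A = "Poly_Mapping.keys x \<union> Poly_Mapping.keys y"
  have "Poly_Mapping.keys (x + y) \<subseteq> ?A" by (rule keys_add)
  then show ?thesis
    by (simp add: fa_lin_superset[of ?A] lookup_add fa_const_add distrib_right sum.distrib)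
qed

lemma fa_lin_single: "fa_lin g (Poly_Mapping.single w c) = fa_const c * g w"
  by (simp add: fa_lin_superset[of "{w}"])

lemma fa_lin_const_mult: "fa_lin g (fa_const c * x) = fa_const c * fa_lin g x"
  by (induction x rule: fa_additive_induct)
    (simp_all add: fa_lin_add distrib_left fa_lin_single fa_const_def single_mult
      flip: mult.assoc)

text \<open>A central embedding of the field into a ring. The instances are \<open>fa_const\<close>,
  \<open>id\<close> and later \<open>endo_const\<close>, so that one treatment of numerical matrices
  serves the free algebras, the field itself and the operators on a free algebra.\<close>

locale scalars =
  fixes \<phi> :: "'k::field \<Rightarrow> 'a::ring_1"
  assumes add: "\<phi> (a + b) = \<phi> a + \<phi> b"
    and mult: "\<phi> (a * b) = \<phi> a * \<phi> b"
    and one [simp]: "\<phi> 1 = 1"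
    and central: "\<phi> a * x = x * \<phi> a"
begin

lemma zero [simp]: "\<phi> 0 = 0"
  using add[of 0 0] by simp

lemma sum: "\<phi> (\<Sum>i\<in>A. f i) = (\<Sum>i\<in>A. \<phi> (f i))"
  by (induction A rule: infinite_finite_induct) (simp_all add: add)

lemma left_central: "x * (\<phi> c * y) = \<phi> c * (x * y)"
  by (metis central mult.assoc)

lemma fa_eval_superset:
  assumes "finite A" "Poly_Mapping.keys x \<subseteq> A"
  shows "fa_eval \<phi> f x = (\<Sum>w\<in>A. \<phi> (Poly_Mapping.lookup x w) * prod_list (map f w))"
  unfolding fa_eval_def using assms
  by (intro sum.mono_neutral_left) (auto simp: not_in_keys_iff_lookup_eq_zero)

lemma fa_eval_add: "fa_eval \<phi> f (x + y) = fa_eval \<phi> f x + fa_eval \<phi> f y"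
proof -
  let ?A = "Poly_Mapping.keys x \<union> Poly_Mapping.keys y"
  have "Poly_Mapping.keys (x + y) \<subseteq> ?A" by (rule keys_add)
  then show ?thesis
    by (simp add: fa_eval_superset[of ?A] lookup_add add distrib_right sum.distrib)
qed

lemma fa_eval_single: "fa_eval \<phi> f (Poly_Mapping.single w c) = \<phi> c * prod_list (map f w)"
  by (simp add: fa_eval_superset[of "{w}"])

lemma fa_eval_const [simp]: "fa_eval \<phi> f (fa_const c) = \<phi> c"
  by (simp add: fa_const_def fa_eval_single)

lemma fa_eval_var [simp]: "fa_eval \<phi> f (fa_var v) = f v"
  by (simp add: fa_var_def fa_eval_single)

lemma fa_eval_one [simp]: "fa_eval \<phi> f 1 = 1"
  using fa_eval_const[of f 1] by simp

lemma fa_eval_zero [simp]: "fa_eval \<phi> f 0 = 0"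
  using fa_eval_const[of f 0] by simp

lemma fa_eval_mult: "fa_eval \<phi> f (x * y) = fa_eval \<phi> f x * fa_eval \<phi> f y"
proof (induction x rule: fa_additive_induct)
  case (2 w c)
  show ?case
  proof (induction y rule: fa_additive_induct)
    case (2 v d)
    show ?case
      by (simp add: fa_eval_single single_mult mult mult.assoc left_central[of "prod_list _"])
  qed (simp add: fa_eval_add distrib_left)
qed (simp add: fa_eval_add distrib_right)

end

interpretation fa: scalars "fa_const :: 'k::field \<Rightarrow> ('x, 'k) free_alg"
  by unfold_locales (rule fa_const_add fa_const_mult fa_const_central fa_const_simps)+

interpretation id: scalars "id :: 'k::field \<Rightarrow> 'k"
  by unfold_locales (simp_all add: mult.commute)

lemma ring_free_ring: "ring (free_ring :: ('x, 'k::field) free_alg ring)"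
proof (rule ringI)
  have "\<exists>y. y + x = 0" for x :: "('x, 'k) free_alg"
    by (rule exI[of _ "- x"]) simp
  then show "abelian_group (free_ring :: ('x, 'k::field) free_alg ring)"
    by (intro abelian_groupI) (auto simp: free_ring_def add.assoc add.commute)
  show "Group.monoid (free_ring :: ('x, 'k::field) free_alg ring)"
    by (intro monoidI) (auto simp: free_ring_def mult.assoc)
qed (auto simp: free_ring_def algebra_simps)

lemma free_ring_simps [simp]:
  "carrier free_ring = UNIV" "x \<oplus>\<^bsub>free_ring\<^esub> y = x + y" "x \<otimes>\<^bsub>free_ring\<^esub> y = x * y"
  "\<one>\<^bsub>free_ring\<^esub> = 1" "\<zero>\<^bsub>free_ring\<^esub> = 0"
  by (simp_all add: free_ring_def)

lemma a_inv_free_ring [simp]: "\<ominus>\<^bsub>free_ring\<^esub> x = - x"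
  by (metis ring_free_ring UNIV_I abelian_group.minus_equality free_ring_simps(1,2,5)
      left_minus ring_def)

lemma ideal_rel_ideal: "ideal (rel_ideal S) free_ring"
  unfolding rel_ideal_def by (rule ring.genideal_ideal[OF ring_free_ring]) simp

lemma rel_ideal_incl: "x \<in> S \<Longrightarrow> x \<in> rel_ideal S"
  unfolding rel_ideal_def using ring.genideal_self[OF ring_free_ring, of S] by auto

lemma rel_ideal_add: "x \<in> rel_ideal S \<Longrightarrow> y \<in> rel_ideal S \<Longrightarrow> x + y \<in> rel_ideal S"
  using additive_subgroup.a_closed[OF ideal.axioms(1)[OF ideal_rel_ideal]]
      by (metis free_ring_simps(2))

lemma rel_ideal_zero [simp]: "0 \<in> rel_ideal S"
  using additive_subgroup.zero_closed[OF ideal.axioms(1)[OF ideal_rel_ideal]]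
      by (metis free_ring_simps(5))

lemma rel_ideal_left: "x \<in> rel_ideal S \<Longrightarrow> y * x \<in> rel_ideal S"
  using ideal.I_l_closed[OF ideal_rel_ideal, of x S y] by simp

lemma rel_ideal_right: "x \<in> rel_ideal S \<Longrightarrow> x * y \<in> rel_ideal S"
  using ideal.I_r_closed[OF ideal_rel_ideal, of x S y] by simp

lemma rel_ideal_uminus: "x \<in> rel_ideal S \<Longrightarrow> - x \<in> rel_ideal S"
  using rel_ideal_left[of x S "- 1"] by simp

lemma rel_ideal_diff: "x \<in> rel_ideal S \<Longrightarrow> y \<in> rel_ideal S \<Longrightarrow> x - y \<in> rel_ideal S"
  using rel_ideal_add[of x S "- y"] rel_ideal_uminus[of y S] by simp

lemma rel_ideal_sum: "(\<And>i. i \<in> A \<Longrightarrow> f i \<in> rel_ideal S) \<Longrightarrow> (\<Sum>i\<in>A. f i) \<in> rel_ideal S"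
  by (induction A rule: infinite_finite_induct) (simp_all add: rel_ideal_add)

text \<open>The elements with \<open>P\<close> form an ideal, closure under negation being left
  multiplication by -1, and \<open>rel_ideal S\<close> is the smallest ideal containing
  \<open>S\<close>.\<close>

lemma rel_ideal_induct [consumes 1, case_names incl zero add left right]:
  assumes "x \<in> rel_ideal S" "\<And>x. x \<in> S \<Longrightarrow> P x" "P 0" "\<And>x y. P x \<Longrightarrow> P y \<Longrightarrow> P (x + y)"
    "\<And>x y. P x \<Longrightarrow> P (y * x)" "\<And>x y. P x \<Longrightarrow> P (x * y)"
  shows "P x"
proof -
  have neg: "P (- x)" if "P x" for x using assms(5)[OF that, of "- 1"] by simp
  have "ideal {x. P x} free_ring"
  proof (rule idealI[OF ring_free_ring])
    show "subgroup {x. P x} (add_monoid free_ring)"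
    proof (rule group.subgroupI)
      show "Group.group (add_monoid (free_ring :: ('a, 'b) free_alg ring))"
        by (rule abelian_group.a_group[OF ring.is_abelian_group[OF ring_free_ring]])
      fix a assume "a \<in> {x. P x}"
      then show "inv\<^bsub>add_monoid free_ring\<^esub> a \<in> {x. P x}"
        using neg by (metis a_inv_def a_inv_free_ring mem_Collect_eq)
    qed (use assms(3,4) in auto)
  qed (use assms in auto)
  then have "rel_ideal S \<subseteq> {x. P x}"
    unfolding rel_ideal_def
    by (rule ring.genideal_minimal[OF ring_free_ring]) (use assms in auto)
  then show ?thesis using assms(1) by auto
qed

lemma mem_cls_iff: "y \<in> cls S x \<longleftrightarrow> y - x \<in> rel_ideal S"
  unfolding cls_def a_r_coset_def' by (auto simp: algebra_simps intro!: bexI[of _ "y - x"])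

lemma cls_eq_iff: "cls S x = cls S y \<longleftrightarrow> x - y \<in> rel_ideal S"
proof
  assume "cls S x = cls S y"
  then have "x \<in> cls S y" using mem_cls_iff[of x S x] by simp
  then show "x - y \<in> rel_ideal S" by (simp add: mem_cls_iff)
next
  assume *: "x - y \<in> rel_ideal S"
  have "z - x \<in> rel_ideal S \<longleftrightarrow> z - y \<in> rel_ideal S" for z
    using rel_ideal_add[OF _ *, of "z - x"] rel_ideal_diff[OF _ *, of "z - y"] by auto
  then show "cls S x = cls S y" by (auto simp: mem_cls_iff)
qed

lemma presented_simps:
  "carrier (presented S) = range (cls S)"
  "cls S x \<otimes>\<^bsub>presented S\<^esub> cls S y = cls S (x * y)"
  "cls S x \<oplus>\<^bsub>presented S\<^esub> cls S y = cls S (x + y)"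
  "\<one>\<^bsub>presented S\<^esub> = cls S 1"
  "\<zero>\<^bsub>presented S\<^esub> = cls S 0"
  "c \<odot>\<^bsub>presented S\<^esub> cls S x = cls S (fa_const c * x)"
proof -
  note I = ideal_rel_ideal[of S]
  have "cls S x \<otimes>\<^bsub>free_ring Quot rel_ideal S\<^esub> cls S y = cls S (x * y)" for x y
    using ideal.rcoset_mult_add[OF I, of x y] by (simp add: FactRing_def cls_def)
  then show "cls S x \<otimes>\<^bsub>presented S\<^esub> cls S y = cls S (x * y)"
    "c \<odot>\<^bsub>presented S\<^esub> cls S x = cls S (fa_const c * x)"
    by (simp_all add: presented_def ring.defs module.defs)
  show "carrier (presented S) = range (cls S)"
    by (auto simp: presented_def ring.defs module.defs FactRing_def A_RCOSETS_def' cls_def)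
  show "cls S x \<oplus>\<^bsub>presented S\<^esub> cls S y = cls S (x + y)"
  proof -
    have "cls S x <+>\<^bsub>free_ring\<^esub> cls S y = cls S (x + y)"
    proof (intro subset_antisym subsetI)
      fix z assume "z \<in> cls S x <+>\<^bsub>free_ring\<^esub> cls S y"
      then obtain h k where "z = h + k" "h - x \<in> rel_ideal S" "k - y \<in> rel_ideal S"
        by (auto simp: set_add_def' mem_cls_iff)
      then show "z \<in> cls S (x + y)"
        using rel_ideal_add[of "h - x" S "k - y"] by (simp add: mem_cls_iff algebra_simps)
    next
      fix z assume "z \<in> cls S (x + y)"
      then have "z - y \<in> cls S x" "y \<in> cls S y" by (simp_all add: mem_cls_iff algebra_simps)
      then show "z \<in> cls S x <+>\<^bsub>free_ring\<^esub> cls S y"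
        by (force simp: set_add_def')
    qed
    then show ?thesis by (simp add: presented_def ring.defs module.defs FactRing_def)
  qed
  show "\<one>\<^bsub>presented S\<^esub> = cls S 1"
    by (simp add: presented_def ring.defs module.defs FactRing_def cls_def)
  show "\<zero>\<^bsub>presented S\<^esub> = cls S 0"
    by (auto simp: presented_def ring.defs module.defs FactRing_def mem_cls_iff)
qed

lemma abelian_monoid_presented: "abelian_monoid (presented S)"
  by (rule abelian_monoidI) (auto simp: presented_simps add_ac)

text \<open>Reduces finite sums over the carrier of the quotient to ordinary sums of
  representatives.\<close>

lemma finsum_presented:
  assumes "finite A" "\<And>i. i \<in> A \<Longrightarrow> g i = cls S (f i)"
  shows "(\<Oplus>\<^bsub>presented S\<^esub>i\<in>A. g i) = cls S (\<Sum>i\<in>A. f i)"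
proof -
  interpret abelian_monoid "presented S" by (rule abelian_monoid_presented)
  have "(\<Oplus>\<^bsub>presented S\<^esub>i\<in>A. g i) = (\<Oplus>\<^bsub>presented S\<^esub>i\<in>A. cls S (f i))"
    using assms by (intro finsum_cong') (auto simp: presented_simps)
  also have "\<dots> = cls S (\<Sum>i\<in>A. f i)"
    using assms(1) by induction (simp_all add: presented_simps Pi_def)
  finally show ?thesis .
qed

text \<open>Evaluates the maps on cosets that are defined through \<open>the_elem\<close>, once they
  are seen to be constant along the ideal.\<close>

lemma the_elem_cls:
  assumes "\<And>y. y - x \<in> rel_ideal S \<Longrightarrow> h y = h x"
  shows "the_elem (h ` cls S x) = h x"
proof -
  have "x \<in> cls S x" by (simp add: mem_cls_iff)
  moreover have "h y = h x" if "y \<in> cls S x" for y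
    using assms[of y] that unfolding mem_cls_iff by blast
  ultimately have "h ` cls S x = {h x}" by blast
  then show ?thesis by simp
qed

section \<open>Matrices on tensor powers\<close>

lemma finite_tidx [simp]: "finite (tidx k :: 'n::finite list set)"
  using finite_lists_length_eq[of "UNIV :: 'n set" k] by (simp add: tidx_def)

lemma mem_tidx [simp]: "xs \<in> tidx k \<longleftrightarrow> length xs = k"
  by (simp add: tidx_def)

lemma sum_tidx_append:
  fixes f :: "'n::finite list \<Rightarrow> 'a::comm_monoid_add"
  shows "(\<Sum>zs\<in>tidx (p + k). f zs) = (\<Sum>us\<in>tidx p. \<Sum>vs\<in>tidx k. f (us @ vs))"
proof -
  have "(\<Sum>zs\<in>tidx (p + k). f zs) = (\<Sum>(us, vs)\<in>tidx p \<times> tidx k. f (us @ vs))"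
    by (rule sum.reindex_bij_witness[of _ "\<lambda>(us, vs). us @ vs" "\<lambda>zs. (take p zs, drop p zs)"]) auto
  then show ?thesis by (simp add: sum.cartesian_product)
qed

lemma tidx_0 [simp]: "tidx 0 = {[]}"
  by (auto simp: tidx_def)

lemma sum_tidx_1:
  fixes f :: "'n::finite list \<Rightarrow> 'a::comm_monoid_add"
  shows "(\<Sum>zs\<in>tidx (Suc 0). f zs) = (\<Sum>z\<in>UNIV. f [z])"
  by (rule sum.reindex_bij_witness[of _ "\<lambda>z. [z]" hd]) (auto simp: length_Suc_conv)

lemma sum_tidx_Cons:
  fixes f :: "'n::finite list \<Rightarrow> 'a::comm_monoid_add"
  shows "(\<Sum>zs\<in>tidx (Suc k). f zs) = (\<Sum>z\<in>UNIV. \<Sum>us\<in>tidx k. f (z # us))"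
  using sum_tidx_append[of f "Suc 0" k] by (simp add: sum_tidx_1)

lemma sum_tidx_snoc:
  fixes f :: "'n::finite list \<Rightarrow> 'a::comm_monoid_add"
  shows "(\<Sum>zs\<in>tidx (Suc k). f zs) = (\<Sum>us\<in>tidx k. \<Sum>z\<in>UNIV. f (us @ [z]))"
  using sum_tidx_append[of f k "Suc 0"] by (simp add: sum_tidx_1)

lemma tmul_assoc: "A \<cdot> B \<cdot> C = A \<cdot> (B \<cdot> (C :: ('n::finite, 'a::semiring_0) tmat))"
proof (intro ext)
  fix xs ys :: "'n list"
  let ?I = "tidx (length xs) :: 'n list set"
  have "(A \<cdot> B \<cdot> C) xs ys = (\<Sum>zs\<in>?I. \<Sum>us\<in>?I. A xs us * (B us zs * C zs ys))"
    by (simp add: tmul_def sum_distrib_right mult.assoc)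
  also have "\<dots> = (\<Sum>us\<in>?I. \<Sum>zs\<in>?I. A xs us * (B us zs * C zs ys))"
    by (rule sum.swap)
  also have "\<dots> = (A \<cdot> (B \<cdot> C)) xs ys"
    by (simp add: tmul_def sum_distrib_left)
  finally show "(A \<cdot> B \<cdot> C) xs ys = (A \<cdot> (B \<cdot> C)) xs ys" .
qed

lemma tmul_diff_left: "(A - B) \<cdot> C = A \<cdot> C - B \<cdot> (C :: ('n::finite, 'a::ring) tmat)"
  by (intro ext) (simp add: tmul_def left_diff_distrib sum_subtractf)

lemma tmul_diff_right: "A \<cdot> (B - C) = A \<cdot> B - A \<cdot> (C :: ('n::finite, 'a::ring) tmat)"
  by (intro ext) (simp add: tmul_def right_diff_distrib sum_subtractf)

lemma tone_tmul [simp]: "tone \<cdot> A = (A :: ('n::finite, 'a::semiring_1) tmat)"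
  by (intro ext) (simp add: tmul_def tone_def if_distrib[of "\<lambda>x. x * _"] sum.delta cong: if_cong)

lemma tmul_tone: "length ys = length xs
    \<Longrightarrow> (A \<cdot> tone) xs ys = (A :: ('n::finite, 'a::semiring_1) tmat) xs ys"
  by (simp add: tmul_def tone_def if_distrib[of "\<lambda>x. _ * x"] sum.delta' cong: if_cong)

lemma teqI: "(\<And>xs ys. length xs = k \<Longrightarrow> length ys = k \<Longrightarrow> A xs ys = B xs ys) \<Longrightarrow> teq k A B"
  by (simp add: teq_def)

lemma teqD: "teq k A B \<Longrightarrow> length xs = k \<Longrightarrow> length ys = k \<Longrightarrow> A xs ys = B xs ys"
  by (simp add: teq_def)

lemma teq_refl [simp]: "teq k A A"
  by (simp add: teq_def)

lemma teq_sym: "teq k A B \<Longrightarrow> teq k B A"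
  by (simp add: teq_def)

lemma teq_trans [trans]: "teq k A B \<Longrightarrow> teq k B C \<Longrightarrow> teq k A C"
  by (simp add: teq_def)

lemma teq_tmul: "teq k A A' \<Longrightarrow> teq k B B' \<Longrightarrow> teq k (A \<cdot> B) (A' \<cdot> B')"
  by (simp add: teq_def tmul_def)

lemma teq_tmul_tone: "teq k (A \<cdot> tone) (A :: ('n::finite, 'a::semiring_1) tmat)"
  by (simp add: teq_def tmul_tone)

text \<open>Vanishing at index lists of different lengths makes \<open>tone\<close> a right unit as
  well: a product reads its level off the left index, so \<open>A \<cdot> tone\<close> is 0 wherever
  the lengths differ. On this type the identities of an abstract monoid apply to matrices.\<close>

typedef (overloaded) ('n, 'a::semiring_1) lmat =
  "{A :: ('n, 'a) tmat. \<forall>xs ys. length xs \<noteq> length ys \<longrightarrow> A xs ys = 0}"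
  by (rule exI[of _ "\<lambda>_ _. 0"]) simp

setup_lifting type_definition_lmat

instantiation lmat :: (finite, semiring_1) monoid_mult
begin

lift_definition one_lmat :: "('a, 'b) lmat" is tone
  by (auto simp: tone_def)

lift_definition times_lmat :: "('a, 'b) lmat \<Rightarrow> ('a, 'b) lmat \<Rightarrow> ('a, 'b) lmat" is "(\<cdot>)"
  by (simp add: tmul_def)

instance
proof
  fix A B C :: "('a, 'b) lmat"
  show "A * B * C = A * (B * C)" by transfer (rule tmul_assoc)
  show "1 * A = A" by transfer simp
  show "A * 1 = A"
  proof (transfer, intro ext)
    fix A :: "('a, 'b) tmat" and xs ys
    assume *: "\<forall>xs ys. length xs \<noteq> length ys \<longrightarrow> A xs ys = 0"
    show "(A \<cdot> tone) xs ys = A xs ys"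
    proof (cases "length ys = length xs")
      case False
      with * show ?thesis by (auto simp: tmul_def tone_def intro!: sum.neutral)
    qed (simp add: tmul_tone)
  qed
qed

end

text \<open>
  The value of \<open>at_level k A\<close> away from level \<open>k\<close> is the identity, so that \<open>at_level k\<close> is a
  homomorphism of monoids with unit.
\<close>

lift_definition at_level :: "nat \<Rightarrow> ('n, 'a::semiring_1) tmat \<Rightarrow> ('n, 'a) lmat" is
  "\<lambda>k A xs ys. if length xs = k \<and> length ys = k then A xs ys else tone xs ys"
  by (auto simp: tone_def)

lemma teq_iff_at_level: "teq k A B \<longleftrightarrow> at_level k A = at_level k B"
  by transfer (force simp: teq_def fun_eq_iff)

lemma at_level_tmul: "at_level k (A \<cdot> B)
    = at_level k A * at_level k (B :: ('n::finite, 'a::semiring_1) tmat)"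
proof (transfer, intro ext)
  fix k and A B :: "('n, 'a) tmat" and xs ys
  let ?T = "\<lambda>A xs ys. if length xs = k \<and> length ys = k then A xs ys else tone xs ys :: 'a"
  show "?T (A \<cdot> B) xs ys = (?T A \<cdot> ?T B) xs ys"
  proof (cases "length xs = k")
    case True
    then show ?thesis
      by (cases "length ys = k") (auto simp: tmul_def tone_def intro!: sum.neutral)
  next
    case False
    then have "(?T A \<cdot> ?T B) xs ys = (tone \<cdot> tone) xs ys"
      by (simp add: tmul_def del: tone_tmul)
    also have "\<dots> = tone xs ys" by (simp only: tone_tmul)
    finally show ?thesis using False by simp
  qed
qed

lemma at_level_tone [simp]: "at_level k tone = 1"
  by transfer auto

section \<open>Tensor products of matrices and matrices placed in a block of factors\<close>

definition kron :: "nat \<Rightarrow> ('n, 'a::times) tmat \<Rightarrow> ('n, 'a) tmat \<Rightarrow> ('n, 'a) tmat" where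
  "kron p A B xs ys = A (take p xs) (take p ys) * B (drop p xs) (drop p ys)"

text \<open>Just one pair changes places, \<open>B\<close> and \<open>C\<close>; over a
  noncommutative ring their entries must therefore commute.\<close>

lemma kron_tmul:
  fixes A B C D :: "('n::finite, 'a::semiring_1) tmat"
  assumes "p \<le> k" and "\<And>us vs us' vs'. B us vs * C us' vs' = C us' vs' * B us vs"
  shows "teq k (kron p A B \<cdot> kron p C D) (kron p (A \<cdot> C) (B \<cdot> D))"
proof (rule teqI)
  fix xs ys :: "'n list" assume len: "length xs = k" "length ys = k"
  let ?f = "\<lambda>zs. kron p A B xs zs * kron p C D zs ys"
  have "sum ?f (tidx k) = (\<Sum>us\<in>tidx p. \<Sum>vs\<in>tidx (k - p). ?f (us @ vs))"
    using sum_tidx_append[of ?f p "k - p"] assms(1) by simp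
  then have "(kron p A B \<cdot> kron p C D) xs ys =
    (\<Sum>us\<in>tidx p. \<Sum>vs\<in>tidx (k - p). A (take p xs) us * B (drop p xs) vs * (C us (take p ys)
        * D vs (drop p ys)))"
    by (simp add: tmul_def kron_def len)
  also have "\<dots> = (\<Sum>us\<in>tidx p. \<Sum>vs\<in>tidx (k - p). (A (take p xs) us * C us (take p ys))
      * (B (drop p xs) vs * D vs (drop p ys)))"
    by (intro sum.cong refl) (metis assms(2) mult.assoc)
  also have "\<dots> = kron p (A \<cdot> C) (B \<cdot> D) xs ys"
    using assms(1) len by (simp add: tmul_def kron_def sum_product min_def)
  finally show "(kron p A B \<cdot> kron p C D) xs ys = kron p (A \<cdot> C) (B \<cdot> D) xs ys" .
qed

lemma kron_cong:
  assumes "teq p A A'" "teq (k - p) B B'" "p \<le> k"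
  shows "teq k (kron p A B) (kron p A' B')"
  using assms by (simp add: teq_def kron_def)

text \<open>I \<otimes> A \<otimes> I, with \<open>A\<close> in the factors \<open>i + 1\<close>,
  ..., \<open>i + k\<close>. The last \<open>tone\<close> covers whatever factors remain, so the
  total number of factors is not a parameter.\<close>

definition embed_at :: "nat \<Rightarrow> nat \<Rightarrow> ('n, 'a::semiring_1) tmat \<Rightarrow> ('n, 'a) tmat" where
  "embed_at i k A = kron i tone (kron k A tone)"

lemma embed_at_tmul:
  assumes "i + k \<le> K"
  shows "teq K (embed_at i k (A \<cdot> B)) (embed_at i k A
      \<cdot> embed_at i k (B :: ('n::finite, 'a::semiring_1) tmat))"
proof -
  have "teq (K - i) (kron k A tone \<cdot> kron k B tone) (kron k (A \<cdot> B) (tone \<cdot> tone))"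
    by (rule kron_tmul) (use assms in \<open>auto simp: tone_def\<close>)
  then have 1: "teq (K - i) (kron k A tone \<cdot> kron k B tone) (kron k (A \<cdot> B) tone)" by simp
  have "teq K (kron i tone (kron k A tone) \<cdot> kron i tone (kron k B tone))
      (kron i (tone \<cdot> tone) (kron k A tone \<cdot> kron k B tone))"
    by (rule kron_tmul) (use assms in \<open>auto simp: tone_def\<close>)
  then have "teq K (embed_at i k A \<cdot> embed_at i k B) (kron i tone (kron k A tone \<cdot> kron k B tone))"
    by (simp add: embed_at_def)
  also have "teq K \<dots> (embed_at i k (A \<cdot> B))"
    unfolding embed_at_def using 1 assms by (intro kron_cong) auto
  finally show ?thesis by (rule teq_sym)
qed

lemma embed_at_cong: "teq k A B \<Longrightarrow> i + k \<le> K \<Longrightarrow> teq K (embed_at i k A) (embed_at i k B)"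
  unfolding embed_at_def by (intro kron_cong) auto

lemma kron_tone: "p \<le> k \<Longrightarrow> teq k (kron p tone tone) (tone :: ('n, 'a::semiring_1) tmat)"
  by (rule teqI) (auto simp: kron_def tone_def, metis append_take_drop_id)

lemma embed_at_leg:
  assumes "1 \<le> d" "d < k" "i + k \<le> K"
  shows "teq K (embed_at i k (leg d X)) (leg (i + d) (X :: ('n::finite, 'k::semiring_1) mat2))"
proof (rule teqI)
  fix xs ys :: "'n list" assume len: "length xs = K" "length ys = K"
  have "\<exists>a b c. zs = a @ b @ c \<and> length a = i \<and> length b = k" if "length zs = K" for zs :: "'n list"
    using that assms(3)
    by (intro exI[of _ "take i zs"] exI[of _ "take k (drop i zs)"] exI[of _ "drop k (drop i zs)"])
      (simp del: drop_drop)
  then obtain a b c a' b' c' where *: "xs = a @ b @ c" "ys = a' @ b' @ c'"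
    "length a = i" "length a' = i" "length b = k" "length b' = k"
    using len by metis
  have "drop (Suc d) b @ c = drop (Suc d) b' @ c' \<longleftrightarrow> drop (Suc d) b = drop (Suc d) b' \<and> c = c'"
    "a @ take (d - 1) b = a' @ take (d - 1) b' \<longleftrightarrow> a = a' \<and> take (d - 1) b = take (d - 1) b'"
    using * by simp_all
  then show "embed_at i k (leg d X) xs ys = leg (i + d) X xs ys"
    using * assms(1,2)
    by (auto simp: embed_at_def kron_def tone_def leg_def nth_append simp del:
        append_eq_append_conv)
qed

lemma embed_at_tone: "i + k \<le> K \<Longrightarrow> teq K (embed_at i k tone) (tone :: ('n, 'a::semiring_1) tmat)"
  by (rule teq_trans[OF _ kron_tone[of i K]]) (auto simp: embed_at_def intro!: kron_cong kron_tone)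

text \<open>Every leg is a translate of the first one, so an identity at a single leg position has
  to be verified on two factors only.\<close>

lemma leg_eq_embed_at:
  "1 \<le> i \<Longrightarrow> i < K \<Longrightarrow> teq K (leg i (X :: ('n::finite, 'k::semiring_1) mat2)) (embed_at (i
      - 1) 2 (leg 1 X))"
  using embed_at_leg[of 1 2 "i - 1" K X] by (auto intro: teq_sym)

lemma UNIV_pair_sum: "(\<Sum>z\<in>UNIV. f (z :: 'a::finite \<times> 'b::finite)) = (\<Sum>a\<in>UNIV. \<Sum>b\<in>UNIV. f (a, b))"
  by (simp add: sum.cartesian_product)

lemma leg_mult:
  assumes "1 \<le> i" "i < K"
  shows "teq K (leg i X \<cdot> leg i Y) (leg i (X ** (Y :: ('n::finite, 'k::semiring_1) mat2)))"
proof -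
  have "teq 2 (leg 1 X \<cdot> leg 1 Y) (leg 1 (X ** Y))"
    by (auto simp: teq_def numeral_2_eq_2 length_Suc_conv tmul_def sum_tidx_Cons leg_def
        matrix_matrix_mult_def UNIV_pair_sum)
  then have "teq K (embed_at (i - 1) 2 (leg 1 X \<cdot> leg 1 Y)) (embed_at (i - 1) 2 (leg 1 (X ** Y)))"
    using assms by (intro embed_at_cong) auto
  moreover have "teq K (embed_at (i - 1) 2 (leg 1 X \<cdot> leg 1 Y)) (leg i X \<cdot> leg i Y)"
    using assms by (intro teq_trans[OF embed_at_tmul] teq_tmul leg_eq_embed_at[THEN teq_sym]) auto
  ultimately show ?thesis
    using leg_eq_embed_at[OF assms] teq_sym teq_trans by blast
qed

lemma leg_mat_1:
  assumes "1 \<le> i" "i < K"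
  shows "teq K (leg i (mat 1 :: ('n::finite, 'k::semiring_1) mat2)) tone"
proof -
  have "teq 2 (leg 1 (mat 1 :: ('n, 'k) mat2)) tone"
    by (auto simp: teq_def numeral_2_eq_2 length_Suc_conv leg_def mat_def tone_def)
  then show ?thesis
    using assms by (intro teq_trans[OF leg_eq_embed_at[OF assms] teq_trans[OF embed_at_cong
        embed_at_tone]]) auto
qed

lemma leg_inverse:
  fixes X :: "('n::finite, 'k::semiring_1) mat2"
  assumes "X ** Y = mat 1" "1 \<le> i" "i < K"
  shows "teq K (leg i X \<cdot> leg i Y) tone"
  using leg_mult[OF assms(2,3), of X Y] leg_mat_1[OF assms(2,3)] unfolding assms(1)
      by (rule teq_trans)

lemma kron_tone_leg:
  assumes "p < j" "j < K"
  shows "teq K (kron p tone (leg (j - p) X)) (leg j (X :: ('n::finite, 'k::semiring_1) mat2))"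
proof -
  have "teq K (kron p tone (leg (j - p) X)) (kron p tone (embed_at (j - p - 1) 2 (leg 1 X)))"
    using assms by (intro kron_cong leg_eq_embed_at) auto
  also have "teq K \<dots> (embed_at (j - 1) 2 (leg 1 X))"
  proof (rule teqI)
    fix xs ys :: "'n list" assume "length xs = K" "length ys = K"
    have "take (j - 1) zs = take p zs @ take (j - p - 1) (drop p zs)" for zs :: "'n list"
      using assms(1) by (simp add: take_add[symmetric])
    moreover have "p + (j - p - 1) = j - 1" using assms(1) by simp
    ultimately show "kron p tone (embed_at (j - p - 1) 2 (leg 1 X)) xs ys
        = embed_at (j - 1) 2 (leg 1 X) xs ys"
      using \<open>length xs = K\<close> \<open>length ys = K\<close> assms
      by (auto simp: kron_def embed_at_def tone_def min_def)
  qed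
  also have "teq K \<dots> (leg j X)"
    using assms by (intro leg_eq_embed_at[THEN teq_sym]) auto
  finally show ?thesis .
qed

lemma kron_leg_tone:
  assumes "1 \<le> i" "i < p" "p \<le> K"
  shows "teq K (kron p (leg i X) tone) (leg i (X :: ('n::finite, 'k::semiring_1) mat2))"
  using embed_at_leg[of i p 0 K X] assms
      by (simp add: embed_at_def kron_def[of 0] teq_def tone_def[of "[]"])

lemma kron_commute:
  assumes "p \<le> K" "\<And>us us' vs vs'. A us us' * B vs vs' = B vs vs' * (A us us' :: 'a::semiring_1)"
  shows "teq K (kron p A tone \<cdot> kron p tone B) (kron p tone B
      \<cdot> kron p (A :: ('n::finite, 'a) tmat) tone)"
proof -
  have "teq K (kron p A tone \<cdot> kron p tone B) (kron p (A \<cdot> tone) (tone \<cdot> B))"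
    by (rule kron_tmul[OF assms(1)]) (simp add: tone_def)
  also have "teq K \<dots> (kron p (tone \<cdot> A) (B \<cdot> tone))"
    using assms(1) by (intro kron_cong) (simp_all add: teq_tmul_tone teq_tmul_tone[THEN teq_sym])
  also have "teq K \<dots> (kron p tone B \<cdot> kron p A tone)"
    by (rule kron_tmul[OF assms(1), THEN teq_sym]) (simp add: assms(2))
  finally show ?thesis .
qed

text \<open>Cutting after \<open>j - 1\<close> factors puts the two legs into different tensor
  factors.\<close>

lemma leg_far:
  assumes "1 \<le> i" "i + 1 < j" "j < K"
  shows "teq K (leg i X \<cdot> leg j Y) (leg j Y \<cdot> leg i (X :: ('n::finite, 'k::comm_semiring_1) mat2))"
proof -
  have "teq K (leg i X) (kron (j - 1) (leg i X) tone)" "teq K (leg j Y) (kron (j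
      - 1) tone (leg 1 Y))"
    using assms kron_leg_tone[of i "j - 1" K X] kron_tone_leg[of "j - 1" j K Y]
        by (auto intro: teq_sym)
  moreover have "teq K (kron (j - 1) (leg i X) tone \<cdot> kron (j - 1) tone (leg 1 Y))
      (kron (j - 1) tone (leg 1 Y) \<cdot> kron (j - 1) (leg i X) tone)"
    using assms by (intro kron_commute) (auto simp: mult.commute)
  ultimately show ?thesis
    by (meson teq_tmul teq_sym teq_trans)
qed

lemma first_leg_eq_kron:
  "1 \<le> K \<Longrightarrow> teq K (first_leg M) (kron 1 (\<lambda>us vs. M (hd us) (hd vs)) (tone ::
      ('n, 'a::semiring_1) tmat))"
proof (rule teqI)
  fix xs ys :: "'n list" assume "1 \<le> K" "length xs = K" "length ys = K"
  then show "first_leg M xs ys = kron 1 (\<lambda>us vs. M (hd us) (hd vs)) tone xs ys"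
    by (cases xs; cases ys) (auto simp: first_leg_def kron_def tone_def)
qed

lemma embed_at_first_leg: "1 \<le> K \<Longrightarrow> k \<ge> 1 \<Longrightarrow> k \<le> K
    \<Longrightarrow> teq K (embed_at 0 k (first_leg M)) (first_leg (M :: 'n \<Rightarrow> 'n \<Rightarrow> 'a::semiring_1))"
proof (rule teqI)
  fix xs ys :: "'n list" assume *: "1 \<le> K" "k \<ge> 1" "k \<le> K" "length xs = K" "length ys = K"
  then obtain x xs' y ys' where **: "xs = x # xs'" "ys = y # ys'" by (cases xs; cases ys) auto
  obtain k' where k: "k = Suc k'" using * by (cases k) auto
  have "(take k' xs' = take k' ys' \<and> drop k' xs' = drop k' ys') \<longleftrightarrow> xs' = ys'"
    by (metis append_take_drop_id)
  then show "embed_at 0 k (first_leg M) xs ys = first_leg M xs ys"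
    by (auto simp: ** k embed_at_def kron_def tone_def first_leg_def)
qed

section \<open>Exchange relations\<close>

text \<open>\<open>gnum\<close>, \<open>gbar\<close> and \<open>gbar_prod\<close> are
  \<open>num\<close>, \<open>bar\<close> and \<open>bar_prod\<close> over an arbitrary scalar map,
  so that the same matrix formulas can be read in a free algebra and in its ring of linear
  operators.\<close>

definition gnum :: "('k \<Rightarrow> 'a) \<Rightarrow> ('n, 'k) tmat \<Rightarrow> ('n, 'a) tmat" where
  "gnum \<phi> A xs ys = \<phi> (A xs ys)"

primrec gbar :: "('k::field \<Rightarrow> 'a::ring_1) \<Rightarrow> ('n::finite, 'k) mat2 \<Rightarrow> ('n \<Rightarrow> 'n \<Rightarrow> 'a) \<Rightarrow> nat \<Rightarrow>
    ('n, 'a) tmat" where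
  "gbar \<phi> F X 0 = tone"
| "gbar \<phi> F X (Suc k) =
     (if k = 0 then first_leg X
      else gnum \<phi> (leg k F) \<cdot> gbar \<phi> F X k \<cdot> gnum \<phi> (leg k (matrix_inv F)))"

primrec gbar_prod :: "('k::field \<Rightarrow> 'a::ring_1) \<Rightarrow> ('n::finite, 'k) mat2 \<Rightarrow> ('n \<Rightarrow> 'n \<Rightarrow> 'a) \<Rightarrow> nat \<Rightarrow>
    ('n, 'a) tmat" where
  "gbar_prod \<phi> F X 0 = tone"
| "gbar_prod \<phi> F X (Suc p) = gbar_prod \<phi> F X p \<cdot> gbar \<phi> F X (Suc p)"

lemma num_eq_gnum: "num = gnum fa_const"
  by (intro ext) (simp add: num_def gnum_def)

lemma bar_eq_gbar: "bar F X k = gbar fa_const F X k"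
  by (induction k) (simp_all add: num_eq_gnum)

lemma bar_prod_eq_gbar_prod: "bar_prod F X p = gbar_prod fa_const F X p"
  by (induction p) (simp_all add: bar_eq_gbar del: bar.simps gbar.simps)

lemma gnum_teq: "teq k A B \<Longrightarrow> teq k (gnum \<phi> A) (gnum \<phi> B)"
  by (simp add: teq_def gnum_def)

definition smult2 :: "'k::times \<Rightarrow> ('n::finite, 'k) mat2 \<Rightarrow> ('n, 'k) mat2" where
  "smult2 c X = (\<chi> i j. c * X $ i $ j)"

lemma leg_smult2: "leg i (smult2 c X) xs ys = c * (leg i X xs ys :: 'k::semiring_1)"
  by (simp add: leg_def smult2_def)

lemma leg_chain_smult2:
  "leg_chain (smult2 c X) p xs ys = c ^ p * (leg_chain X p xs ys :: 'k::comm_semiring_1)"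
  by (induction p arbitrary: xs ys) (simp_all add: tmul_def leg_smult2 sum_distrib_left ac_simps)

lemma invertible_matrix_inv:
  assumes "invertible (A :: 'k::field ^ 'm ^ 'm)"
  shows "A ** matrix_inv A = mat 1" "matrix_inv A ** A = mat 1"
proof -
  have "A ** matrix_inv A = mat 1 \<and> matrix_inv A ** A = mat 1"
    using assms unfolding invertible_def matrix_inv_def by (rule someI_ex)
  then show "A ** matrix_inv A = mat 1" "matrix_inv A ** A = mat 1" by auto
qed

context scalars
begin

lemma gnum_tmul: "gnum \<phi> (A \<cdot> B) = gnum \<phi> A \<cdot> gnum \<phi> (B :: ('n::finite, 'k) tmat)"
  by (intro ext) (simp add: gnum_def tmul_def sum mult)

lemma gnum_tone [simp]: "gnum \<phi> tone = tone"
  by (intro ext) (simp add: gnum_def tone_def)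

lemma first_leg_commute:
  assumes "2 \<le> j" "j < K"
  shows "teq K (first_leg M \<cdot> gnum \<phi> (leg j X)) (gnum \<phi> (leg j X)
      \<cdot> first_leg (M :: 'n::finite \<Rightarrow> 'n \<Rightarrow> 'a))"
proof -
  let ?M = "kron 1 (\<lambda>us vs. M (hd us) (hd vs)) tone" and ?X = "kron 1 tone (gnum \<phi> (leg (j - 1) X))"
  have "teq K (gnum \<phi> (kron 1 tone (leg (j - 1) X))) (gnum \<phi> (leg j X))"
    using assms by (intro gnum_teq kron_tone_leg) auto
  moreover have "gnum \<phi> (kron 1 tone (leg (j - 1) X)) = ?X"
    by (intro ext) (simp add: gnum_def kron_def tone_def)
  ultimately have "teq K (gnum \<phi> (leg j X)) ?X" by (simp add: teq_sym)
  moreover have "teq K (first_leg M) ?M" using assms by (intro first_leg_eq_kron) auto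
  moreover have "teq K (?M \<cdot> ?X) (?X \<cdot> ?M)"
    using assms by (intro kron_commute) (auto simp: gnum_def central)
  ultimately show ?thesis by (meson teq_tmul teq_sym teq_trans)
qed

end

section \<open>Exchange identities in an abstract monoid\<close>

lemma (in monoid_mult) inverse_move:
  assumes "g * gi = 1" "fi * f = 1" "a * f * g = f * g * b"
  shows "fi * a * f = g * b * gi"
proof -
  have "fi * a * f = fi * (a * f * g) * gi" by (simp add: mult.assoc assms(1))
  also have "\<dots> = fi * (f * g * b) * gi" by (simp only: assms(3))
  also have "\<dots> = (fi * f) * g * b * gi" by (simp only: mult.assoc)
  finally show ?thesis by (simp add: assms(2))
qed

text \<open>
  In the next three lemmas \<open>f\<close>, \<open>g\<close> stand for $F_k$, $F_{k+1}$, \<open>r\<close>, \<open>r'\<close> for $R_k$, $R_{k+1}$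
  and \<open>s\<close>, \<open>s'\<close> for $\eta R_k^{-1}$, $\eta R_{k+1}^{-1}$.
\<close>

lemma (in monoid_mult) cross_shift:
  assumes inv: "f * fi = 1" "fi * f = 1" "g * gi = 1" "gi * g = 1"
    and braid: "f * g * f = g * f * g"
    and R: "r' * f * g = f * g * r" and S: "s' * f * g = f * g * s"
    and comm: "g * L = L * g" "g * M = M * g"
    and cross: "L * r * M = s * M * (f * L * fi)"
  shows "(f * L * fi) * r' * (f * M * fi) = s' * (f * M * fi) * (g * (f * L * fi) * gi)"
proof -
  have fgf: "fi * g * f = g * f * gi"
    by (rule inverse_move) (use inv braid in auto)
  have "fi * gi * fi = gi * fi * gi"
  proof -
    have "fi * gi * fi * (f * g * f) = 1" "(g * f * g) * (gi * fi * gi) = 1"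
      by (metis inv mult.assoc mult_1_left mult_1_right)+
    then show ?thesis by (metis braid mult.assoc mult_1_left mult_1_right)
  qed
  note inv_braid = this
  have giM: "gi * M = M * gi" and giL: "gi * L = L * gi"
    by (metis comm inv mult.assoc mult_1_left mult_1_right)+
  have "(f * L * fi) * r' * (f * M * fi) = f * L * (fi * r' * f) * M * fi"
    by (simp add: mult.assoc)
  \<comment> \<open>The outer factors \<open>g\<close> and \<open>gi\<close> commute with
    \<open>L\<close> and \<open>M\<close>, which exposes \<open>L * r * M\<close> for the use of
    \<open>cross\<close>.\<close>
  also have "fi * r' * f = g * r * gi" by (rule inverse_move) (use inv R in auto)
  also have "f * L * (g * r * gi) * M * fi = f * (L * g) * r * (gi * M) * fi"
    by (simp add: mult.assoc)
  also have "\<dots> = f * g * (L * r * M) * gi * fi"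
    by (simp add: giM comm[symmetric] mult.assoc)
  also have "\<dots> = f * g * (s * M * (f * L * fi)) * gi * fi"
    by (simp only: cross)
  also have "\<dots> = (f * g * s) * M * f * L * (fi * gi * fi)"
    by (simp only: mult.assoc)
  also have "\<dots> = (s' * f * g) * M * f * L * (gi * fi * gi)"
    by (simp only: S inv_braid)
  also have "\<dots> = s' * f * (g * M) * f * (L * gi) * fi * gi"
    by (simp only: mult.assoc)
  also have "\<dots> = s' * f * (M * g) * f * (gi * L) * fi * gi"
    by (simp only: comm giL)
  also have "\<dots> = s' * f * M * (g * f * gi) * L * fi * gi"
    by (simp only: mult.assoc)
  also have "\<dots> = s' * f * M * (fi * g * f) * L * fi * gi"
    by (simp only: fgf)
  finally show ?thesis by (simp add: mult.assoc)
qed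

lemma (in monoid_mult) ideal_identity:
  assumes inv: "f * fi = 1" "fi * f = 1" "g * gi = 1" "gi * g = 1"
    and braid: "r * r' * r = r' * r * r'"
    and S: "s * s' * r = r' * s * s'"
    and F: "r * g * f = g * f * r'"
    and comm: "r' * L = L * r'"
    and cross: "L * (r * r') * N = s * s' * N * (g * (f * L * fi) * gi)"
  shows "L * (r * r') * (r * N) = s * s' * (r * N) * (g * (f * L * fi) * gi)" (is ?A)
    and "L * (r * r') * (N * r) = s * s' * (N * r) * (g * (f * L * fi) * gi)" (is ?B)
proof -
  have "L * (r * r') * (r * N) = L * (r * r' * r) * N" by (simp add: mult.assoc)
  \<comment> \<open>By the braid relation the additional R_1 leaves on the left as R_2, which
    commutes with L_1; the relation \<open>S\<close> turns it back into R_1 behind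
    \<open>s * s'\<close>.\<close>
  also have "\<dots> = (L * r') * r * r' * N" by (simp only: braid) (simp only: mult.assoc)
  also have "\<dots> = r' * (L * (r * r') * N)" by (simp only: comm[symmetric] mult.assoc)
  also have "\<dots> = (r' * s * s') * N * (g * (f * L * fi) * gi)"
    by (simp only: cross) (simp only: mult.assoc)
  also have "\<dots> = (s * s' * r) * N * (g * (f * L * fi) * gi)" by (simp only: S)
  finally show ?A by (simp only: mult.assoc)
  \<comment> \<open>For the other term R_1 has to commute with F_2F_1L_1F_1^{-1}F_2^{-1}:
    compatibility makes it R_2 inside the conjugation, and R_2 commutes with L_1.\<close>
  have "fi * gi * r = r' * fi * gi"
  proof -
    have "fi * gi * r = fi * gi * (r * g * f) * fi * gi"
      by (metis inv mult.assoc mult_1_left mult_1_right)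
    also have "\<dots> = fi * gi * (g * f * r') * fi * gi" by (simp only: F)
    also have "\<dots> = fi * (gi * g) * f * r' * fi * gi" by (simp only: mult.assoc)
    finally show ?thesis by (simp add: inv)
  qed
  then have "(g * (f * L * fi) * gi) * r = g * f * (L * r') * fi * gi"
    by (simp add: mult.assoc)
  also have "\<dots> = (g * f * r') * L * fi * gi" by (simp only: comm[symmetric] mult.assoc)
  also have "\<dots> = (r * g * f) * L * fi * gi" by (simp only: F)
  also have "\<dots> = r * (g * (f * L * fi) * gi)" by (simp only: mult.assoc)
  finally have "(g * (f * L * fi) * gi) * r = r * (g * (f * L * fi) * gi)" .
  note b_comm = this
  have "L * (r * r') * (N * r) = (L * (r * r') * N) * r" by (simp add: mult.assoc)
  also have "\<dots> = s * s' * N * ((g * (f * L * fi) * gi) * r)"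
    by (simp only: cross) (simp only: mult.assoc)
  also have "\<dots> = s * s' * N * (r * (g * (f * L * fi) * gi))" by (simp only: b_comm)
  finally show ?B by (simp only: mult.assoc)
qed

lemma (in monoid_mult) reflection_identity:
  assumes inv: "f * fi = 1" "fi * f = 1" "g * gi = 1" "gi * g = 1"
    and braid: "r * r' * r = r' * r * r'"
    and S: "r * r' * s = s' * r * r'" "r * s' * s = s' * s * r'"
    and F: "r' * f * g = f * g * r"
    and comm: "r' * L = L * r'" "r' * M = M * r'" "s' * L = L * s'" "g * L = L * g"
    and cross: "L * r * M = s * M * (f * L * fi)"
  shows "r * L * r * L * (r' * r) * M = s' * s * M * (f * g) * (r * L * r * L) * (gi * fi)" (is ?A)
    and "L * r * L * r * (r' * r) * M = s' * s * M * (f * g) * (L * r * L * r) * (gi * fi)" (is ?B)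
proof -
  let ?L = "f * L * fi"
  \<comment> \<open>\<open>M\<close> passes both copies of \<open>L\<close>. Moving
    \<open>r'\<close> past \<open>L\<close> frees \<open>L * r * M\<close> for the first use of
    \<open>cross\<close>; the relation for \<open>r * r' * s\<close> then prepares the
    second.\<close>
  have "L * r * L * (r' * r) * M = L * r * (L * r') * r * M" by (simp only: mult.assoc)
  also have "\<dots> = L * r * r' * (L * r * M)" by (simp only: comm[symmetric] mult.assoc)
  also have "\<dots> = L * r * r' * (s * M * ?L)" by (simp only: cross)
  also have "\<dots> = L * (r * r' * s) * M * ?L" by (simp only: mult.assoc)
  also have "\<dots> = (L * s') * r * (r' * M) * ?L" by (simp only: S) (simp only: mult.assoc)
  also have "\<dots> = (s' * L) * r * (M * r') * ?L" by (simp only: comm)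
  also have "\<dots> = s' * (L * r * M) * r' * ?L" by (simp only: mult.assoc)
  also have "\<dots> = s' * (s * M * ?L) * r' * ?L" by (simp only: cross)
  also have "\<dots> = s' * s * M * (?L * r' * ?L)" by (simp only: mult.assoc)
  finally have A: "L * r * L * (r' * r) * M = s' * s * M * (?L * r' * ?L)" .
  have giL: "gi * L = L * gi" by (metis comm(4) inv mult.assoc mult_1_left mult_1_right)
  \<comment> \<open>This is L_{bar 2} R_2 L_{bar 2}; compatibility rewrites it as L_1R_1L_1
    conjugated by F_1F_2.\<close>
  have "?L * r' * ?L = f * L * (fi * r' * f) * L * fi" by (simp add: mult.assoc)
  also have "fi * r' * f = g * r * gi" by (rule inverse_move) (use inv F in auto)
  also have "f * L * (g * r * gi) * L * fi = f * (L * g) * r * (gi * L) * fi"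
      by (simp add: mult.assoc)
  finally have L: "?L * r' * ?L = f * g * (L * r * L) * (gi * fi)"
    by (simp add: giL comm(4)[symmetric] mult.assoc)
  have 1: "r' * (?L * r' * ?L) = f * g * (r * L * r * L) * (gi * fi)"
  proof -
    have "r' * (?L * r' * ?L) = (r' * f * g) * (L * r * L) * (gi * fi)"
        by (simp only: L) (simp only: mult.assoc)
    also have "\<dots> = (f * g * r) * (L * r * L) * (gi * fi)" by (simp only: F)
    finally show ?thesis by (simp only: mult.assoc)
  qed
  have gfr: "gi * fi * r' = r * gi * fi"
  proof -
    have "gi * fi * r' = gi * fi * (r' * f * g) * gi * fi"
      by (metis inv mult.assoc mult_1_left mult_1_right)
    also have "\<dots> = gi * fi * (f * g * r) * gi * fi" by (simp only: F)
    also have "\<dots> = gi * (fi * f) * g * r * gi * fi" by (simp only: mult.assoc)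
    finally show ?thesis by (simp add: inv)
  qed
  have 2: "(?L * r' * ?L) * r' = f * g * (L * r * L * r) * (gi * fi)"
  proof -
    have "(?L * r' * ?L) * r' = f * g * (L * r * L) * (gi * fi * r')"
        by (simp only: L) (simp only: mult.assoc)
    also have "\<dots> = f * g * (L * r * L) * (r * gi * fi)" by (simp only: gfr)
    finally show ?thesis by (simp only: mult.assoc)
  qed
  \<comment> \<open>The two sides of the reflection equation differ in the position of one extra
    \<open>r\<close>. On the left it passes \<open>s' * s\<close>, on the right it passes
    \<open>r' * r\<close>, each time turning into \<open>r'\<close>; inside the conjugation it
    becomes \<open>r\<close> again.\<close>
  have "r * L * r * L * (r' * r) * M = r * (L * r * L * (r' * r) * M)" by (simp only: mult.assoc)
  also have "\<dots> = r * (s' * s * M * (?L * r' * ?L))" by (simp only: A)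
  also have "\<dots> = (r * s' * s) * M * (?L * r' * ?L)" by (simp only: mult.assoc)
  also have "\<dots> = (s' * s * r') * M * (?L * r' * ?L)" by (simp only: S)
  also have "\<dots> = s' * s * (r' * M) * (?L * r' * ?L)" by (simp only: mult.assoc)
  also have "\<dots> = s' * s * (M * r') * (?L * r' * ?L)" by (simp only: comm)
  also have "\<dots> = s' * s * M * (r' * (?L * r' * ?L))" by (simp only: mult.assoc)
  finally show ?A by (simp only: 1) (simp only: mult.assoc)
  have "L * r * L * r * (r' * r) * M = L * r * L * (r * r' * r) * M" by (simp only: mult.assoc)
  also have "\<dots> = L * r * L * (r' * r * r') * M" by (simp only: braid)
  also have "\<dots> = L * r * L * (r' * r) * (r' * M)" by (simp only: mult.assoc)
  also have "\<dots> = L * r * L * (r' * r) * (M * r')" by (simp only: comm)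
  also have "\<dots> = (L * r * L * (r' * r) * M) * r'" by (simp only: mult.assoc)
  also have "\<dots> = (s' * s * M * (?L * r' * ?L)) * r'" by (simp only: A)
  also have "\<dots> = s' * s * M * ((?L * r' * ?L) * r')" by (simp only: mult.assoc)
  finally show ?B by (simp only: 2) (simp only: mult.assoc)
qed

lemma (in monoid_mult) inverse_intertwine:
  assumes "ai * a = 1" "b * bi = 1" "a * x = x * b"
  shows "ai * x = x * bi"
proof -
  have "ai * x = ai * (x * b) * bi" by (simp add: mult.assoc assms(2))
  also have "\<dots> = (ai * a) * x * bi" by (simp only: assms(3)[symmetric] mult.assoc)
  finally show ?thesis by (simp add: assms(1))
qed

lemma (in monoid_mult) mult_commute_both:
  assumes "x * a = a * x" "x * b = b * x"
  shows "x * (a * b) = a * b * x"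
proof -
  have "x * (a * b) = (x * a) * b" by (simp only: mult.assoc)
  also have "\<dots> = a * (x * b)" by (simp only: assms(1) mult.assoc)
  finally show ?thesis by (simp only: assms(2) mult.assoc)
qed

lemma (in monoid_mult) conjugate_commute:
  assumes "x * a = a * x" "x * b = b * x" "x * c = c * x"
  shows "x * (a * b * c) = a * b * c * x"
  using assms by (intro mult_commute_both)

lemma (in monoid_mult) inverse_mult:
  assumes "a * ai = 1" "b * bi = 1"
  shows "a * b * (bi * ai) = 1"
proof -
  have "a * b * (bi * ai) = a * (b * bi) * ai" by (simp only: mult.assoc)
  then show ?thesis by (simp add: assms)
qed

lemma (in monoid_mult) intertwine_inverse:
  assumes "x * y = 1" "y * x = 1" "y * b = a * y"
  shows "b * x = x * a"
proof -
  have "b * x = x * (y * b) * x" by (simp add: assms(1) mult.assoc[symmetric])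
  also have "\<dots> = x * a * (y * x)" by (simp only: assms(3) mult.assoc)
  finally show ?thesis by (simp add: assms(2))
qed

section \<open>Legs as elements of the matrix monoid\<close>

lemma embed_at_leg_triple:
  fixes X :: "('n::finite, 'k::semiring_1) mat2"
  assumes "i + 3 \<le> K" "{a, b, c} \<subseteq> {1, 2}"
  shows "teq K (embed_at i 3 (leg a X \<cdot> leg b Y \<cdot> leg c Z)) (leg (i + a) X \<cdot> leg (i + b) Y
      \<cdot> leg (i + c) Z)"
  using assms by (intro teq_trans[OF embed_at_tmul] teq_tmul embed_at_leg) auto

text \<open>Carries the braid and compatibility relations, which are given on three factors, to any
  three neighbouring ones.\<close>

lemma leg_triple_shift:
  fixes X :: "('n::finite, 'k::semiring_1) mat2"
  assumes "teq 3 (leg a X \<cdot> leg b Y \<cdot> leg c Z) (leg a' X' \<cdot> leg b' Y' \<cdot> leg c' Z')"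
    and "i + 3 \<le> K" "{a, b, c} \<subseteq> {1, 2}" "{a', b', c'} \<subseteq> {1, 2}"
  shows "teq K (leg (i + a) X \<cdot> leg (i + b) Y \<cdot> leg (i + c) Z) (leg (i + a') X' \<cdot> leg (i + b') Y'
      \<cdot> leg (i + c') Z')"
  using embed_at_leg_triple[OF assms(2,3), of X Y Z] embed_at_leg_triple[OF assms(2,4), of X' Y' Z']
    embed_at_cong[OF assms(1,2)] teq_sym teq_trans by blast

context scalars
begin

lemma gnum_embed_at: "gnum \<phi> (embed_at i k A) = embed_at i k (gnum \<phi> A)"
  by (intro ext) (simp add: gnum_def embed_at_def kron_def mult tone_def)

definition at_leg :: "nat \<Rightarrow> nat \<Rightarrow> ('n::finite, 'k) mat2 \<Rightarrow> ('n, 'a) lmat" where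
  "at_leg K i X = at_level K (gnum \<phi> (leg i X))"

lemma at_leg_teq:
  "teq K (leg a X \<cdot> leg b Y \<cdot> leg c Z) (leg a' X' \<cdot> leg b' Y' \<cdot> leg c' Z') \<Longrightarrow>
    at_leg K a X * at_leg K b Y * at_leg K c Z = at_leg K a' X' * at_leg K b' Y' * at_leg K c' Z'"
  by (drule gnum_teq[where \<phi> = \<phi>]) (simp add: at_leg_def gnum_tmul teq_iff_at_level at_level_tmul)

lemma at_leg_triple_shift:
  assumes "teq 3 (leg a X \<cdot> leg b Y \<cdot> leg c Z) (leg a' X' \<cdot> leg b' Y' \<cdot> leg c' Z')"
    and "1 \<le> k" "Suc k < K" "{a, b, c} \<subseteq> {1, 2}" "{a', b', c'} \<subseteq> {1, 2}"
  shows "at_leg K (k - 1 + a) X * at_leg K (k - 1 + b) Y * at_leg K (k - 1 + c) Z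
    = at_leg K (k - 1 + a') X' * at_leg K (k - 1 + b') Y' * at_leg K (k - 1 + c') Z'"
  using assms by (intro at_leg_teq leg_triple_shift) auto

lemma at_leg_inverse:
  assumes "X ** Y = mat 1" "1 \<le> i" "i < K"
  shows "at_leg K i X * at_leg K i Y = 1"
proof -
  have "teq K (gnum \<phi> (leg i X \<cdot> leg i Y)) (gnum \<phi> tone)"
    by (rule gnum_teq, rule leg_inverse[OF assms])
  then show ?thesis by (simp add: at_leg_def gnum_tmul teq_iff_at_level at_level_tmul)
qed

lemma at_leg_far:
  assumes "1 \<le> i" "i + 1 < j" "j < K"
  shows "at_leg K i X * at_leg K j Y = at_leg K j Y * at_leg K i X"
  using gnum_teq[OF leg_far[OF assms, of X Y], of \<phi>]
  by (simp add: at_leg_def gnum_tmul teq_iff_at_level at_level_tmul)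

lemma at_leg_first_leg:
  "2 \<le> j \<Longrightarrow> j < K \<Longrightarrow> at_leg K j X * at_level K (first_leg M)
      = at_level K (first_leg M) * at_leg K j X"
  using first_leg_commute[of j K M X] by (simp add: at_leg_def teq_iff_at_level at_level_tmul)

text \<open>The monoid \<open>lmat\<close> has no scalar multiplication, so a scalar enters as the
  matrix cI, which commutes with everything at level \<open>K\<close>.\<close>

definition at_scalar :: "nat \<Rightarrow> 'k \<Rightarrow> ('n::finite, 'a) lmat" where
  "at_scalar K c = at_level K (gnum \<phi> (\<lambda>xs ys. c * tone xs ys))"

lemma at_scalar_commute: "at_level K A * at_scalar K c = at_scalar K c * at_level K A"
proof -
  have "teq K (A \<cdot> gnum \<phi> (\<lambda>xs ys. c * tone xs ys)) (gnum \<phi> (\<lambda>xs ys. c * tone xs ys) \<cdot> A)"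
    by (rule teqI) (simp add: tmul_def gnum_def tone_def central if_distrib[of "\<lambda>x. _ * x"]
        if_distrib[of "\<lambda>x. x * _"] if_distrib[of \<phi>] sum.delta sum.delta' cong: if_cong)
  then show ?thesis by (simp add: at_scalar_def teq_iff_at_level at_level_tmul)
qed

lemma at_leg_smult2: "at_leg K i (smult2 c X) = at_scalar K c * at_leg K i X"
proof -
  have "leg i (smult2 c X) = (\<lambda>xs ys. c * tone xs ys) \<cdot> leg i X"
    by (intro ext) (simp add: leg_smult2 tmul_def tone_def if_distrib[of "\<lambda>x. _ * x"]
        if_distrib[of "\<lambda>x. x * _"] sum.delta' cong: if_cong)
  then show ?thesis by (simp add: at_leg_def at_scalar_def gnum_tmul at_level_tmul)
qed

end

locale compatible = scalars \<phi> for \<phi> :: "'k::field \<Rightarrow> 'a::ring_1" +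
  fixes R F :: "('n::finite, 'k) mat2" and \<eta> :: 'k
  assumes R: "R_matrix R" and F: "R_matrix F" and RF: "compatible_pair R F"
begin

abbreviation "Ri \<equiv> matrix_inv R"
abbreviation "Fi \<equiv> matrix_inv F"
text \<open>The exchange relation becomes L_1R_1M_1 = S_1M_1L_{bar 2}; each use of it contributes
  one factor S, and \<eta> needs no separate bookkeeping.\<close>

abbreviation "S \<equiv> smult2 \<eta> Ri"

lemma R_inv: "R ** Ri = mat 1" "Ri ** R = mat 1"
  using R invertible_matrix_inv unfolding R_matrix_def by blast+

lemma F_inv: "F ** Fi = mat 1" "Fi ** F = mat 1"
  using F invertible_matrix_inv unfolding R_matrix_def by blast+

context
  fixes K k :: nat
  assumes k: "1 \<le> k" "Suc k < K"
begin

lemma braid_R: "at_leg K k R * at_leg K (Suc k) R * at_leg K k R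
    = at_leg K (Suc k) R * at_leg K k R * at_leg K (Suc k) R"
  using at_leg_triple_shift[of 1 R 2 R 1 R 2 R 1 R 2 R k K] k R by (simp add: R_matrix_def)

lemma braid_F: "at_leg K k F * at_leg K (Suc k) F * at_leg K k F
    = at_leg K (Suc k) F * at_leg K k F * at_leg K (Suc k) F"
  using at_leg_triple_shift[of 1 F 2 F 1 F 2 F 1 F 2 F k K] k F by (simp add: R_matrix_def)

lemma RFF: "at_leg K k R * at_leg K (Suc k) F * at_leg K k F
    = at_leg K (Suc k) F * at_leg K k F * at_leg K (Suc k) R"
  using at_leg_triple_shift[of 1 R 2 F 1 F 2 F 1 F 2 R k K] k RF by (simp add: compatible_pair_def)

lemma FFR: "at_leg K (Suc k) R * at_leg K k F * at_leg K (Suc k) F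
    = at_leg K k F * at_leg K (Suc k) F * at_leg K k R"
  using at_leg_triple_shift[of 1 F 2 F 1 R 2 R 1 F 2 F k K] k RF by (simp add: compatible_pair_def)

lemma R_cancel:
  "at_leg K k R * at_leg K k Ri = 1" "at_leg K k Ri * at_leg K k R = 1"
  "at_leg K (Suc k) R * at_leg K (Suc k) Ri = 1" "at_leg K (Suc k) Ri * at_leg K (Suc k) R = 1"
  using k by (auto intro!: at_leg_inverse R_inv)

lemma F_cancel:
  "at_leg K k F * at_leg K k Fi = 1" "at_leg K k Fi * at_leg K k F = 1"
  "at_leg K (Suc k) F * at_leg K (Suc k) Fi = 1" "at_leg K (Suc k) Fi * at_leg K (Suc k) F = 1"
  using k by (auto intro!: at_leg_inverse F_inv)

lemma scalar_right: "at_leg K i X * at_scalar K c = at_scalar K c * at_leg K i X"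
  by (simp only: at_leg_def at_scalar_commute)

lemma scalar_left: "at_leg K i X * (at_scalar K c * y) = at_scalar K c * (at_leg K i X * y)"
  by (simp only: scalar_right mult.assoc[symmetric])

text \<open>This relation and the next three are braid or compatibility relations with some R
  inverted. Both sides contain equally many factors S, so the scalar is the same on both
  sides.\<close>

lemma S_FF: "at_leg K (Suc k) S * at_leg K k F * at_leg K (Suc k) F
    = at_leg K k F * at_leg K (Suc k) F * at_leg K k S"
proof -
  have "at_leg K (Suc k) Ri * (at_leg K k F * at_leg K (Suc k) F)
      = at_leg K k F * at_leg K (Suc k) F * at_leg K k Ri"
    by (rule inverse_intertwine[of _ "at_leg K (Suc k) R" "at_leg K k R"])
      (use R_cancel FFR in \<open>simp_all add: mult.assoc\<close>)
  then show ?thesis by (simp add: at_leg_smult2 scalar_left scalar_right mult.assoc)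
qed

lemma S_SR: "at_leg K k S * at_leg K (Suc k) S * at_leg K k R
    = at_leg K (Suc k) R * at_leg K k S * at_leg K (Suc k) S"
proof -
  have "at_leg K (Suc k) R * (at_leg K k Ri * at_leg K (Suc k) Ri)
      = (at_leg K k Ri * at_leg K (Suc k) Ri) * at_leg K k R"
  proof (rule intertwine_inverse[of _ "at_leg K (Suc k) R * at_leg K k R"])
    show "at_leg K k Ri * at_leg K (Suc k) Ri * (at_leg K (Suc k) R * at_leg K k R) = 1"
      "at_leg K (Suc k) R * at_leg K k R * (at_leg K k Ri * at_leg K (Suc k) Ri) = 1"
      by (rule inverse_mult; rule R_cancel)+
  qed (use braid_R in \<open>simp add: mult.assoc\<close>)
  then show ?thesis by (simp add: at_leg_smult2 scalar_left scalar_right mult.assoc)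
qed

lemma RR_S: "at_leg K k R * at_leg K (Suc k) R * at_leg K k S
    = at_leg K (Suc k) S * at_leg K k R * at_leg K (Suc k) R"
proof -
  have "at_leg K (Suc k) Ri * (at_leg K k R * at_leg K (Suc k) R)
      = at_leg K k R * at_leg K (Suc k) R * at_leg K k Ri"
    by (rule inverse_intertwine[of _ "at_leg K (Suc k) R" "at_leg K k R"])
      (use R_cancel braid_R in \<open>simp_all add: mult.assoc\<close>)
  then show ?thesis by (simp add: at_leg_smult2 scalar_left scalar_right mult.assoc)
qed

lemma R_SS: "at_leg K k R * at_leg K (Suc k) S * at_leg K k S
    = at_leg K (Suc k) S * at_leg K k S * at_leg K (Suc k) R"
proof -
  have "at_leg K k R * (at_leg K (Suc k) Ri * at_leg K k Ri)
      = (at_leg K (Suc k) Ri * at_leg K k Ri) * at_leg K (Suc k) R"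
  proof (rule intertwine_inverse[of _ "at_leg K k R * at_leg K (Suc k) R"])
    show "at_leg K (Suc k) Ri * at_leg K k Ri * (at_leg K k R * at_leg K (Suc k) R) = 1"
      "at_leg K k R * at_leg K (Suc k) R * (at_leg K (Suc k) Ri * at_leg K k Ri) = 1"
      by (rule inverse_mult; rule R_cancel)+
  qed (use braid_R in \<open>simp add: mult.assoc\<close>)
  then show ?thesis by (simp add: at_leg_smult2 scalar_left scalar_right mult.assoc)
qed

end

abbreviation "at_bar K X k \<equiv> at_level K (gbar \<phi> F X k)"

lemma at_bar_Suc: "1 \<le> k \<Longrightarrow> at_bar K X (Suc k) = at_leg K k F * at_bar K X k * at_leg K k Fi"
  by (simp add: at_leg_def at_level_tmul)

text \<open>X_{bar k} is built from X_1 and legs below \<open>k\<close>, hence acts in the factors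
  1, ..., k only.\<close>

lemma at_bar_commute:
  assumes "1 \<le> k" "k < j" "j < K"
  shows "at_leg K j Y * at_bar K X k = at_bar K X k * at_leg K j Y"
  using assms
proof (induction k rule: dec_induct)
  case base
  then show ?case using at_leg_first_leg[of j K Y X] by simp
next
  case (step k)
  have "at_leg K j Y * at_leg K k Z = at_leg K k Z * at_leg K j Y" for Z
    by (rule at_leg_far[symmetric]) (use step in auto)
  then show ?case
    using step by (simp only: at_bar_Suc conjugate_commute Suc_lessD)
qed

lemma at_bar_prod_commute:
  "p < j \<Longrightarrow> j < K \<Longrightarrow> at_leg K j Y * at_level K (gbar_prod \<phi> F X p)
      = at_level K (gbar_prod \<phi> F X p) * at_leg K j Y"
proof (induction p)
  case (Suc p)
  have "at_leg K j Y * at_bar K X (Suc p) = at_bar K X (Suc p) * at_leg K j Y"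
    using Suc by (intro at_bar_commute) auto
  then show ?case
    using Suc by (simp add: at_level_tmul mult_commute_both del: gbar.simps)
qed simp

end

section \<open>The iterated exchange relation\<close>

locale crossed = compatible \<phi> R F \<eta>
  for \<phi> :: "'k::field \<Rightarrow> 'a::ring_1" and R F :: "('n::finite, 'k) mat2" and \<eta> +
  fixes L M :: "'n \<Rightarrow> 'n \<Rightarrow> 'a"
  assumes cross: "teq 2 (first_leg L \<cdot> gnum \<phi> (leg 1 R) \<cdot> first_leg M)
    (gnum \<phi> (leg 1 S) \<cdot> first_leg M \<cdot> gbar \<phi> F L 2)"
begin

text \<open>Conjugation by F_k carries the relation for \<open>k\<close> to the one for
  \<open>k + 1\<close>; this is \<open>cross_shift\<close>.\<close>

lemma cross_bar:
  assumes "1 \<le> k" "k < K"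
  shows "at_bar K L k * at_leg K k R * at_bar K M k
      = at_leg K k S * at_bar K M k * at_bar K L (Suc k)"
  using assms
proof (induction k rule: dec_induct)
  case base
  then have K: "2 \<le> K" by simp
  \<comment> \<open>The assumption \<open>cross\<close> is given on two factors; each matrix in it
    acts as the identity on all further factors, so it extends to \<open>K\<close> factors.\<close>
  have leg: "teq K (embed_at 0 2 (gnum \<phi> (leg 1 X))) (gnum \<phi> (leg 1 X))" for X :: "('n, 'k) mat2"
    using gnum_teq[OF embed_at_leg[of 1 2 0 K X], of \<phi>] K by (simp add: gnum_embed_at)
  have 1: "teq K (embed_at 0 2 (first_leg X)) (first_leg X)" for X :: "'n \<Rightarrow> 'n \<Rightarrow> 'a"
    using K by (intro embed_at_first_leg) auto
  note 2 = teq_trans[OF embed_at_tmul teq_tmul] 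
  have "teq K (embed_at 0 2 (first_leg L \<cdot> gnum \<phi> (leg 1 R) \<cdot> first_leg M))
      (first_leg L \<cdot> gnum \<phi> (leg 1 R) \<cdot> first_leg M)"
    using K by (intro 2 1 leg) auto
  moreover have "teq K (embed_at 0 2 (gnum \<phi> (leg 1 S) \<cdot> first_leg M \<cdot> (gnum \<phi> (leg 1 F)
      \<cdot> first_leg L \<cdot> gnum \<phi> (leg 1 Fi))))
      (gnum \<phi> (leg 1 S) \<cdot> first_leg M \<cdot> (gnum \<phi> (leg 1 F) \<cdot> first_leg L \<cdot> gnum \<phi> (leg 1 Fi)))"
    using K by (intro 2 1 leg) auto
  ultimately have "teq K (first_leg L \<cdot> gnum \<phi> (leg 1 R) \<cdot> first_leg M)
    (gnum \<phi> (leg 1 S) \<cdot> first_leg M \<cdot> (gnum \<phi> (leg 1 F) \<cdot> first_leg L \<cdot> gnum \<phi> (leg 1 Fi)))"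
    using embed_at_cong[OF cross, of 0 K] K teq_sym teq_trans
    by (simp add: numeral_2_eq_2) blast
  then show ?case
    by (simp add: teq_iff_at_level at_level_tmul at_leg_def)
next
  case (step k)
  have "(at_leg K k F * at_bar K L k * at_leg K k Fi) * at_leg K (Suc k) R * (at_leg K k F
      * at_bar K M k * at_leg K k Fi)
    = at_leg K (Suc k) S * (at_leg K k F * at_bar K M k * at_leg K k Fi)
       * (at_leg K (Suc k) F * (at_leg K k F * at_bar K L k * at_leg K k Fi) * at_leg K (Suc k) Fi)"
    using step F_cancel[of k K] braid_F[of k K] FFR[of k K] S_FF[of k K]
    by (intro cross_shift[where r = "at_leg K k R" and s = "at_leg K k S"] at_bar_commute)
      (auto simp: at_bar_Suc simp del: gbar.simps)
  then show ?case using step by (simp add: at_bar_Suc del: gbar.simps)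
qed

text \<open>R_{p+1} and S_{p+1} act beyond the first p factors and slip past M_{bar 1} ... M_{bar
  p}, which brings the next exchange into the form of \<open>cross_bar\<close>.\<close>

lemma cross_chain:
  "p < K \<Longrightarrow> at_level K (first_leg L) * at_level K (gnum \<phi> (leg_chain R p))
      * at_level K (gbar_prod \<phi> F M p)
    = at_level K (gnum \<phi> (leg_chain S p)) * at_level K (gbar_prod \<phi> F M p) * at_bar K L (Suc p)"
proof (induction p)
  case (Suc p)
  let ?R = "at_level K (gnum \<phi> (leg_chain R p))" and ?S = "at_level K (gnum \<phi> (leg_chain S p))"
    and ?N = "at_level K (gbar_prod \<phi> F M p)" and ?M = "at_bar K M (Suc p)"
    and ?L = "at_level K (first_leg L)" and ?r = "at_leg K (Suc p) R" and ?s = "at_leg K (Suc p) S"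
  have c: "?r * ?N = ?N * ?r" "?s * ?N = ?N * ?s"
    using Suc by (auto intro: at_bar_prod_commute)
  have "?L * (?R * ?r) * (?N * ?M) = ?L * ?R * (?r * ?N) * ?M" by (simp only: mult.assoc)
  also have "\<dots> = (?L * ?R * ?N) * ?r * ?M" by (simp only: c mult.assoc)
  also have "\<dots> = ?S * ?N * at_bar K L (Suc p) * ?r * ?M" using Suc by simp
  also have "\<dots> = ?S * ?N * (at_bar K L (Suc p) * ?r * ?M)" by (simp only: mult.assoc)
  also have "\<dots> = ?S * ?N * (?s * ?M * at_bar K L (Suc (Suc p)))"
    using Suc by (simp only: cross_bar)
  also have "\<dots> = ?S * (?N * ?s) * ?M * at_bar K L (Suc (Suc p))" by (simp only: mult.assoc)
  also have "\<dots> = ?S * (?s * ?N) * ?M * at_bar K L (Suc (Suc p))" by (simp only: c)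
  finally show ?case
    by (simp add: gnum_tmul at_level_tmul at_leg_def mult.assoc del: gbar.simps)
qed simp

text \<open>
  \<open>cross_ideal\<close>: $L$ moves through the quadratic relations of $M$; \<open>cross_reflection\<close>: the
  quadratic relations of $L$ move through $M$.
\<close>

lemma cross_ideal:
  fixes N D b
  defines "N \<equiv> gbar_prod \<phi> F M 2" and "b \<equiv> gbar \<phi> F L 3"
  defines "D \<equiv> gnum \<phi> (leg 1 R) \<cdot> N - N \<cdot> gnum \<phi> (leg 1 R)"
  shows "teq 3 (first_leg L \<cdot> gnum \<phi> (leg_chain R 2) \<cdot> D) (gnum \<phi> (leg_chain S 2) \<cdot> D \<cdot> b)"
proof -
  let ?L = "at_level 3 (first_leg L)" and ?N = "at_level 3 N" and ?r = "\<lambda>i. at_leg 3 i R"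
    and ?f = "\<lambda>i. at_leg 3 i F" and ?g = "\<lambda>i. at_leg 3 i Fi" and ?s = "\<lambda>i. at_leg 3 i S"
  have b: "at_level 3 b = ?f 2 * (?f 1 * ?L * ?g 1) * ?g 2"
    by (simp add: b_def at_leg_def at_level_tmul numeral_3_eq_3 numeral_2_eq_2)
  have RR: "at_level 3 (gnum \<phi> (leg_chain X 2))
      = at_leg 3 1 X * at_leg 3 2 X" for X :: "('n, 'k) mat2"
    by (simp add: gnum_tmul at_level_tmul at_leg_def numeral_2_eq_2)
  have c: "?L * (?r 1 * ?r 2) * ?N = ?s 1 * ?s 2 * ?N * (?f 2 * (?f 1 * ?L * ?g 1) * ?g 2)"
    using cross_chain[of 2 3] unfolding RR N_def[symmetric] b[symmetric] b_def
    by (simp add: numeral_3_eq_3 del: gbar.simps)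
  have k: "1 \<le> (1 :: nat)" "Suc 1 < (3 :: nat)" and 2: "Suc 1 = (2 :: nat)" by auto
  note k_rels = F_cancel[OF k, unfolded 2] braid_R[OF k, unfolded 2] S_SR[OF k, unfolded 2] RFF[OF
      k, unfolded 2]
  have L: "?r 2 * ?L = ?L * ?r 2" by (rule at_leg_first_leg) auto
  note * = ideal_identity[OF k_rels L c]
  have "teq 3 (first_leg L \<cdot> gnum \<phi> (leg_chain R 2) \<cdot> (gnum \<phi> (leg 1 R) \<cdot> N))
      (gnum \<phi> (leg_chain S 2) \<cdot> (gnum \<phi> (leg 1 R) \<cdot> N) \<cdot> b)"
    "teq 3 (first_leg L \<cdot> gnum \<phi> (leg_chain R 2) \<cdot> (N \<cdot> gnum \<phi> (leg 1 R)))
      (gnum \<phi> (leg_chain S 2) \<cdot> (N \<cdot> gnum \<phi> (leg 1 R)) \<cdot> b)"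
    using * by (simp_all add: teq_iff_at_level at_level_tmul RR b flip: at_leg_def)
  then show ?thesis
    unfolding D_def by (simp add: tmul_diff_right tmul_diff_left teq_def)
qed

lemma cross_reflection:
  fixes E l r
  defines "l \<equiv> first_leg L" and "r \<equiv> gnum \<phi> (leg 1 R)"
  defines "E \<equiv> r \<cdot> l \<cdot> r \<cdot> l - l \<cdot> r \<cdot> l \<cdot> r"
  shows "teq 3 (E \<cdot> gnum \<phi> (leg 2 R \<cdot> leg 1 R) \<cdot> first_leg M)
    (gnum \<phi> (leg 2 S \<cdot> leg 1 S) \<cdot> first_leg M \<cdot> gnum \<phi> (leg 1 F \<cdot> leg 2 F) \<cdot> E \<cdot> gnum \<phi> (leg 2 Fi
        \<cdot> leg 1 Fi))"
proof -
  let ?L = "at_level 3 (first_leg L)" and ?M = "at_level 3 (first_leg M)"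
      and ?r = "\<lambda>i. at_leg 3 i R"
    and ?f = "\<lambda>i. at_leg 3 i F" and ?g = "\<lambda>i. at_leg 3 i Fi" and ?s = "\<lambda>i. at_leg 3 i S"
  have c: "?L * ?r 1 * ?M = ?s 1 * ?M * (?f 1 * ?L * ?g 1)"
    using cross_bar[of 1 3] by (simp add: at_leg_def at_level_tmul)
  have k: "1 \<le> (1 :: nat)" "Suc 1 < (3 :: nat)" and 2: "Suc 1 = (2 :: nat)" by auto
  note k_rels = F_cancel[OF k, unfolded 2] braid_R[OF k, unfolded 2] RR_S[OF k, unfolded 2]
    R_SS[OF k, unfolded 2] FFR[OF k, unfolded 2]
  have comm: "at_leg 3 2 X * at_level 3 (first_leg Y) = at_level 3 (first_leg Y) * at_leg 3 2 X"
    for X and Y :: "'n \<Rightarrow> 'n \<Rightarrow> 'a"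
    by (rule at_leg_first_leg) auto
  note * = reflection_identity[OF k_rels comm comm comm comm c]
  have "teq 3 (r \<cdot> l \<cdot> r \<cdot> l \<cdot> gnum \<phi> (leg 2 R \<cdot> leg 1 R) \<cdot> first_leg M)
      (gnum \<phi> (leg 2 S \<cdot> leg 1 S) \<cdot> first_leg M \<cdot> gnum \<phi> (leg 1 F \<cdot> leg 2 F) \<cdot> (r \<cdot> l \<cdot> r \<cdot> l)
          \<cdot> gnum \<phi> (leg 2 Fi \<cdot> leg 1 Fi))"
    "teq 3 (l \<cdot> r \<cdot> l \<cdot> r \<cdot> gnum \<phi> (leg 2 R \<cdot> leg 1 R) \<cdot> first_leg M)
      (gnum \<phi> (leg 2 S \<cdot> leg 1 S) \<cdot> first_leg M \<cdot> gnum \<phi> (leg 1 F \<cdot> leg 2 F) \<cdot> (l \<cdot> r \<cdot> l \<cdot> r)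
          \<cdot> gnum \<phi> (leg 2 Fi \<cdot> leg 1 Fi))"
    using * by (simp_all add: teq_iff_at_level at_level_tmul gnum_tmul l_def r_def flip: at_leg_def)
  then show ?thesis
    unfolding E_def by (simp add: tmul_diff_right tmul_diff_left teq_def)
qed

end

section \<open>Skew-invertibility\<close>

definition fa_subspace :: "('x, 'k::field) free_alg set \<Rightarrow> bool" where
  "fa_subspace S \<longleftrightarrow> 0 \<in> S \<and> (\<forall>x\<in>S. \<forall>y\<in>S. x + y \<in> S) \<and> (\<forall>c. \<forall>x\<in>S. fa_const c * x \<in> S)"

lemma fa_subspace_sum: "fa_subspace S \<Longrightarrow> (\<And>i. i \<in> A \<Longrightarrow> f i \<in> S) \<Longrightarrow> (\<Sum>i\<in>A. f i) \<in> S"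
  by (induction A rule: infinite_finite_induct) (auto simp: fa_subspace_def)

lemma fa_subspace_const: "fa_subspace S \<Longrightarrow> x \<in> S \<Longrightarrow> fa_const c * x \<in> S"
  by (simp add: fa_subspace_def)

lemma fa_subspace_rel_ideal: "fa_subspace (rel_ideal S)"
  by (simp add: fa_subspace_def rel_ideal_add rel_ideal_left)

text \<open>In coordinates \<Psi> is an ordinary inverse of R after a partial transposition:
  R_{xa}^{yb} is read as a matrix with row index (x,y) and column index (a,b). The first equation
  serves to solve linear systems, the second to verify a solution.\<close>

lemma skew_inverse_entries:
  fixes R \<Psi> :: "('n::finite, 'k::field) mat2"
  assumes "skew_inverse R \<Psi>"
  shows "(\<Sum>a\<in>UNIV. \<Sum>b\<in>UNIV. R $ (x, a) $ (y, b) * \<Psi> $ (b, x') $ (a, y')) = (if y = x' \<and> y'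
      = x then 1 else 0)"
    and "(\<Sum>a\<in>UNIV. \<Sum>b\<in>UNIV. \<Psi> $ (x, a) $ (y, b) * R $ (b, x') $ (a, y')) = (if y = x' \<and> y'
        = x then 1 else 0)"
proof -
  have *: "ptrace 2 (leg 1 X \<cdot> leg 2 Y) [x, x'] [y, y']
      = (\<Sum>a\<in>UNIV. \<Sum>b\<in>UNIV. X $ (x, a) $ (y, b) * Y $ (b, x') $ (a, y'))"
    for X Y :: "('n, 'k) mat2"
  proof -
    have "(leg 1 X \<cdot> leg 2 Y) [x, a, x'] [y, a, y']
        = (\<Sum>b\<in>UNIV. X $ (x, a) $ (y, b) * Y $ (b, x') $ (a, y'))" for a
    proof -
      have len: "length [x, a, x'] = Suc (Suc (Suc 0))" by simp
      have "(leg 1 X \<cdot> leg 2 Y) [x, a, x'] [y, a, y'] =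
        (\<Sum>z\<in>UNIV. \<Sum>b\<in>UNIV. \<Sum>z'\<in>UNIV. (if x' = z' then X $ (x, a) $ (z, b) else 0) * (if z
            = y then Y $ (b, z') $ (a, y') else 0))"
        unfolding tmul_def len sum_tidx_Cons tidx_0
            by (simp add: leg_def numeral_2_eq_2 cong: if_cong)
      also have "\<dots> = (\<Sum>z\<in>UNIV. \<Sum>b\<in>UNIV. X $ (x, a) $ (z, b) * (if z
          = y then Y $ (b, x') $ (a, y') else 0))"
        by (simp add: if_distrib[of "\<lambda>x. x * _"] sum.delta cong: if_cong)
      also have "\<dots> = (\<Sum>b\<in>UNIV. \<Sum>z\<in>UNIV. X $ (x, a) $ (z, b) * (if z
          = y then Y $ (b, x') $ (a, y') else 0))"
        by (rule sum.swap)
      also have "\<dots> = (\<Sum>b\<in>UNIV. X $ (x, a) $ (y, b) * Y $ (b, x') $ (a, y'))"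
        by (simp add: if_distrib[of "\<lambda>x. _ * x"] sum.delta' cong: if_cong)
      finally show ?thesis .
    qed
    then show ?thesis by (simp add: ptrace_def)
  qed
  have f: "leg 1 flip [x, x'] [y, y'] = (if y = x' \<and> y' = x then 1 else 0 :: 'k)"
    by (simp add: leg_def flip_def)
  have "ptrace 2 (leg 1 R \<cdot> leg 2 \<Psi>) [x, x'] [y, y'] = leg 1 flip [x, x'] [y, y']"
    "ptrace 2 (leg 1 \<Psi> \<cdot> leg 2 R) [x, x'] [y, y'] = leg 1 flip [x, x'] [y, y']"
    using assms by (auto simp: skew_inverse_def intro: teqD[of 2])
  then show "(\<Sum>a\<in>UNIV. \<Sum>b\<in>UNIV. R $ (x, a) $ (y, b) * \<Psi> $ (b, x') $ (a, y')) = (if y = x' \<and> y'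
      = x then 1 else 0)"
    "(\<Sum>a\<in>UNIV. \<Sum>b\<in>UNIV. \<Psi> $ (x, a) $ (y, b) * R $ (b, x') $ (a, y')) = (if y = x' \<and> y'
        = x then 1 else 0)"
    by (simp_all only: * f)
qed

lemma sum_delta2:
  fixes f :: "'a::finite \<Rightarrow> 'b::finite \<Rightarrow> 'c::semiring_1"
  shows "(\<Sum>a\<in>UNIV. \<Sum>b\<in>UNIV. (if b = b0 \<and> a = a0 then 1 else 0) * f a b) = f a0 b0"
proof -
  have "(\<Sum>a\<in>UNIV. \<Sum>b\<in>UNIV. (if b = b0 \<and> a = a0 then 1 else 0) * f a b)
    = (\<Sum>a\<in>UNIV. if a = a0 then \<Sum>b\<in>UNIV. if b = b0 then f a b else 0 else 0)"
    by (intro sum.cong refl) (auto simp: if_distrib[of "\<lambda>x. x * _"] cong: if_cong)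
  then show ?thesis by (simp add: if_distrib[of "\<lambda>x. x * _"] cong: if_cong)
qed

lemma sum_rotate: "(\<Sum>a\<in>A. \<Sum>b\<in>B. \<Sum>c\<in>C. f a b c) = (\<Sum>b\<in>B. \<Sum>c\<in>C. \<Sum>a\<in>A. f a b c)"
proof -
  have "(\<Sum>a\<in>A. \<Sum>b\<in>B. \<Sum>c\<in>C. f a b c) = (\<Sum>b\<in>B. \<Sum>a\<in>A. \<Sum>c\<in>C. f a b c)" by (rule sum.swap)
  also have "\<dots> = (\<Sum>b\<in>B. \<Sum>c\<in>C. \<Sum>a\<in>A. f a b c)" by (rule sum.cong[OF refl], rule sum.swap)
  finally show ?thesis .
qed

text \<open>The coefficient matrix with rows (j,e) and columns (a,g) is inverted by \<Psi>, so every
  v_{ag} is a linear combination of the given sums. Membership in a subspace, rather than values,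
  lets the argument run modulo an ideal.\<close>

lemma skew_solve:
  fixes v :: "'n::finite \<Rightarrow> 'n \<Rightarrow> ('x, 'k::field) free_alg"
  assumes skew: "skew_inverse R \<Psi>" and S: "fa_subspace S"
    and mem: "\<And>j e. (\<Sum>a\<in>UNIV. \<Sum>g\<in>UNIV. fa_const (R $ (a, j) $ (g, e)) * v a g) \<in> S"
  shows "v a g \<in> S"
proof -
  have "(\<Sum>j\<in>UNIV. \<Sum>e\<in>UNIV. fa_const (\<Psi> $ (e, g) $ (j, a)) *
      (\<Sum>a'\<in>UNIV. \<Sum>g'\<in>UNIV. fa_const (R $ (a', j) $ (g', e)) * v a' g')) \<in> S" (is "?x \<in> S")
    by (intro fa_subspace_sum[OF S] fa_subspace_const[OF S] mem)
  also have "?x = (\<Sum>j\<in>UNIV. \<Sum>e\<in>UNIV. \<Sum>a'\<in>UNIV. \<Sum>g'\<in>UNIV.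
      fa_const (R $ (a', j) $ (g', e) * \<Psi> $ (e, g) $ (j, a)) * v a' g')"
    by (simp add: sum_distrib_left fa_const_mult mult.assoc mult.commute[of "R $ _ $ _"])
  also have "\<dots> = (\<Sum>j\<in>UNIV. \<Sum>a'\<in>UNIV. \<Sum>g'\<in>UNIV. \<Sum>e\<in>UNIV.
      fa_const (R $ (a', j) $ (g', e) * \<Psi> $ (e, g) $ (j, a)) * v a' g')"
    by (rule sum.cong[OF refl], rule sum_rotate)
  also have "\<dots> = (\<Sum>a'\<in>UNIV. \<Sum>g'\<in>UNIV. \<Sum>j\<in>UNIV. \<Sum>e\<in>UNIV.
      fa_const (R $ (a', j) $ (g', e) * \<Psi> $ (e, g) $ (j, a)) * v a' g')"
    by (rule sum_rotate)
  also have "\<dots> = (\<Sum>a'\<in>UNIV. \<Sum>g'\<in>UNIV. fa_const (if g' = g \<and> a = a' then 1 else 0) * v a' g')"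
    by (simp add: skew_inverse_entries(1)[OF skew, symmetric] fa.sum sum_distrib_right)
  also have "\<dots> = (\<Sum>a'\<in>UNIV. \<Sum>g'\<in>UNIV. (if g' = g \<and> a' = a then 1 else 0) * v a' g')"
    by (intro sum.cong refl) auto
  finally show ?thesis by (simp only: sum_delta2)
qed

section \<open>Linear systems whose coefficients are products of consecutive legs\<close>

lemma leg_chain_kron:
  assumes "p < q" "q \<le> K"
  shows "teq K (leg_chain X p) (kron q (leg_chain (X :: ('n::finite, 'k::field) mat2) p) tone)"
  using assms(1)
proof (induction p)
  case 0
  show ?case using assms kron_tone[of q K, THEN teq_sym] by simp
next
  case (Suc p)
  have "teq K (leg_chain X p \<cdot> leg (Suc p) X) (kron q (leg_chain X p) tone
      \<cdot> kron q (leg (Suc p) X) tone)"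
    using Suc assms by (intro teq_tmul kron_leg_tone[THEN teq_sym]) auto
  also have "teq K \<dots> (kron q (leg_chain X p \<cdot> leg (Suc p) X) (tone \<cdot> tone))"
    using assms by (intro kron_tmul) (auto simp: tone_def)
  finally show ?case by simp
qed

lemma leg_last:
  assumes "length us = p" "length bs = p"
  shows "leg (Suc p) X (us @ [z, z']) (bs @ [b, l]) = (if us = bs then X $ (z, z') $ (b, l) else 0)"
  using assms by (simp add: leg_def nth_append)

text \<open>Only the last leg touches the last factor, so \<open>j\<close>, \<open>b\<close> and
  \<open>l\<close> enter through a single entry of \<open>X\<close>, linked to the shorter chain by
  \<open>z\<close>.\<close>

lemma leg_chain_entry:
  fixes X :: "('n::finite, 'k::field) mat2"
  assumes "length us = Suc p" "length bs = p"
  shows "leg_chain X (Suc p) (us @ [j]) (bs @ [b, l])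
      = (\<Sum>z\<in>UNIV. leg_chain X p us (bs @ [z]) * X $ (z, j) $ (b, l))"
proof -
  have c: "leg_chain X p (us @ [j]) (vs @ [z, z']) = leg_chain X p us (vs @ [z]) * (if j
      = z' then 1 else 0)"
    if "length vs = p" for vs z z'
    using teqD[OF leg_chain_kron[of p "Suc p" "Suc (Suc p)" X], of "us @ [j]" "vs @ [z, z']"] assms
        that
    by (simp add: kron_def tone_def)
  have "leg_chain X (Suc p) (us @ [j]) (bs @ [b, l]) = (\<Sum>vs\<in>tidx p. \<Sum>z\<in>UNIV. \<Sum>z'\<in>UNIV.
      leg_chain X p us (vs @ [z]) * (if j = z' then 1 else 0) * (if vs
          = bs then X $ (z, z') $ (b, l) else 0))"
    using assms by (simp add: tmul_def sum_tidx_snoc c leg_last)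
  also have "\<dots> = (\<Sum>vs\<in>tidx p. if vs
      = bs then \<Sum>z\<in>UNIV. leg_chain X p us (vs @ [z]) * X $ (z, j) $ (b, l) else 0)"
    by (intro sum.cong refl) (simp add: if_distrib[of "\<lambda>x. x * _"] if_distrib[of "\<lambda>x. _
        * x"] sum.delta' cong: if_cong)
  finally show ?thesis using assms by (simp add: sum.delta)
qed

text \<open>X_p ... X_1, opposite to \<open>leg_chain\<close>. For R it occurs as R_2R_1 in the
  exchange of the reflection equation; for F it conjugates M_1 into M_{bar p+1}.\<close>

primrec rev_chain :: "('n::finite, 'k::field) mat2 \<Rightarrow> nat \<Rightarrow> ('n, 'k) tmat" where
  "rev_chain X 0 = tone"
| "rev_chain X (Suc p) = leg (Suc p) X \<cdot> rev_chain X p"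

lemma rev_chain_kron:
  assumes "p < q" "q \<le> K"
  shows "teq K (rev_chain X p) (kron q (rev_chain (X :: ('n::finite, 'k::field) mat2) p) tone)"
  using assms(1)
proof (induction p)
  case 0
  show ?case using assms kron_tone[of q K, THEN teq_sym] by simp
next
  case (Suc p)
  have "teq K (leg (Suc p) X \<cdot> rev_chain X p) (kron q (leg (Suc p) X) tone
      \<cdot> kron q (rev_chain X p) tone)"
    using Suc assms by (intro teq_tmul kron_leg_tone[THEN teq_sym]) auto
  also have "teq K \<dots> (kron q (leg (Suc p) X \<cdot> rev_chain X p) (tone \<cdot> tone))"
    using assms by (intro kron_tmul) (auto simp: tone_def)
  finally show ?case by simp
qed

lemma rev_chain_entry:
  fixes X :: "('n::finite, 'k::field) mat2"
  assumes "length as = p" "length bs = Suc p"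
  shows "rev_chain X (Suc p) (as @ [a, j]) (bs @ [e])
      = (\<Sum>g\<in>UNIV. X $ (a, j) $ (g, e) * rev_chain X p (as @ [g]) bs)"
proof -
  have c: "rev_chain X p (vs @ [z, z']) (bs @ [e]) = rev_chain X p (vs @ [z]) bs * (if z'
      = e then 1 else 0)"
    if "length vs = p" for vs z z'
    using teqD[OF rev_chain_kron[of p "Suc p" "Suc (Suc p)" X], of "vs @ [z, z']" "bs @ [e]"] assms
        that
    by (simp add: kron_def tone_def)
  have "rev_chain X (Suc p) (as @ [a, j]) (bs @ [e]) = (\<Sum>vs\<in>tidx p. \<Sum>z\<in>UNIV. \<Sum>z'\<in>UNIV.
      (if as = vs then X $ (a, j) $ (z, z') else 0) * (rev_chain X p (vs @ [z]) bs * (if z'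
          = e then 1 else 0)))"
    using assms by (simp add: tmul_def sum_tidx_snoc c leg_last)
  also have "\<dots> = (\<Sum>vs\<in>tidx p. if as
      = vs then \<Sum>z\<in>UNIV. X $ (a, j) $ (z, e) * rev_chain X p (vs @ [z]) bs else 0)"
    by (intro sum.cong refl) (simp add: if_distrib[of "\<lambda>x. x * _"] if_distrib[of "\<lambda>x. _
        * x"] sum.delta cong: if_cong)
  finally show ?thesis using assms by (simp add: sum.delta')
qed

text \<open>The last leg is removed by \<open>skew_solve\<close>, with the sums over the shorter
  chain as unknowns; the induction hypothesis then resolves those sums.\<close>

lemma leg_chain_solve:
  fixes u :: "'n::finite \<Rightarrow> 'n list \<Rightarrow> ('x, 'k::field) free_alg"
  assumes skew: "skew_inverse R \<Psi>" and S: "fa_subspace S"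
    and mem: "\<And>js l. length js = p \<Longrightarrow> (\<Sum>a\<in>UNIV. \<Sum>bs\<in>tidx p. fa_const (leg_chain R p (a # js)
        (bs @ [l])) * u a bs) \<in> S"
    and "length bs = p"
  shows "u a bs \<in> S"
  using mem \<open>length bs = p\<close>
proof (induction p arbitrary: u a bs)
  case 0
  have "(\<Sum>b\<in>UNIV. fa_const (leg_chain R 0 [b] [a]) * u b []) \<in> S"
    using 0(1)[of "[]" a] by simp
  also have "(\<Sum>b\<in>UNIV. fa_const (leg_chain R 0 [b] [a]) * u b []) = u a []"
    by (simp add: tone_def if_distrib[of fa_const] if_distrib[of "\<lambda>x. x
        * _"] sum.delta cong: if_cong)
  finally show ?case using 0 by simp
next
  case (Suc p)
  obtain bs' b where bs: "bs = bs' @ [b]" "length bs' = p"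
    using Suc.prems(2) by (metis length_Suc_conv_rev)
  define v where "v js l b = (\<Sum>a\<in>UNIV. \<Sum>bs\<in>tidx p. fa_const (leg_chain R p (a # js) (bs @ [l]))
      * u a (bs @ [b]))" for js l b
  have "v js l b \<in> S" if js: "length js = p" for js l b
  proof (rule skew_solve[OF skew S, of "v js"])
    fix j e
    have "(\<Sum>z\<in>UNIV. \<Sum>b\<in>UNIV. fa_const (R $ (z, j) $ (b, e)) * v js z b)
      = (\<Sum>z\<in>UNIV. \<Sum>b\<in>UNIV. \<Sum>a\<in>UNIV. \<Sum>bs\<in>tidx p.
          fa_const (leg_chain R p (a # js) (bs @ [z]) * R $ (z, j) $ (b, e)) * u a (bs @ [b]))"
      by (simp add: v_def sum_distrib_left fa_const_mult mult.assoc mult.commute[of _ "R $ _ $ _"])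
    also have "\<dots> = (\<Sum>b\<in>UNIV. \<Sum>z\<in>UNIV. \<Sum>a\<in>UNIV. \<Sum>bs\<in>tidx p.
          fa_const (leg_chain R p (a # js) (bs @ [z]) * R $ (z, j) $ (b, e)) * u a (bs @ [b]))"
      by (rule sum.swap)
    also have "\<dots> = (\<Sum>b\<in>UNIV. \<Sum>a\<in>UNIV. \<Sum>bs\<in>tidx p. \<Sum>z\<in>UNIV.
          fa_const (leg_chain R p (a # js) (bs @ [z]) * R $ (z, j) $ (b, e)) * u a (bs @ [b]))"
      by (rule sum.cong[OF refl], rule sum_rotate)
    also have "\<dots> = (\<Sum>b\<in>UNIV. \<Sum>a\<in>UNIV. \<Sum>bs\<in>tidx p.
          fa_const (leg_chain R (Suc p) ((a # js) @ [j]) (bs @ [b, e])) * u a (bs @ [b]))"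
      by (intro sum.cong refl, subst leg_chain_entry) (simp_all add: js fa.sum sum_distrib_right)
    also have "\<dots> = (\<Sum>a\<in>UNIV. \<Sum>bs\<in>tidx p. \<Sum>b\<in>UNIV.
          fa_const (leg_chain R (Suc p) ((a # js) @ [j]) (bs @ [b, e])) * u a (bs @ [b]))"
      by (rule sum_rotate)
    also have "\<dots> = (\<Sum>a\<in>UNIV. \<Sum>bs\<in>tidx (Suc p). fa_const (leg_chain R (Suc p) (a # js @ [j])
        (bs @ [e])) * u a bs)"
      by (simp add: sum_tidx_snoc del: leg_chain.simps)
    also have "\<dots> \<in> S" using js by (intro Suc.prems(1)) simp
    finally show "(\<Sum>z\<in>UNIV. \<Sum>b\<in>UNIV. fa_const (R $ (z, j) $ (b, e)) * v js z b) \<in> S" .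
  qed
  then show ?case
    unfolding bs(1) v_def by (rule Suc.IH[of "\<lambda>a bs. u a (bs @ [b])"]) (simp_all add: bs)
qed

lemma rev_chain_solve:
  fixes u :: "'n::finite list \<Rightarrow> 'n \<Rightarrow> ('x, 'k::field) free_alg"
  assumes skew: "skew_inverse R \<Psi>" and S: "fa_subspace S"
    and mem: "\<And>j cs. length cs = p \<Longrightarrow> (\<Sum>as\<in>tidx p. \<Sum>b\<in>UNIV. fa_const (rev_chain R p (as @ [j])
        (b # cs)) * u as b) \<in> S"
    and "length as = p"
  shows "u as b \<in> S"
  using mem \<open>length as = p\<close>
proof (induction p arbitrary: u as b)
  case 0
  have "(\<Sum>c\<in>UNIV. fa_const (rev_chain R 0 [b] [c]) * u [] c) \<in> S"
    using 0(1)[of "[]" b] by simp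
  also have "(\<Sum>c\<in>UNIV. fa_const (rev_chain R 0 [b] [c]) * u [] c) = u [] b"
    by (simp add: tone_def if_distrib[of fa_const] if_distrib[of "\<lambda>x. x
        * _"] sum.delta' cong: if_cong)
  finally show ?case using 0 by simp
next
  case (Suc p)
  obtain as' a where as: "as = as' @ [a]" "length as' = p"
    using Suc.prems(2) by (metis length_Suc_conv_rev)
  define v where "v cs a g = (\<Sum>as\<in>tidx p. \<Sum>b\<in>UNIV. fa_const (rev_chain R p (as @ [g]) (b # cs))
      * u (as @ [a]) b)" for cs a g
  have "v cs a g \<in> S" if cs: "length cs = p" for cs a g
  proof (rule skew_solve[OF skew S, of "v cs"])
    fix j e
    have "(\<Sum>a\<in>UNIV. \<Sum>g\<in>UNIV. fa_const (R $ (a, j) $ (g, e)) * v cs a g)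
      = (\<Sum>a\<in>UNIV. \<Sum>g\<in>UNIV. \<Sum>as\<in>tidx p. \<Sum>b\<in>UNIV.
          fa_const (R $ (a, j) $ (g, e) * rev_chain R p (as @ [g]) (b # cs)) * u (as @ [a]) b)"
      by (simp add: v_def sum_distrib_left fa_const_mult mult.assoc)
    also have "\<dots> = (\<Sum>a\<in>UNIV. \<Sum>as\<in>tidx p. \<Sum>b\<in>UNIV. \<Sum>g\<in>UNIV.
          fa_const (R $ (a, j) $ (g, e) * rev_chain R p (as @ [g]) (b # cs)) * u (as @ [a]) b)"
      by (rule sum.cong[OF refl], rule sum_rotate)
    also have "\<dots> = (\<Sum>a\<in>UNIV. \<Sum>as\<in>tidx p. \<Sum>b\<in>UNIV.
          fa_const (rev_chain R (Suc p) (as @ [a, j]) ((b # cs) @ [e])) * u (as @ [a]) b)"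
      by (intro sum.cong refl, subst rev_chain_entry) (simp_all add: cs fa.sum sum_distrib_right)
    also have "\<dots> = (\<Sum>as\<in>tidx p. \<Sum>a\<in>UNIV. \<Sum>b\<in>UNIV.
          fa_const (rev_chain R (Suc p) (as @ [a, j]) ((b # cs) @ [e])) * u (as @ [a]) b)"
      by (rule sum.swap)
    also have "\<dots> = (\<Sum>as\<in>tidx (Suc p). \<Sum>b\<in>UNIV. fa_const (rev_chain R (Suc p) (as @ [j])
        (b # cs @ [e])) * u as b)"
      by (simp add: sum_tidx_snoc del: rev_chain.simps)
    also have "\<dots> \<in> S" using cs by (intro Suc.prems(1)) simp
    finally show "(\<Sum>a\<in>UNIV. \<Sum>g\<in>UNIV. fa_const (R $ (a, j) $ (g, e)) * v cs a g) \<in> S" .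
  qed
  then show ?case
    unfolding as(1) v_def by (rule Suc.IH[of "\<lambda>as b. u (as @ [a]) b"]) (simp_all add: as)
qed

section \<open>Endomorphisms of the free algebra\<close>

text \<open>As a type of class \<open>ring_1\<close>, the linear operators can be entries of
  matrices, so that \<open>scalars\<close>, \<open>lmat\<close> and the exchange relations apply to
  them.\<close>

typedef (overloaded) ('x, 'k::field) fa_endo =
  "{f :: ('x, 'k) free_alg \<Rightarrow> ('x, 'k) free_alg. (\<forall>x y. f (x + y)
      = f x + f y) \<and> (\<forall>c x. f (fa_const c * x) = fa_const c * f x)}"
  morphisms app Abs_fa_endo
  by (rule exI[of _ id]) simp

setup_lifting type_definition_fa_endo

instantiation fa_endo :: (type, field) ring_1
begin

lift_definition zero_fa_endo :: "('a, 'b) fa_endo" is "\<lambda>_. 0" by simp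
lift_definition one_fa_endo :: "('a, 'b) fa_endo" is "\<lambda>x. x" by simp
lift_definition plus_fa_endo :: "('a, 'b) fa_endo \<Rightarrow> ('a, 'b) fa_endo \<Rightarrow> ('a, 'b) fa_endo"
  is "\<lambda>f g x. f x + g x" by (simp add: algebra_simps)
lift_definition uminus_fa_endo :: "('a, 'b) fa_endo \<Rightarrow> ('a, 'b) fa_endo"
  is "\<lambda>f x. - f x" by simp
lift_definition minus_fa_endo :: "('a, 'b) fa_endo \<Rightarrow> ('a, 'b) fa_endo \<Rightarrow> ('a, 'b) fa_endo"
  is "\<lambda>f g x. f x - g x" by (simp add: algebra_simps)
lift_definition times_fa_endo :: "('a, 'b) fa_endo \<Rightarrow> ('a, 'b) fa_endo \<Rightarrow> ('a, 'b) fa_endo"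
  is "\<lambda>f g x. f (g x)" by simp

instance
proof
  show "(0 :: ('a, 'b) fa_endo) \<noteq> 1"
    by transfer (metis zero_neq_one)
qed (transfer; force simp: algebra_simps)+

end

lemma app_add: "app f (x + y) = app f x + app f y"
  and app_const: "app f (fa_const c * x) = fa_const c * app f x"
  by (transfer, simp)+

lemma app_zero [simp]: "app f 0 = 0"
  using app_const[of f 0 0] by simp

lemma app_simps:
  "app 0 x = 0" "app 1 x = x" "app (f + g) x = app f x + app g x" "app (f - g) x
      = app f x - app g x"
  "app (f * g) x = app f (app g x)"
  by (simp_all add: zero_fa_endo.rep_eq one_fa_endo.rep_eq plus_fa_endo.rep_eq minus_fa_endo.rep_eq
      times_fa_endo.rep_eq)

lemma app_sum: "app (\<Sum>i\<in>A. f i) x = (\<Sum>i\<in>A. app (f i) x)"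
  by (induction A rule: infinite_finite_induct) (simp_all add: app_simps)

definition lmul :: "('x, 'k::field) free_alg \<Rightarrow> ('x, 'k) fa_endo" where
  "lmul x = Abs_fa_endo ((*) x)"

lemma app_lmul [simp]: "app (lmul x) y = x * y"
  by (simp add: lmul_def Abs_fa_endo_inverse distrib_left fa.left_central)

lemma fa_endo_ext: "(\<And>x. app f x = app g x) \<Longrightarrow> f = g"
  by (simp add: app_inject[symmetric] ext)

lemma lmul_simps:
  "lmul 1 = 1" "lmul 0 = 0" "lmul (x + y) = lmul x + lmul y" "lmul (x - y)
      = lmul x - lmul y" "lmul (x * y) = lmul x * lmul y"
  by (auto intro!: fa_endo_ext simp: app_simps algebra_simps)

definition endo_const :: "'k \<Rightarrow> ('x, 'k::field) fa_endo" where
  "endo_const c = lmul (fa_const c)"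

interpretation endo: scalars "endo_const :: 'k::field \<Rightarrow> ('x, 'k) fa_endo"
proof
  show "endo_const a * x = x * endo_const a" for a and x :: "('x, 'k) fa_endo"
    unfolding endo_const_def by (rule fa_endo_ext) (simp add: app_simps app_const)
qed (simp_all add: endo_const_def fa_const_add fa_const_mult lmul_simps)

definition lin_endo :: "('x list \<Rightarrow> ('x, 'k::field) free_alg) \<Rightarrow> ('x, 'k) fa_endo" where
  "lin_endo g = Abs_fa_endo (fa_lin g)"

lemma app_lin_endo: "app (lin_endo g) (Poly_Mapping.single w 1) = g w"
  by (simp add: lin_endo_def Abs_fa_endo_inverse fa_lin_add fa_lin_const_mult fa_lin_single)

lemma fa_endo_eqI:
  assumes "\<And>w. app f (Poly_Mapping.single w 1) = app g (Poly_Mapping.single w 1)"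
  shows "f = g"
proof -
  have "app f x = app g x" for x
  proof (induction x rule: fa_additive_induct)
    case (2 w c)
    show ?case by (subst (1 2) single_eq_const_mult) (simp only: app_const assms)
  qed (simp add: app_add)
  then show ?thesis by (rule fa_endo_ext)
qed

lemma endo_const_eq: "endo_const = (\<lambda>c. lmul (fa_const c))"
  by (intro ext) (simp add: endo_const_def)

lemma app_endo_const [simp]: "app (endo_const c) x = fa_const c * x"
  by (simp add: endo_const_def)

section \<open>Ring homomorphisms and evaluation of operators, applied entrywise\<close>

definition unital_hom :: "('a::ring_1 \<Rightarrow> 'b::ring_1) \<Rightarrow> bool" where
  "unital_hom h \<longleftrightarrow> h 1 = 1 \<and> (\<forall>x y. h (x + y) = h x + h y) \<and> (\<forall>x y. h (x * y) = h x * h y)"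

lemma unital_hom_zero: "unital_hom h \<Longrightarrow> h 0 = 0"
  unfolding unital_hom_def by (metis add_cancel_right_right)

lemma unital_hom_diff: "unital_hom h \<Longrightarrow> h (x - y) = h x - h y"
  unfolding unital_hom_def by (metis add_diff_cancel diff_add_cancel)

lemma unital_hom_sum: "unital_hom h \<Longrightarrow> h (\<Sum>i\<in>A. f i) = (\<Sum>i\<in>A. h (f i))"
  by (induction A rule: infinite_finite_induct) (simp_all add: unital_hom_zero, simp add:
      unital_hom_def)

lemma unital_hom_lmul: "unital_hom lmul"
  by (simp add: unital_hom_def lmul_simps)

lemma (in scalars) unital_hom_fa_eval: "unital_hom (fa_eval \<phi> f)"
  by (simp add: unital_hom_def fa_eval_add fa_eval_mult)

lemma gnum_hom_tmul: "unital_hom h \<Longrightarrow> gnum h (A \<cdot> B)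
    = gnum h A \<cdot> gnum h (B :: ('n::finite, 'a::ring_1) tmat)"
  by (intro ext) (simp add: gnum_def tmul_def unital_hom_sum, simp add: unital_hom_def)

lemma gnum_hom_tone: "unital_hom h \<Longrightarrow> gnum h tone = tone"
  by (intro ext) (simp add: gnum_def tone_def unital_hom_zero, simp add: unital_hom_def)

lemma gnum_hom_first_leg: "unital_hom h \<Longrightarrow> gnum h (first_leg X) = first_leg (\<lambda>i j. h (X i j))"
  by (intro ext) (simp add: gnum_def first_leg_def unital_hom_zero)

lemma gnum_hom_diff: "unital_hom h \<Longrightarrow> gnum h (A - B) = gnum h A - gnum h B"
  by (intro ext) (simp add: gnum_def unital_hom_diff)

lemma gnum_gnum: "gnum h (gnum \<phi> A) = gnum (\<lambda>c. h (\<phi> c)) A"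
  by (intro ext) (simp add: gnum_def)

lemma gnum_hom_gbar: "unital_hom h \<Longrightarrow> gnum h (gbar \<phi> F X k)
    = gbar (\<lambda>c. h (\<phi> c)) F (\<lambda>i j. h (X i j)) k"
  by (induction k) (simp_all add: gnum_hom_tone gnum_hom_first_leg gnum_hom_tmul gnum_gnum)

lemma gnum_hom_gbar_prod:
  "unital_hom h \<Longrightarrow> gnum h (gbar_prod \<phi> F X p) = gbar_prod (\<lambda>c. h (\<phi> c)) F (\<lambda>i j. h (X i j)) p"
  by (induction p) (simp_all add: gnum_hom_tone gnum_hom_tmul gnum_hom_gbar del: gbar.simps)

abbreviation app_mat :: "('x, 'k::field) free_alg \<Rightarrow> ('n, ('x, 'k) fa_endo) tmat \<Rightarrow> ('n,
    ('x, 'k) free_alg) tmat" where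
  "app_mat y \<equiv> gnum (\<lambda>f. app f y)"

lemma app_mat_lmul: "app_mat y (gnum lmul D \<cdot> B)
    = D \<cdot> app_mat y (B :: ('n::finite, ('x, 'k::field) fa_endo) tmat)"
  by (intro ext) (simp add: gnum_def tmul_def app_sum app_simps)

lemma app_mat_const: "app_mat y (gnum endo_const C \<cdot> B)
    = gnum fa_const C \<cdot> app_mat y (B :: ('n::finite, ('x, 'k::field) fa_endo) tmat)"
  by (intro ext) (simp add: gnum_def tmul_def app_sum app_simps)

text \<open>Operators are linear and constants are central, so numerical matrices can leave on the
  right as well.\<close>

lemma app_mat_const_right:
  "app_mat y (B \<cdot> gnum endo_const C) = app_mat y (B :: ('n::finite, ('x, 'k::field) fa_endo) tmat)
      \<cdot> gnum fa_const C"
  by (intro ext) (simp add: gnum_def tmul_def app_sum app_simps app_const fa_const_central[of _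
      "app _ _"])

lemma app_mat_first_leg: "app_mat y (first_leg X) = first_leg (\<lambda>i j. app (X i j) y)"
  by (intro ext) (simp add: gnum_def first_leg_def app_simps)

lemma app_mat_diff: "app_mat y (A - B) = app_mat y A - app_mat y B"
  by (intro ext) (simp add: gnum_def app_simps)

definition mat_in :: "nat \<Rightarrow> 'a set \<Rightarrow> ('n, 'a) tmat \<Rightarrow> bool" where
  "mat_in k S A \<longleftrightarrow> (\<forall>xs\<in>tidx k. \<forall>ys\<in>tidx k. A xs ys \<in> S)"

lemma mat_inD: "mat_in k S A \<Longrightarrow> length xs = k \<Longrightarrow> length ys = k \<Longrightarrow> A xs ys \<in> S"
  by (simp add: mat_in_def)

lemma mat_in_left: "mat_in k (rel_ideal S) B \<Longrightarrow> mat_in k (rel_ideal S) (A \<cdot> B)"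
  by (auto simp: mat_in_def tmul_def intro!: rel_ideal_sum rel_ideal_left)

lemma mat_in_right: "mat_in k (rel_ideal S) A \<Longrightarrow> mat_in k (rel_ideal S) (A \<cdot> B)"
  by (auto simp: mat_in_def tmul_def intro!: rel_ideal_sum rel_ideal_right)

lemma mat_in_teq: "teq k A B \<Longrightarrow> mat_in k S A \<longleftrightarrow> mat_in k S B"
  by (simp add: mat_in_def teq_def)

lemma mat_in_const_left:
  "fa_subspace W \<Longrightarrow> mat_in k W A \<Longrightarrow> mat_in k W (gnum fa_const C
      \<cdot> (A :: ('n::finite, ('x, 'k::field) free_alg) tmat))"
  by (auto simp: mat_in_def tmul_def gnum_def intro!: fa_subspace_sum fa_subspace_const)

lemma mat_in_const_right:
  "fa_subspace W \<Longrightarrow> mat_in k W A \<Longrightarrow> mat_in k W ((A :: ('n::finite, ('x, 'k::field) free_alg) tmat)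
      \<cdot> gnum fa_const C)"
  by (auto simp: mat_in_def tmul_def gnum_def fa_const_central[symmetric] intro!: fa_subspace_sum
      fa_subspace_const)

text \<open>The levels of a \<open>tmat\<close> may be unrelated; this singles out the families that
  act in the first \<open>k\<close> factors and as the identity beyond.\<close>

definition local_mat :: "nat \<Rightarrow> ('n, 'a::semiring_1) tmat \<Rightarrow> bool" where
  "local_mat k A \<longleftrightarrow> (\<forall>K\<ge>k. teq K A (embed_at 0 k A))"

lemma local_tone: "local_mat k tone"
  by (simp add: local_mat_def embed_at_tone teq_sym)

lemma local_tmul: "local_mat k A \<Longrightarrow> local_mat k B
    \<Longrightarrow> local_mat k (A \<cdot> (B :: ('n::finite, 'a::semiring_1) tmat))"
  unfolding local_mat_def
  by (intro allI impI teq_trans[OF teq_tmul embed_at_tmul[THEN teq_sym]]) auto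

lemma local_diff: "local_mat k A \<Longrightarrow> local_mat k B \<Longrightarrow> local_mat k (A - (B :: ('n, 'a::ring_1) tmat))"
  by (simp add: local_mat_def teq_def embed_at_def kron_def right_diff_distrib left_diff_distrib)

lemma local_app_mat: "local_mat k A \<Longrightarrow> local_mat k (app_mat y A)"
  by (auto simp: local_mat_def teq_def embed_at_def kron_def gnum_def tone_def app_simps)

lemma local_first_leg: "1 \<le> k \<Longrightarrow> local_mat k (first_leg M)"
  by (auto simp: local_mat_def intro!: embed_at_first_leg[THEN teq_sym])

lemma (in scalars) local_leg: "1 \<le> i \<Longrightarrow> i < k \<Longrightarrow> local_mat k (gnum \<phi> (leg i X))"
  using gnum_teq[OF embed_at_leg[of i k 0 _ X], of _ \<phi>]
  by (auto simp: local_mat_def gnum_embed_at intro: teq_sym)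

lemma (in scalars) local_gbar: "1 \<le> i \<Longrightarrow> i \<le> k \<Longrightarrow> local_mat k (gbar \<phi> F X i)"
proof (induction i)
  case (Suc i)
  then show ?case
    by (cases "i = 0") (auto intro!: local_tmul local_leg local_first_leg)
qed simp

lemma (in scalars) local_gbar_prod: "p \<le> k \<Longrightarrow> local_mat k (gbar_prod \<phi> F X p)"
  by (induction p) (auto simp del: gbar.simps intro!: local_tone local_tmul local_gbar)

lemma local_entry:
  assumes "local_mat k A" "length us = k" "length vs = k" "length ts = length ws"
  shows "A (us @ ws) (vs @ ts) = (if ws = ts then A us vs else 0)"
proof -
  have "teq (k + length ws) A (embed_at 0 k A)" using assms(1) by (simp add: local_mat_def)
  from teqD[OF this, of "us @ ws" "vs @ ts"] show ?thesis
    using assms by (simp add: embed_at_def kron_def tone_def)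
qed

lemma local_mat_in:
  assumes "local_mat k A" "mat_in k S A" "0 \<in> S" "k \<le> K"
  shows "mat_in K S A"
  unfolding mat_in_def
proof (intro ballI)
  fix xs ys :: "'a list" assume *: "xs \<in> tidx K" "ys \<in> tidx K"
  have "A (take k xs @ drop k xs) (take k ys @ drop k ys) \<in> S"
    using * assms(2-4) by (subst local_entry[OF assms(1)]) (auto simp: mat_in_def)
  then show "A xs ys \<in> S" by simp
qed

lemma local_tmul_entry:
  fixes D :: "('n::finite, 'a::semiring_1) tmat"
  assumes "local_mat k D" "length us = k"
  shows "(D \<cdot> A) (us @ ws) ys = (\<Sum>vs\<in>tidx k. D us vs * A (vs @ ws) ys)"
proof -
  have "(D \<cdot> A) (us @ ws) ys = (\<Sum>vs\<in>tidx k. \<Sum>ts\<in>tidx (length ws). (if ws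
      = ts then D us vs else 0) * A (vs @ ts) ys)"
    using assms(2) by (simp add: tmul_def sum_tidx_append local_entry[OF assms(1)])
  also have "\<dots> = (\<Sum>vs\<in>tidx k. D us vs * A (vs @ ws) ys)"
    by (simp add: if_distrib[of "\<lambda>x. x * _"] sum.delta cong: if_cong)
  finally show ?thesis .
qed

lemma tmul_local_entry:
  fixes D :: "('n::finite, 'a::semiring_1) tmat"
  assumes "local_mat k D" "length vs = k" "length xs = k + length ts"
  shows "(A \<cdot> D) xs (vs @ ts) = (\<Sum>us\<in>tidx k. A xs (us @ ts) * D us vs)"
proof -
  have "(A \<cdot> D) xs (vs @ ts) = (\<Sum>us\<in>tidx k. \<Sum>ws\<in>tidx (length ts). A xs (us @ ws) * (if ws
      = ts then D us vs else 0))"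
    using assms(2,3) by (simp add: tmul_def sum_tidx_append local_entry[OF assms(1)])
  also have "\<dots> = (\<Sum>us\<in>tidx k. A xs (us @ ts) * D us vs)"
    by (simp add: if_distrib[of "\<lambda>x. _ * x"] sum.delta' cong: if_cong)
  finally show ?thesis .
qed

lemma first_leg_tmul: "(first_leg X \<cdot> B) (i # js) ys
    = (\<Sum>a\<in>UNIV. X i a * B (a # js) (ys :: 'n::finite list) :: 'a::semiring_1)"
proof -
  have "(first_leg X \<cdot> B) (i # js) ys = (\<Sum>a\<in>UNIV. \<Sum>us\<in>tidx (length js). (if js
      = us then X i a else 0) * B (a # us) ys)"
    by (simp add: tmul_def sum_tidx_Cons first_leg_def cong: if_cong)
  also have "\<dots> = (\<Sum>a\<in>UNIV. X i a * B (a # js) ys)"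
    by (simp add: if_distrib[of "\<lambda>x. x * _"] sum.delta cong: if_cong)
  finally show ?thesis .
qed

lemma tmul_first_leg:
  assumes "length xs = Suc (length cs)"
  shows "(B \<cdot> first_leg X) xs (k # cs)
      = (\<Sum>b\<in>UNIV. B xs (b # cs) * X b (k :: 'n::finite) :: 'a::semiring_1)"
proof -
  have "(B \<cdot> first_leg X) xs (k # cs) = (\<Sum>b\<in>UNIV. \<Sum>us\<in>tidx (length cs). B xs (b # us) * (if us
      = cs then X b k else 0))"
    using assms by (simp add: tmul_def sum_tidx_Cons first_leg_def cong: if_cong)
  also have "\<dots> = (\<Sum>b\<in>UNIV. B xs (b # cs) * X b k)"
    by (simp add: if_distrib[of "\<lambda>x. _ * x"] sum.delta' cong: if_cong)
  finally show ?thesis .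
qed

lemma gbar_2: "gbar \<phi> G X 2 = gnum \<phi> (leg 1 G) \<cdot> first_leg X \<cdot> gnum \<phi> (leg 1 (matrix_inv G))"
  by (simp add: numeral_2_eq_2)

lemma first_leg_leg_first_leg:
  "(first_leg A \<cdot> gnum \<phi> (leg 1 R) \<cdot> first_leg B) [i, j] [k, l]
    = (\<Sum>a\<in>UNIV. \<Sum>b\<in>UNIV. A i a * \<phi> (R $ (a, j) $ (b, l)) * (B b (k :: 'n::finite) :: 'a::ring_1))"
  if "\<phi> 0 = 0"
  unfolding tmul_assoc using that
  by (simp add: first_leg_tmul tmul_first_leg sum_distrib_left gnum_def leg_def mult.assoc)

lemma QMA_rels_entries: "QMA_rels R F X = {(gnum fa_const (leg 1 R) \<cdot> gbar_prod fa_const F X 2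
    - gbar_prod fa_const F X 2 \<cdot> gnum fa_const (leg 1 R)) xs ys | xs ys. xs \<in> tidx 2 \<and> ys \<in> tidx 2}"
  by (simp add: QMA_rels_def entry_rels_def num_eq_gnum bar_eq_gbar numeral_2_eq_2 tmul_assoc del:
      gbar.simps)

lemma cross_rhs_in:
  fixes G Y :: "'n::finite \<Rightarrow> 'n \<Rightarrow> ('x, 'k::field) free_alg"
  assumes W: "fa_subspace W" and mem: "\<And>i j a k. G i j * Y a k \<in> W"
  shows "mat_in 2 W (gnum fa_const A \<cdot> (first_leg G \<cdot> (gnum fa_const B \<cdot> (first_leg Y
      \<cdot> gnum fa_const C))))"
proof -
  \<comment> \<open>The numerical matrices mix different entries of \<open>Y\<close> behind a fixed
    entry of \<open>G\<close>. \<open>W'\<close> collects the elements that every entry of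
    \<open>G\<close> carries into \<open>W\<close>, so the mixing can take place inside
    \<open>W'\<close>.\<close>
  define W' where "W' = {z. \<forall>i j. G i j * z \<in> W}"
  have W': "fa_subspace W'"
    using W by (auto simp: W'_def fa_subspace_def distrib_left fa.left_central)
  have "mat_in 2 W' (first_leg Y)"
    using mem W by (simp add: mat_in_def first_leg_def W'_def fa_subspace_def)
  then have "mat_in 2 W' (gnum fa_const B \<cdot> (first_leg Y \<cdot> gnum fa_const C))"
    by (intro mat_in_const_left mat_in_const_right W')
  then have "mat_in 2 W (first_leg G \<cdot> (gnum fa_const B \<cdot> (first_leg Y \<cdot> gnum fa_const C)))"
    using W by (auto simp: mat_in_def tmul_def first_leg_def W'_def fa_subspace_def intro!:
        fa_subspace_sum)
  then show ?thesis by (intro mat_in_const_left W)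
qed

text \<open>Solves the exchange relation, known only modulo \<open>W\<close> and at
  \<open>x\<close>, for the single values of L_i^a M_b^k. The operators \<open>L\<close> are
  arbitrary because two cases are needed: \<open>Lop\<close> on the free algebra in the M_i^j, and
  left multiplication by the generators of B_r.\<close>

lemma skew_cross_solve:
  fixes L :: "'n::finite \<Rightarrow> 'n \<Rightarrow> ('x, 'k::field) fa_endo" and G :: "'n \<Rightarrow> 'n \<Rightarrow> ('x, 'k) free_alg"
  defines "M \<equiv> first_leg (\<lambda>i j. lmul (G i j))"
  assumes skew: "skew_inverse R \<Psi>" and W: "fa_subspace W"
    and rel: "mat_in 2 W (app_mat x (first_leg L \<cdot> gnum endo_const (leg 1 R) \<cdot> M
        - gnum endo_const C \<cdot> M \<cdot> gbar endo_const F L 2))"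
    and mem: "\<And>i j a k. G i j * app (L a k) x \<in> W"
  shows "app (L i a) (G b k * x) \<in> W"
proof (rule skew_solve[OF skew W, where v = "\<lambda>a b. app (L i a) (G b k * x)"])
  fix j l
  let ?A = "first_leg L \<cdot> gnum endo_const (leg 1 R) \<cdot> M"
      and ?B = "gnum endo_const C \<cdot> M \<cdot> gbar endo_const F L 2"
  have M: "M = gnum lmul (first_leg G)"
    by (simp add: M_def gnum_hom_first_leg[OF unital_hom_lmul])
  have 1: "mat_in 2 W (app_mat x ?B)"
    unfolding gbar_2 tmul_assoc M app_mat_const app_mat_lmul app_mat_const_right app_mat_first_leg
    by (rule cross_rhs_in[OF W mem])
  have "app_mat x ?A [i, j] [k, l] = app_mat x (?A - ?B) [i, j] [k, l] + app_mat x ?B [i, j] [k, l]"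
    by (simp add: app_mat_diff)
  also have "\<dots> \<in> W"
    using mat_inD[OF rel, of "[i, j]" "[k, l]"] mat_inD[OF 1, of "[i, j]" "[k, l]"] W
    by (simp add: fa_subspace_def)
  also have "app_mat x ?A [i, j] [k, l]
      = app (\<Sum>a\<in>UNIV. \<Sum>b\<in>UNIV. L i a * endo_const (R $ (a, j) $ (b, l)) * lmul (G b k)) x"
    unfolding M_def by (subst gnum_def) (simp only: first_leg_leg_first_leg endo.zero)
  also have "\<dots> = (\<Sum>a\<in>UNIV. \<Sum>b\<in>UNIV. fa_const (R $ (a, j) $ (b, l)) * app (L i a) (G b k * x))"
    by (simp only: app_sum app_simps app_endo_const app_const app_lmul)
  finally show "(\<Sum>a\<in>UNIV. \<Sum>b\<in>UNIV. fa_const (R $ (a, j) $ (b, l)) * app (L i a) (G b k * x)) \<in> W" .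
qed

section \<open>The action on the free algebra\<close>

locale braided =
  fixes R F \<Psi> :: "('n::finite, 'k::field) mat2" and \<eta> :: 'k
  assumes R: "R_matrix R" and F: "R_matrix F" and RF: "compatible_pair R F"
    and skew: "skew_inverse R \<Psi>"
begin

sublocale compatible "endo_const :: 'k \<Rightarrow> ('n \<times> 'n, 'k) fa_endo" R F \<eta>
  by unfold_locales (fact R F RF)+

text \<open>
  The action of $L_i^{\,j}$ on words in the $M_i^{\,j}$: the skew inverse solves
  $L_1 R_1 M_1 = \eta R_1^{-1} M_1 L_{\overline 2}$ for $L_i^{\,a} M_b^{\,k}$.
\<close>

primrec L_word :: "('n \<times> 'n) list \<Rightarrow> 'n \<Rightarrow> 'n \<Rightarrow> ('n \<times> 'n, 'k) free_alg" where
  "L_word [] = (\<lambda>i a. if i = a then 1 else 0)"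
| "L_word (v # w) = (\<lambda>i a. \<Sum>j\<in>UNIV. \<Sum>l\<in>UNIV. fa_const (\<Psi> $ (l, fst v) $ (j, a)) *
     (gnum fa_const (leg 1 S) \<cdot> first_leg gen \<cdot> gbar fa_const F (L_word w) 2) [i, j] [snd v, l])"

definition Lop :: "'n \<Rightarrow> 'n \<Rightarrow> ('n \<times> 'n, 'k) fa_endo" where
  "Lop i a = lin_endo (\<lambda>w. L_word w i a)"

definition Mop :: "'n \<Rightarrow> 'n \<Rightarrow> ('n \<times> 'n, 'k) fa_endo" where
  "Mop i a = lmul (gen i a)"

lemma Lop_word: "app (Lop i a) (Poly_Mapping.single w 1) = L_word w i a"
  by (simp add: Lop_def app_lin_endo)

lemma Lop_one: "app (Lop i a) 1 = (if i = a then 1 else 0)"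
  using Lop_word[of i a "[]"] by (simp flip: one_free)

text \<open>Inserting the recursion of \<open>L_word\<close> composes \<Psi> with R, and the second
  trace identity of the skew inverse collapses the sums.\<close>

lemma Lop_gen_word:
  "(\<Sum>a\<in>UNIV. \<Sum>b\<in>UNIV. fa_const (R $ (a, j) $ (b, l)) * L_word ((b, k) # w) i a)
    = (gnum fa_const (leg 1 S) \<cdot> first_leg gen \<cdot> gbar fa_const F (L_word w) 2) [i, j] [k, l]"
proof -
  define X where "X j l = (gnum fa_const (leg 1 S) \<cdot> first_leg gen
      \<cdot> gbar fa_const F (L_word w) 2) [i, j] [k, l]" for j l
  have "(\<Sum>a\<in>UNIV. \<Sum>b\<in>UNIV. fa_const (R $ (a, j) $ (b, l)) * L_word ((b, k) # w) i a)
    = (\<Sum>a\<in>UNIV. \<Sum>b\<in>UNIV. \<Sum>j'\<in>UNIV. \<Sum>l'\<in>UNIV. fa_const (\<Psi> $ (l', b) $ (j', a) * R $ (a, j) $ (b, l))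
        * X j' l')"
    by (simp add: X_def sum_distrib_left fa_const_mult mult.assoc mult.commute[of _ "R $ _ $ _"])
  also have "\<dots> = (\<Sum>b\<in>UNIV. \<Sum>a\<in>UNIV. \<Sum>j'\<in>UNIV. \<Sum>l'\<in>UNIV. fa_const (\<Psi> $ (l', b) $ (j', a)
      * R $ (a, j) $ (b, l)) * X j' l')"
    by (rule sum.swap)
  also have "\<dots> = (\<Sum>b\<in>UNIV. \<Sum>j'\<in>UNIV. \<Sum>l'\<in>UNIV. \<Sum>a\<in>UNIV. fa_const (\<Psi> $ (l', b) $ (j', a)
      * R $ (a, j) $ (b, l)) * X j' l')"
    by (rule sum.cong[OF refl], rule sum_rotate)
  also have "\<dots> = (\<Sum>j'\<in>UNIV. \<Sum>l'\<in>UNIV. \<Sum>b\<in>UNIV. \<Sum>a\<in>UNIV. fa_const (\<Psi> $ (l', b) $ (j', a)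
      * R $ (a, j) $ (b, l)) * X j' l')"
    by (rule sum_rotate)
  also have "\<dots> = (\<Sum>j'\<in>UNIV. \<Sum>l'\<in>UNIV. fa_const (if j' = j \<and> l = l' then 1 else 0) * X j' l')"
    by (simp add: skew_inverse_entries(2)[OF skew, symmetric] fa.sum sum_distrib_right)
  also have "\<dots> = (\<Sum>j'\<in>UNIV. \<Sum>l'\<in>UNIV. (if l' = l \<and> j' = j then 1 else 0) * X j' l')"
    by (intro sum.cong refl) auto
  finally show ?thesis by (simp only: sum_delta2) (simp only: X_def)
qed

text \<open>A nonempty word has exactly one first letter, so the recursion of \<open>L_word\<close>
  meets no consistency condition, and the exchange relation holds as an identity of operators, not
  just modulo the ideal.\<close>

sublocale crossed "endo_const :: 'k \<Rightarrow> ('n \<times> 'n, 'k) fa_endo" R F \<eta> Lop Mop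
proof
  have "(first_leg Lop \<cdot> gnum endo_const (leg 1 R) \<cdot> first_leg Mop) [i, j] [k, l]
    = (gnum endo_const (leg 1 S) \<cdot> first_leg Mop
        \<cdot> gbar endo_const F Lop 2) [i, j] [k, l]" for i j k l
  proof (rule fa_endo_eqI)
    fix w
    let ?w = "Poly_Mapping.single w 1 :: ('n \<times> 'n, 'k) free_alg"
    have M: "first_leg Mop = gnum lmul (first_leg gen)"
      by (simp add: gnum_hom_first_leg[OF unital_hom_lmul] Mop_def[abs_def])
    have "app ((first_leg Lop \<cdot> gnum endo_const (leg 1 R) \<cdot> first_leg Mop) [i, j] [k, l]) ?w
      = (\<Sum>a\<in>UNIV. \<Sum>b\<in>UNIV. fa_const (R $ (a, j) $ (b, l)) * app (Lop i a) (fa_var (b, k) * ?w))"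
      by (simp only: first_leg_leg_first_leg endo.zero app_sum app_simps app_endo_const app_const
          app_lmul Mop_def gen_def)
    also have "\<dots> = (gnum fa_const (leg 1 S) \<cdot> first_leg gen
        \<cdot> gbar fa_const F (L_word w) 2) [i, j] [k, l]"
      by (simp only: single_Cons[symmetric] Lop_word Lop_gen_word)
    also have "\<dots> = app_mat ?w (gnum endo_const (leg 1 S) \<cdot> first_leg Mop
        \<cdot> gbar endo_const F Lop 2) [i, j] [k, l]"
      unfolding gbar_2 tmul_assoc M app_mat_const app_mat_lmul app_mat_const_right app_mat_first_leg
          Lop_word ..
    finally show "app ((first_leg Lop \<cdot> gnum endo_const (leg 1 R) \<cdot> first_leg Mop) [i, j] [k, l]) ?w
      = app ((gnum endo_const (leg 1 S) \<cdot> first_leg Mop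
          \<cdot> gbar endo_const F Lop 2) [i, j] [k, l]) ?w"
      by (simp add: gnum_def)
  qed
  then show "teq 2 (first_leg Lop \<cdot> gnum endo_const (leg 1 R) \<cdot> first_leg Mop)
     (gnum endo_const (leg 1 S) \<cdot> first_leg Mop \<cdot> gbar endo_const F Lop 2)"
    by (auto intro!: teqI simp: numeral_2_eq_2 length_Suc_conv)
qed

definition I :: "('n \<times> 'n, 'k) free_alg set" where
  "I = rel_ideal (QMA_rels R F gen)"

definition Q :: "('n, ('n \<times> 'n, 'k) free_alg) tmat" where
  "Q = gnum fa_const (leg 1 R) \<cdot> gbar_prod fa_const F gen 2 - gbar_prod fa_const F gen 2
      \<cdot> gnum fa_const (leg 1 R)"

lemma QMA_rels_eq: "QMA_rels R F gen = {Q xs ys | xs ys. xs \<in> tidx 2 \<and> ys \<in> tidx 2}"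
  unfolding Q_def by (rule QMA_rels_entries)

lemma local_Q: "local_mat 2 Q"
  unfolding Q_def by (intro local_diff local_tmul fa.local_leg fa.local_gbar_prod) auto

lemma Q_in: "mat_in 2 I Q"
  unfolding mat_in_def I_def QMA_rels_eq by (intro ballI rel_ideal_incl) blast

lemma I_subspace: "fa_subspace I"
  unfolding I_def by (rule fa_subspace_rel_ideal)

lemma lmul_Q: "gnum lmul Q = gnum endo_const (leg 1 R) \<cdot> gbar_prod endo_const F Mop 2
    - gbar_prod endo_const F Mop 2 \<cdot> gnum endo_const (leg 1 R)"
  unfolding Q_def by (simp add: gnum_hom_diff gnum_hom_tmul gnum_hom_gbar_prod unital_hom_lmul
      gnum_gnum
      endo_const_eq Mop_def[abs_def] del: gbar_prod.simps)

lemma Lop_Q_in: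
  assumes "length xs = 2" "length ys = 2"
  shows "app (Lop i a) (Q xs ys * y) \<in> I"
proof (rule leg_chain_solve[OF skew I_subspace, where p = 2
    and u = "\<lambda>a bs. app (Lop i a) (Q bs ys * y)"])
  fix js :: "'n list" and l assume js: "length js = 2"
  let ?b = "gbar endo_const F Lop 3"
  have loc: "local_mat 2 (gnum lmul Q)"
    unfolding lmul_Q by (intro local_diff local_tmul endo.local_leg endo.local_gbar_prod) auto
  have eq: "(first_leg Lop \<cdot> gnum endo_const (leg_chain R 2) \<cdot> gnum lmul Q) (i # js) (ys @ [l])
    = (gnum endo_const (leg_chain S 2) \<cdot> gnum lmul Q \<cdot> ?b) (i # js) (ys @ [l])"
    unfolding lmul_Q by (rule teqD[OF cross_ideal]) (use js assms in auto)
  \<comment> \<open>After evaluation at \<open>y\<close> the entries of \<open>Q\<close> multiply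
    the values of L_{bar 3} from the left, so this side lies in the ideal;
    \<open>leg_chain_solve\<close> then isolates the values of single operators.\<close>
  have "mat_in 3 I (gnum fa_const (leg_chain S 2) \<cdot> (Q \<cdot> app_mat y ?b))"
    unfolding I_def
    by (rule mat_in_left, rule mat_in_right, rule local_mat_in[OF local_Q])
      (use Q_in in \<open>auto simp: I_def\<close>)
  then have "app_mat y (gnum endo_const (leg_chain S 2) \<cdot> gnum lmul Q \<cdot> ?b) (i # js) (ys @ [l]) \<in> I"
    unfolding tmul_assoc app_mat_const app_mat_lmul
    by (rule mat_inD) (use js assms in auto)
  then have "app ((first_leg Lop \<cdot> gnum endo_const (leg_chain R 2)
      \<cdot> gnum lmul Q) (i # js) (ys @ [l])) y \<in> I"
    unfolding eq by (simp add: gnum_def)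
  also have "app ((first_leg Lop \<cdot> gnum endo_const (leg_chain R 2)
      \<cdot> gnum lmul Q) (i # js) (ys @ [l])) y
    = (\<Sum>a\<in>UNIV. \<Sum>bs\<in>tidx 2. fa_const (leg_chain R 2 (a # js) (bs @ [l])) * app (Lop i a) (Q bs ys
        * y))"
    unfolding tmul_assoc first_leg_tmul using js assms
    by (simp add: tmul_local_entry[OF loc] sum_distrib_left app_sum app_simps gnum_def app_const)
  finally show "(\<Sum>a\<in>UNIV. \<Sum>bs\<in>tidx 2. fa_const (leg_chain R 2 (a # js) (bs @ [l]))
      * app (Lop i a) (Q bs ys * y)) \<in> I" .
qed (use assms in auto)

text \<open>Since \<open>cross\<close> is exact, the relation demanded by
  \<open>skew_cross_solve\<close> holds modulo any subspace \<open>W\<close>.\<close>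

lemma Lop_gen_mult:
  assumes W: "fa_subspace W" and mem: "\<And>i a v. fa_var v * app (Lop i a) x \<in> W"
  shows "app (Lop i a) (fa_var v * x) \<in> W"
proof -
  have "mat_in 2 W (app_mat x (first_leg Lop \<cdot> gnum endo_const (leg 1 R) \<cdot> first_leg Mop
      - gnum endo_const (leg 1 S) \<cdot> first_leg Mop \<cdot> gbar endo_const F Lop 2))"
    using cross W unfolding mat_in_def teq_def gnum_def[of "\<lambda>f. app f x"]
    by (simp add: fa_subspace_def app_simps)
  moreover have "gen i j * app (Lop a k) x \<in> W" for i j a k
    unfolding gen_def by (rule mem)
  ultimately have "app (Lop i a) (gen b k * x) \<in> W" for b k
    using skew_cross_solve[OF skew W, of x Lop gen "leg 1 S" F] by (simp add: Mop_def[abs_def])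
  then show ?thesis by (cases v) (simp add: gen_def)
qed

lemma fa_left_mult_induct:
  assumes "fa_subspace W" "x \<in> W" "\<And>v z. z \<in> W \<Longrightarrow> fa_var v * z \<in> W"
  shows "y * x \<in> W"
  using assms by (induction y rule: fa_induct) (auto simp: fa_subspace_def distrib_right mult.assoc)

lemma Lop_I:
  assumes "x \<in> I"
  shows "app (Lop i a) x \<in> I"
proof -
  \<comment> \<open>The operators act from the left, whereas the ideal is two-sided; right multiples
    are therefore built into \<open>T\<close>, and left multiples by generators are handled by
    \<open>Lop_gen_mult\<close>.\<close>
  define T where "T = {x. \<forall>y i a. x * y \<in> I \<and> app (Lop i a) (x * y) \<in> I}"
  have T: "fa_subspace T"
    using I_subspace by (auto simp: T_def fa_subspace_def distrib_right app_add app_const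
        mult.assoc)
  from assms have "x \<in> T"
    unfolding I_def
  proof (induction rule: rel_ideal_induct)
    case (incl x)
    then show ?case
      using Lop_Q_in Q_in
      by (auto simp: QMA_rels_eq T_def I_def mat_in_def intro: rel_ideal_right)
  next
    case (left x y)
    then show ?case
    proof (rule fa_left_mult_induct[OF T])
      fix v z assume z: "z \<in> T"
      have "app (Lop i a) (fa_var v * (z * y)) \<in> I" for i a y
        using z by (intro Lop_gen_mult I_subspace) (auto simp: T_def I_def intro: rel_ideal_left)
      then show "fa_var v * z \<in> T"
        using z by (auto simp: T_def I_def mult.assoc intro: rel_ideal_left)
    qed
  next
    case (right x y)
    then show ?case by (auto simp: T_def mult.assoc)
  qed (use T in \<open>auto simp: fa_subspace_def\<close>)
  then show ?thesis unfolding T_def by (metis (mono_tags) mem_Collect_eq mult_1_right)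
qed

definition E :: "('n, ('n \<times> 'n, 'k) fa_endo) tmat" where
  "E = gnum endo_const (leg 1 R) \<cdot> first_leg Lop \<cdot> gnum endo_const (leg 1 R) \<cdot> first_leg Lop
     - first_leg Lop \<cdot> gnum endo_const (leg 1 R) \<cdot> first_leg Lop \<cdot> gnum endo_const (leg 1 R)"

lemma local_E: "local_mat 2 E"
  unfolding E_def by (intro local_diff local_tmul endo.local_leg local_first_leg) auto

lemma app_mat_tone:
  assumes "teq k (app_mat 1 B) (gnum fa_const C)"
  shows "teq k (app_mat 1 (A \<cdot> B)) (app_mat 1 (A :: ('n, ('n \<times> 'n, 'k) fa_endo) tmat)
      \<cdot> gnum fa_const C)"
proof -
  have "app (A xs us * B us ys) 1 = app (A xs us) 1 * fa_const (C us ys)" if "length us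
      = k" "length ys = k" for xs us ys
    using teqD[OF assms, of us ys] that app_const[of "A xs us" "C us ys" 1]
    by (simp add: gnum_def app_simps fa_const_central[of _ "app _ _"])
  then show ?thesis
    by (intro teqI) (simp add: gnum_def tmul_def app_sum)
qed

text \<open>On 1 the matrix L acts as the identity, so both terms of \<open>E\<close> give
  R_1^2.\<close>

lemma E_one: "mat_in 2 I (app_mat 1 E)"
proof -
  let ?r = "gnum endo_const (leg 1 R) :: ('n, ('n \<times> 'n, 'k) fa_endo) tmat" and ?l = "first_leg Lop"
  have l: "teq 2 (app_mat 1 ?l) (gnum fa_const tone)"
    by (auto intro!: teqI simp: app_mat_first_leg first_leg_def Lop_one tone_def length_Suc_conv
        numeral_2_eq_2)
  have r: "app_mat 1 ?r = gnum fa_const (leg 1 R)"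
    by (intro ext) (simp add: gnum_def)
  have rl: "teq 2 (app_mat 1 (A \<cdot> ?l)) (app_mat 1 A)" for A :: "('n, ('n \<times> 'n, 'k) fa_endo) tmat"
    using teq_trans[OF app_mat_tone[OF l] ] by (simp add: fa.gnum_tone teq_tmul_tone)
  have rl_r: "teq 2 (app_mat 1 (?r \<cdot> ?l)) (gnum fa_const (leg 1 R))"
    using rl[of ?r] unfolding r .
  have "teq 2 (app_mat 1 (?r \<cdot> ?l \<cdot> ?r \<cdot> ?l)) (app_mat 1 (?r \<cdot> ?l \<cdot> ?r))" by (rule rl)
  also have "teq 2 \<dots> (gnum fa_const (leg 1 R) \<cdot> gnum fa_const (leg 1 R))"
    unfolding app_mat_const_right by (intro teq_tmul rl_r teq_refl)
  finally have 1: "teq 2 (app_mat 1 (?r \<cdot> ?l \<cdot> ?r \<cdot> ?l)) (gnum fa_const (leg 1 R)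
      \<cdot> gnum fa_const (leg 1 R))" .
  have "teq 2 (app_mat 1 (?l \<cdot> ?r)) (gnum fa_const (leg 1 R))"
    unfolding app_mat_const_right using teq_tmul[OF l teq_refl[of 2 "gnum fa_const (leg 1 R)"]]
        by simp
  then have "teq 2 (app_mat 1 (?l \<cdot> ?r \<cdot> ?l)) (gnum fa_const (leg 1 R))"
    using rl teq_trans by blast
  then have 2: "teq 2 (app_mat 1 (?l \<cdot> ?r \<cdot> ?l \<cdot> ?r)) (gnum fa_const (leg 1 R)
      \<cdot> gnum fa_const (leg 1 R))"
    unfolding app_mat_const_right[of _ "?l \<cdot> ?r \<cdot> ?l"] by (rule teq_tmul) (rule teq_refl)
  show ?thesis
    using teqD[OF 1] teqD[OF 2] I_subspace
    by (simp add: mat_in_def E_def app_mat_diff fa_subspace_def)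
qed

text \<open>Evaluated at \<open>y\<close>, the right-hand side of \<open>cross_reflection\<close>
  contains \<open>E\<close> applied to \<open>y\<close>, surrounded only by constants and left
  multiplications, so it lies in the ideal. Removing R_2R_1 from the left-hand side gives
  \<open>E\<close> on the products of a generator with \<open>y\<close>.\<close>

lemma E_var:
  assumes "mat_in 2 I (app_mat y E)"
  shows "mat_in 2 I (app_mat (fa_var v * y) E)"
proof -
  obtain b k where v: "v = (b, k)" by (cases v)
  have "app (E is as) (fa_var (b, k) * y) \<in> I" if len: "length is = 2" "length as = 2" for "is" as
  proof (rule rev_chain_solve[OF skew I_subspace, where p = 2
      and u = "\<lambda>as b. app (E is as) (fa_var (b, k) * y)"])
    fix cs :: "'n list" and j assume cs: "length cs = 2"
    let ?C = "leg 2 R \<cdot> leg 1 R"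
    \<comment> \<open>The recursion of \<open>rev_chain\<close> ends in \<open>tone\<close>, which
      is a right unit only at index lists of equal length.\<close>
    have C: "rev_chain R 2 xs ys = ?C xs ys" if "length ys = length xs" for xs ys
      using that by (simp add: numeral_2_eq_2 tmul_assoc[symmetric] tmul_tone)
    have eq: "(E \<cdot> gnum endo_const ?C \<cdot> first_leg Mop) (is @ [j]) (k # cs)
      = (gnum endo_const (leg 2 S \<cdot> leg 1 S) \<cdot> first_leg Mop \<cdot> gnum endo_const (leg 1 F \<cdot> leg 2 F)
          \<cdot> E
          \<cdot> gnum endo_const (leg 2 Fi \<cdot> leg 1 Fi)) (is @ [j]) (k # cs)"
      unfolding E_def by (rule teqD[OF cross_reflection]) (use cs len in auto)
    have M: "first_leg Mop = gnum lmul (first_leg gen)"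
      by (simp add: gnum_hom_first_leg[OF unital_hom_lmul] Mop_def[abs_def])
    have "mat_in 3 I (app_mat y E)"
      by (rule local_mat_in[OF local_app_mat[OF local_E] assms])
        (use I_subspace in \<open>auto simp: fa_subspace_def\<close>)
    then have "mat_in 3 I (gnum fa_const (leg 2 S \<cdot> leg 1 S) \<cdot> (first_leg gen
        \<cdot> (gnum fa_const (leg 1 F \<cdot> leg 2 F)
        \<cdot> (app_mat y E \<cdot> gnum fa_const (leg 2 Fi \<cdot> leg 1 Fi)))))"
      unfolding I_def by (rule mat_in_left[OF mat_in_left[OF mat_in_left[OF mat_in_right]]])
    then have "app_mat y (gnum endo_const (leg 2 S \<cdot> leg 1 S) \<cdot> first_leg Mop
        \<cdot> gnum endo_const (leg 1 F \<cdot> leg 2 F) \<cdot> E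
          \<cdot> gnum endo_const (leg 2 Fi \<cdot> leg 1 Fi)) (is @ [j]) (k # cs) \<in> I"
      unfolding tmul_assoc unfolding M app_mat_const app_mat_lmul app_mat_const_right
      by (rule mat_inD) (use len cs in auto)
    then have "app ((E \<cdot> gnum endo_const ?C \<cdot> first_leg Mop) (is @ [j]) (k # cs)) y \<in> I"
      unfolding eq by (simp add: gnum_def)
    also have "app ((E \<cdot> gnum endo_const ?C \<cdot> first_leg Mop) (is @ [j]) (k # cs)) y
      = (\<Sum>as\<in>tidx 2. \<Sum>b\<in>UNIV. fa_const (rev_chain R 2 (as @ [j]) (b # cs))
          * app (E is as) (fa_var (b, k) * y))"
      unfolding tmul_assoc[of E] using len cs
      by (simp add: local_tmul_entry[OF local_E] tmul_first_leg app_sum app_simps gnum_def app_const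
          C Mop_def gen_def
          sum_distrib_left)
    finally show "(\<Sum>as\<in>tidx 2. \<Sum>b\<in>UNIV. fa_const (rev_chain R 2 (as @ [j]) (b # cs))
        * app (E is as) (fa_var (b, k) * y)) \<in> I" .
  qed (use len in auto)
  then show ?thesis by (auto simp: mat_in_def gnum_def v)
qed

lemma E_in: "mat_in 2 I (app_mat y E)"
proof (induction y rule: fa_induct)
  case (add x y)
  then show ?case using I_subspace by (simp add: mat_in_def gnum_def app_add fa_subspace_def)
next
  case (scale c x)
  then show ?case using I_subspace by (simp add: mat_in_def gnum_def app_const fa_subspace_def)
qed (fact E_one E_var)+

end

section \<open>The action on the quantum matrix algebra\<close>

lemma rel_ideal_hom:
  assumes h: "unital_hom h" and "\<And>x. x \<in> A \<Longrightarrow> h x \<in> rel_ideal B" "x \<in> rel_ideal A"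
  shows "h x \<in> rel_ideal B"
  using assms(3)
proof (induction rule: rel_ideal_induct)
  case (left x y)
  then show ?case using h by (simp add: unital_hom_def rel_ideal_left)
next
  case (right x y)
  then show ?case using h by (simp add: unital_hom_def rel_ideal_right)
next
  case (add x y)
  then show ?case using h by (simp add: unital_hom_def rel_ideal_add)
qed (simp_all add: assms unital_hom_zero)

lemma entry_rels_hom:
  assumes "unital_hom h" "x \<in> entry_rels k A B"
  shows "h x \<in> entry_rels k (gnum h A) (gnum h B)"
proof -
  obtain xs ys where *: "x = A xs ys - B xs ys" "xs \<in> tidx k" "ys \<in> tidx k"
    using assms(2) by (auto simp: entry_rels_def)
  then have "h x = gnum h A xs ys - gnum h B xs ys"
    by (simp add: gnum_def unital_hom_diff[OF assms(1)])
  then show ?thesis using * unfolding entry_rels_def by blast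
qed

lemma REA_rels_hom:
  assumes h: "unital_hom h" and c: "\<And>c. h (fa_const c) = fa_const c" and x: "x \<in> REA_rels R L"
  shows "h x \<in> REA_rels R (\<lambda>i j. h (L i j))"
  using entry_rels_hom[OF h x[unfolded REA_rels_def]]
  by (simp add: REA_rels_def num_eq_gnum gnum_hom_tmul[OF h] gnum_gnum c gnum_hom_first_leg[OF h])

lemma QMA_rels_hom:
  assumes h: "unital_hom h" and c: "\<And>c. h (fa_const c) = fa_const c" and x: "x \<in> QMA_rels R F M"
  shows "h x \<in> QMA_rels R F (\<lambda>i j. h (M i j))"
  using entry_rels_hom[OF h x[unfolded QMA_rels_def]]
  by (simp add: QMA_rels_def num_eq_gnum bar_eq_gbar gnum_hom_tmul[OF h] gnum_gnum c
      gnum_hom_gbar[OF h] del: gbar.simps)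

definition homogeneous :: "nat \<Rightarrow> ('x, 'k::field) free_alg set" where
  "homogeneous p = {x. \<forall>w\<in>Poly_Mapping.keys x. length w = p}"

lemma homogeneous_mult: "x \<in> homogeneous p \<Longrightarrow> y \<in> homogeneous r \<Longrightarrow> x * y \<in> homogeneous (p + r)"
  using keys_mult[of x y] by (fastforce simp: homogeneous_def plus_list_def)

lemma homogeneous_single: "length w = p \<Longrightarrow> Poly_Mapping.single w c \<in> homogeneous p"
  by (simp add: homogeneous_def)

lemma homogeneous_subspace: "fa_subspace (homogeneous p)"
proof -
  have "x + y \<in> homogeneous p" if "x \<in> homogeneous p" "y
      \<in> homogeneous p" for x y :: "('a, 'b) free_alg"
    using that keys_add[of x y] by (fastforce simp: homogeneous_def)
  moreover have "fa_const c * x \<in> homogeneous p" if "x \<in> homogeneous p" for c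
      and x :: "('a, 'b) free_alg"
    using homogeneous_mult[OF homogeneous_single[of "[]" 0 c] that] by (simp add: fa_const_def)
  moreover have "0 \<in> homogeneous p" by (simp add: homogeneous_def)
  ultimately show ?thesis unfolding fa_subspace_def by blast
qed

definition L_embed :: "('n \<times> 'n, 'k::field) free_alg \<Rightarrow> (('n \<times> 'n) + ('n \<times> 'n), 'k) free_alg" where
  "L_embed = fa_eval fa_const (\<lambda>(i, j). genL i j)"

definition M_embed :: "('n \<times> 'n, 'k::field) free_alg \<Rightarrow> (('n \<times> 'n) + ('n \<times> 'n), 'k) free_alg" where
  "M_embed = fa_eval fa_const (\<lambda>(i, j). genM i j)"

lemma L_embed_hom: "unital_hom L_embed" and M_embed_hom: "unital_hom M_embed"
  unfolding L_embed_def M_embed_def by (rule fa.unital_hom_fa_eval)+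

lemma L_embed_simps:
  "L_embed 1 = 1" "L_embed (x + y) = L_embed x + L_embed y" "L_embed (x * y)
      = L_embed x * L_embed y"
  "L_embed (fa_const c) = fa_const c" "L_embed (fa_var (i, j)) = genL i j"
  by (simp_all add: L_embed_def fa.fa_eval_add fa.fa_eval_mult)

lemma M_embed_simps:
  "M_embed 1 = 1" "M_embed (x + y) = M_embed x + M_embed y" "M_embed (x * y)
      = M_embed x * M_embed y"
  "M_embed (fa_const c) = fa_const c" "M_embed (fa_var (i, j)) = genM i j"
  by (simp_all add: M_embed_def fa.fa_eval_add fa.fa_eval_mult)

definition counit_free :: "('n \<times> 'n, 'k::field) free_alg \<Rightarrow> 'k" where
  "counit_free = fa_eval id (\<lambda>(i, j). if i = j then 1 else 0)"

text \<open>The identity matrix solves the reflection equation, both sides becoming R_1^2, so the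
  evaluation L = I kills the ideal.\<close>

lemma counit_cls:
  fixes R :: "('n::finite, 'k::field) mat2"
  shows "counit R (REA_cls R x) = counit_free x"
  unfolding counit_def REA_cls_def counit_free_def[symmetric]
proof (rule the_elem_cls)
  fix y assume "y - x \<in> rel_ideal (REA_rels R gen)"
  have h: "unital_hom (counit_free :: ('n \<times> 'n, 'k) free_alg \<Rightarrow> 'k)" unfolding counit_free_def
      by (rule id.unital_hom_fa_eval)
  have z: "counit_free z = 0" if "z \<in> rel_ideal (REA_rels R gen)" for z
    using that
  proof (induction rule: rel_ideal_induct)
    case (incl z)
    let ?r = "gnum (\<lambda>c. counit_free (fa_const c :: ('n \<times> 'n, 'k) free_alg)) (leg 1 R)"
    let ?l = "first_leg (\<lambda>i j. counit_free (gen i j)) :: ('n, 'k) tmat"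
    from incl obtain xs ys where *: "length xs = 2" "length ys = 2"
      "counit_free z = (?r \<cdot> ?l \<cdot> ?r \<cdot> ?l) xs ys - (?l \<cdot> ?r \<cdot> ?l \<cdot> ?r) xs ys"
      using entry_rels_hom[OF h incl[unfolded REA_rels_def]]
      by (auto simp: num_eq_gnum gnum_hom_tmul[OF h] gnum_gnum gnum_hom_first_leg[OF h]
          entry_rels_def)
    have l: "teq 2 ?l tone"
      by (auto intro!: teqI simp: first_leg_def gen_def counit_free_def tone_def length_Suc_conv
          numeral_2_eq_2)
    have rl: "teq 2 (A \<cdot> ?l) A" for A
      using teq_trans[OF teq_tmul[OF teq_refl l] teq_tmul_tone] .
    have lr: "teq 2 (?l \<cdot> A) A" for A
      using teq_tmul[OF l teq_refl[of 2 A]] by simp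
    have "teq 2 (?r \<cdot> ?l \<cdot> ?r \<cdot> ?l) (?r \<cdot> ?l \<cdot> ?r)" by (rule rl)
    also have "teq 2 \<dots> (?r \<cdot> ?r)" by (intro teq_tmul rl teq_refl)
    finally have 1: "teq 2 (?r \<cdot> ?l \<cdot> ?r \<cdot> ?l) (?r \<cdot> ?r)" .
    have "teq 2 (?l \<cdot> (?r \<cdot> (?l \<cdot> ?r))) (?r \<cdot> (?l \<cdot> ?r))" by (rule lr)
    also have "teq 2 \<dots> (?r \<cdot> ?r)" by (intro teq_tmul lr teq_refl)
    finally have 2: "teq 2 (?l \<cdot> ?r \<cdot> ?l \<cdot> ?r) (?r \<cdot> ?r)" by (simp only: tmul_assoc)
    show ?case using teqD[OF 1] teqD[OF 2] * by simp
  qed (use h in \<open>simp_all add: unital_hom_def unital_hom_zero[OF h]\<close>)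
  show "counit_free y = counit_free x"
    using z[OF \<open>y - x \<in> _\<close>] unital_hom_diff[OF h, of y x] by simp
qed

section \<open>The representation of the braided differential algebra\<close>

context braided
begin

sublocale free: compatible "fa_const :: 'k \<Rightarrow> ('n \<times> 'n, 'k) free_alg" R F \<eta>
  by unfold_locales (fact R F RF)+

abbreviation "J \<equiv> rel_ideal (BR_rels \<eta> R F)"

text \<open>The operators act on the free algebra in the M_i^j, before its relations are imposed.
  The passage to the quotient takes two facts: every operator preserves \<open>I\<close>, and the
  relations of B_r map everything into \<open>I\<close>.\<close>

definition \<Phi> :: "(('n \<times> 'n) + ('n \<times> 'n), 'k) free_alg \<Rightarrow> ('n \<times> 'n, 'k) fa_endo" where
  "\<Phi> = fa_eval endo_const (case_sum (\<lambda>(i, j). Lop i j) (\<lambda>(i, j). Mop i j))"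

lemma \<Phi>_hom: "unital_hom \<Phi>"
  unfolding \<Phi>_def by (rule endo.unital_hom_fa_eval)

lemma \<Phi>_simps:
  "\<Phi> 1 = 1" "\<Phi> (x + y) = \<Phi> x + \<Phi> y" "\<Phi> (x * y) = \<Phi> x * \<Phi> y" "\<Phi> (fa_const c) = endo_const c"
  "\<Phi> (genL i j) = Lop i j" "\<Phi> (genM i j) = Mop i j"
  by (simp_all add: \<Phi>_def genL_def genM_def endo.fa_eval_add endo.fa_eval_mult)

lemma I_left: "x \<in> I \<Longrightarrow> y * x \<in> I"
  unfolding I_def by (rule rel_ideal_left)

lemma \<Phi>_I: "x \<in> I \<Longrightarrow> app (\<Phi> y) x \<in> I"
proof (induction y rule: fa_induct)
  case (var v y)
  then have "app (\<Phi> (fa_var v)) (app (\<Phi> y) x) \<in> I"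
    by (cases v) (auto simp: \<Phi>_def Mop_def intro: Lop_I I_left)
  then show ?case by (simp add: \<Phi>_simps app_simps)
qed (use I_subspace in \<open>auto simp: \<Phi>_simps app_simps fa_subspace_def\<close>)

lemma \<Phi>_M_embed: "\<Phi> (M_embed x) = lmul x"
proof (induction x rule: fa_induct)
  case (var v x)
  then show ?case by (cases v) (simp add: M_embed_simps \<Phi>_simps lmul_simps Mop_def gen_def)
qed (simp_all add: M_embed_simps \<Phi>_simps lmul_simps endo_const_def)

lemma \<Phi>_L_embed_one: "app (\<Phi> (L_embed x)) 1 = fa_const (counit_free x)"
proof (induction x rule: fa_induct)
  case (var v x)
  then show ?case
    using app_const[of "Lop (fst v) (snd v)" "counit_free x" 1]
    by (cases v) (simp add: L_embed_simps \<Phi>_simps app_simps counit_free_def id.fa_eval_mult Lop_one)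
qed (simp_all add: L_embed_simps \<Phi>_simps app_simps counit_free_def id.fa_eval_mult id.fa_eval_add
      fa_const_add fa_const_mult)

lemma \<Phi>_J:
  assumes "x \<in> J"
  shows "app (\<Phi> x) y \<in> I"
  using assms
proof (induction arbitrary: y rule: rel_ideal_induct)
  case (incl x)
  then consider "x \<in> QMA_rels R F genM" | "x \<in> REA_rels R genL" | "x \<in> cross_rels \<eta> R F genL genM"
    by (auto simp: BR_rels_def)
  then show ?case
  proof cases
    case 1
    then obtain xs ys where *: "length xs = 2" "length ys = 2"
      "x = (gnum fa_const (leg 1 R) \<cdot> gbar_prod fa_const F genM 2 - gbar_prod fa_const F genM 2
          \<cdot> gnum fa_const (leg 1 R)) xs ys"
      unfolding QMA_rels_entries by auto
    have "\<Phi> x = gnum \<Phi> (gnum fa_const (leg 1 R) \<cdot> gbar_prod fa_const F genM 2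
        - gbar_prod fa_const F genM 2 \<cdot> gnum fa_const (leg 1 R)) xs ys"
      unfolding *(3) by (simp add: gnum_def[of \<Phi>])
    also have "\<dots> = gnum lmul Q xs ys"
      unfolding lmul_Q by (simp only: gnum_hom_diff[OF \<Phi>_hom] gnum_hom_tmul[OF \<Phi>_hom]
          gnum_hom_gbar_prod[OF \<Phi>_hom] gnum_gnum \<Phi>_simps)
    finally show ?thesis using mat_inD[OF Q_in *(1,2)] by (simp add: gnum_def I_def rel_ideal_right)
  next
    case 2
    then obtain xs ys where *: "length xs = 2" "length ys = 2" "\<Phi> x = E xs ys"
      using entry_rels_hom[OF \<Phi>_hom 2[unfolded REA_rels_def]]
      by (auto simp: entry_rels_def num_eq_gnum gnum_hom_tmul[OF \<Phi>_hom] gnum_gnum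
          gnum_hom_first_leg[OF \<Phi>_hom] \<Phi>_simps E_def)
    show ?thesis using mat_inD[OF E_in[of y] *(1,2)] by (simp add: gnum_def *)
  next
    case 3
    let ?r = "gnum endo_const (leg 1 R) :: ('n, ('n \<times> 'n, 'k) fa_endo) tmat"
    let ?B = "first_leg Mop \<cdot> gbar endo_const F Lop 2"
    have t: "gnum \<Phi> (tscale \<eta> A) = (\<lambda>xs ys. endo_const \<eta> * gnum \<Phi> A xs ys)"
      for A :: "('n, (('n \<times> 'n) + ('n \<times> 'n), 'k) free_alg) tmat"
      by (intro ext) (simp add: gnum_def tscale_def \<Phi>_simps)
    from 3 obtain xs ys where *: "length xs = 2" "length ys = 2"
      "\<Phi> x = (?r \<cdot> first_leg Lop \<cdot> ?r \<cdot> first_leg Mop) xs ys - endo_const \<eta> * ?B xs ys"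
      using entry_rels_hom[OF \<Phi>_hom 3[unfolded cross_rels_def]]
      unfolding num_eq_gnum t bar_eq_gbar gnum_hom_tmul[OF \<Phi>_hom] gnum_gnum gnum_hom_gbar[OF \<Phi>_hom]
          gnum_hom_first_leg[OF \<Phi>_hom] \<Phi>_simps entry_rels_def by auto
    \<comment> \<open>The defining relation of B_r is \<open>cross\<close> multiplied by R_1 from
      the left, because R_1S_1 = \<eta>I.\<close>
    have RS: "teq 2 (leg 1 R \<cdot> leg 1 S) (\<lambda>xs ys. \<eta> * tone xs ys)"
    proof (rule teqI)
      fix xs ys :: "'n list" assume "length xs = 2" "length ys = 2"
      then have "(leg 1 R \<cdot> leg 1 Ri) xs ys = tone xs ys"
        by (intro teqD[OF leg_inverse[OF R_inv(1)]]) auto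
      moreover have "(leg 1 R \<cdot> leg 1 S) xs ys = \<eta> * (leg 1 R \<cdot> leg 1 Ri) xs ys"
        by (simp add: tmul_def leg_smult2 sum_distrib_left mult.left_commute)
      ultimately show "(leg 1 R \<cdot> leg 1 S) xs ys = \<eta> * tone xs ys" by simp
    qed
    have "teq 2 (?r \<cdot> (first_leg Lop \<cdot> ?r \<cdot> first_leg Mop)) (?r \<cdot> (gnum endo_const (leg 1 S)
        \<cdot> first_leg Mop \<cdot> gbar endo_const F Lop 2))"
      by (intro teq_tmul cross teq_refl)
    also have "\<dots> = gnum endo_const (leg 1 R \<cdot> leg 1 S) \<cdot> ?B"
      by (simp only: endo.gnum_tmul tmul_assoc)
    also have "teq 2 \<dots> (gnum endo_const (\<lambda>xs ys. \<eta> * tone xs ys) \<cdot> ?B)"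
      by (intro teq_tmul gnum_teq RS teq_refl)
    also have "gnum endo_const (\<lambda>xs ys. \<eta> * tone xs ys) \<cdot> ?B = (\<lambda>xs ys. endo_const \<eta> * ?B xs ys)"
      by (intro ext, subst tmul_def)
        (simp add: gnum_def tone_def if_distrib[of endo_const] if_distrib[of "\<lambda>x. _ * x"]
          if_distrib[of "\<lambda>x. x * _"] sum.delta cong: if_cong)
    finally have "(?r \<cdot> first_leg Lop \<cdot> ?r \<cdot> first_leg Mop) xs ys = endo_const \<eta> * ?B xs ys"
      using *(1,2) unfolding tmul_assoc by (rule teqD)
    then show ?thesis using I_subspace by (simp add: * app_simps fa_subspace_def)
  qed
next
  \<comment> \<open>Left multiples need that the operators preserve \<open>I\<close>; right
    multiples are covered because the argument of the operator is arbitrary in the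
    induction.\<close>
  case (left x y z)
  then show ?case by (simp add: \<Phi>_simps app_simps \<Phi>_I)
qed (use I_subspace in \<open>simp_all add: \<Phi>_simps app_simps fa_subspace_def unital_hom_zero[OF \<Phi>_hom]\<close>)

lemma L_embed_J: "x \<in> rel_ideal (REA_rels R gen) \<Longrightarrow> L_embed x \<in> J"
proof (rule rel_ideal_hom[OF L_embed_hom])
  fix x assume "x \<in> REA_rels R gen"
  from REA_rels_hom[OF L_embed_hom L_embed_simps(4) this] have "L_embed x \<in> REA_rels R genL"
    by (simp add: gen_def L_embed_simps)
  then show "L_embed x \<in> J" by (auto simp: BR_rels_def intro: rel_ideal_incl)
qed

lemma M_embed_J: "x \<in> I \<Longrightarrow> M_embed x \<in> J"
  unfolding I_def
proof (rule rel_ideal_hom[OF M_embed_hom])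
  fix x assume "x \<in> QMA_rels R F gen"
  from QMA_rels_hom[OF M_embed_hom M_embed_simps(4) this] have "M_embed x \<in> QMA_rels R F genM"
    by (simp add: gen_def M_embed_simps)
  then show "M_embed x \<in> J" by (auto simp: BR_rels_def intro: rel_ideal_incl)
qed

lemma REA_to_BR_cls: "REA_to_BR \<eta> R F (REA_cls R x) = cls (BR_rels \<eta> R F) (L_embed x)"
  unfolding REA_to_BR_def REA_cls_def L_embed_def[symmetric]
  by (rule the_elem_cls) (use L_embed_J unital_hom_diff[OF L_embed_hom] in \<open>metis cls_eq_iff\<close>)

lemma QMA_to_BR_cls: "QMA_to_BR \<eta> R F (QMA_cls R F x) = cls (BR_rels \<eta> R F) (M_embed x)"
  unfolding QMA_to_BR_def QMA_cls_def M_embed_def[symmetric]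
  by (rule the_elem_cls) (use M_embed_J unital_hom_diff[OF M_embed_hom] I_def in \<open>metis cls_eq_iff\<close>)

text \<open>The elements that have, modulo the relations of B_r, an expression as required in
  \<open>action_value\<close>. That every \<open>L_embed a * M_embed b\<close> belongs here gives
  the existence of a value.\<close>

definition ordered :: "(('n \<times> 'n) + ('n \<times> 'n), 'k) free_alg set" where
  "ordered = {x. \<exists>ps. x - (\<Sum>(b, a)\<leftarrow>ps. M_embed b * L_embed a) \<in> J}"

lemma ordered_J: "x \<in> J \<Longrightarrow> x \<in> ordered"
  by (auto simp: ordered_def intro!: exI[of _ "[]"])

lemma ordered_prod: "M_embed b * L_embed a \<in> ordered"
  by (auto simp: ordered_def intro!: exI[of _ "[(b, a)]"])

lemma ordered_M_mult:
  assumes "x \<in> ordered"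
  shows "M_embed c * x \<in> ordered"
proof -
  obtain ps where ps: "x - (\<Sum>(b, a)\<leftarrow>ps. M_embed b * L_embed a) \<in> J"
    using assms by (auto simp: ordered_def)
  have *: "M_embed c * (\<Sum>(b, a)\<leftarrow>ps. M_embed b * L_embed a)
      = (\<Sum>(b, a)\<leftarrow>map (\<lambda>(b, a). (c * b, a)) ps. M_embed b * L_embed a)"
    by (induction ps) (auto simp: distrib_left M_embed_simps mult.assoc)
  have "M_embed c * x - (\<Sum>(b, a)\<leftarrow>map (\<lambda>(b, a). (c * b, a)) ps. M_embed b * L_embed a) \<in> J"
    using rel_ideal_left[OF ps, of "M_embed c"] by (simp only: right_diff_distrib *)
  then show ?thesis unfolding ordered_def by blast
qed

lemma ordered_add:
  assumes "x \<in> ordered" "y \<in> ordered"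
  shows "x + y \<in> ordered"
proof -
  obtain ps qs where "x - (\<Sum>(b, a)\<leftarrow>ps. M_embed b * L_embed a)
      \<in> J" "y - (\<Sum>(b, a)\<leftarrow>qs. M_embed b * L_embed a) \<in> J"
    using assms by (auto simp: ordered_def)
  from rel_ideal_add[OF this] show ?thesis
    unfolding ordered_def by (auto intro!: exI[of _ "ps @ qs"] simp: algebra_simps)
qed

lemma ordered_subspace: "fa_subspace ordered"
  using ordered_M_mult[of _ "fa_const _"] ordered_add ordered_J
  by (auto simp: fa_subspace_def M_embed_simps)

text \<open>The defining relation multiplied by R_1^{-1} from the left, the form to which
  \<open>skew_cross_solve\<close> applies.\<close>

lemma cross_BR:
  "mat_in 2 J (first_leg genL \<cdot> gnum fa_const (leg 1 R) \<cdot> first_leg genM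
    - gnum fa_const (leg 1 S) \<cdot> first_leg genM \<cdot> gbar fa_const F genL 2)"
proof -
  let ?r = "gnum fa_const (leg 1 R) :: ('n, (('n \<times> 'n) + ('n \<times> 'n), 'k) free_alg) tmat"
  let ?ri = "gnum fa_const (leg 1 Ri) :: ('n, (('n \<times> 'n) + ('n \<times> 'n), 'k) free_alg) tmat"
  let ?A = "first_leg genL \<cdot> ?r \<cdot> first_leg genM" and ?B = "first_leg genM \<cdot> gbar fa_const F genL 2"
  have "mat_in 2 J (?r \<cdot> ?A - tscale \<eta> ?B)"
    unfolding mat_in_def
  proof (intro ballI rel_ideal_incl)
    fix xs ys :: "'n list" assume "xs \<in> tidx 2" "ys \<in> tidx 2"
    then show "(?r \<cdot> ?A - tscale \<eta> ?B) xs ys \<in> BR_rels \<eta> R F"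
      unfolding BR_rels_def cross_rels_def entry_rels_def num_eq_gnum bar_eq_gbar tmul_assoc
      by auto
  qed
  then have *: "mat_in 2 J (?ri \<cdot> (?r \<cdot> ?A - tscale \<eta> ?B))" by (rule mat_in_left)
  have "teq 2 (leg 1 Ri \<cdot> leg 1 R) tone"
    by (rule leg_inverse[OF R_inv(2)]) auto
  then have "teq 2 (gnum fa_const (leg 1 Ri \<cdot> leg 1 R) \<cdot> ?A) (gnum fa_const tone \<cdot> ?A)"
    by (rule teq_tmul[OF gnum_teq teq_refl])
  then have 1: "teq 2 (?ri \<cdot> ?r \<cdot> ?A) ?A"
    by (simp only: fa.gnum_tmul fa.gnum_tone tone_tmul)
  have const: "fa_const r * (fa_const \<eta> * z) = fa_const (\<eta> * r) * z"
    for r and z :: "(('n \<times> 'n) + ('n \<times> 'n), 'k) free_alg"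
    by (simp only: fa_const_mult[symmetric] mult.assoc[symmetric] mult.commute[of r])
  have "?ri \<cdot> tscale \<eta> ?B = gnum fa_const (leg 1 S) \<cdot> ?B"
    by (intro ext) (simp only: tmul_def gnum_def tscale_def leg_smult2 const)
  with 1 have "teq 2 (?ri \<cdot> (?r \<cdot> ?A - tscale \<eta> ?B)) (?A - gnum fa_const (leg 1 S) \<cdot> ?B)"
    unfolding tmul_diff_right by (simp only: tmul_assoc teq_def minus_apply) simp
  from mat_in_teq[OF this, of J] * show ?thesis by (simp only: tmul_assoc)
qed

text \<open>\<open>skew_cross_solve\<close> is applied to left multiplications in the free algebra
  on both kinds of generators. The exchange relation holds modulo \<open>J\<close>, hence modulo
  \<open>ordered\<close>, and \<open>ordered\<close> absorbs generators M from the left.\<close>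

lemma ordered_L_M:
  assumes "\<And>i a. genL i a * y \<in> ordered"
  shows "genL i a * (M_embed b * y) \<in> ordered"
  using assms
proof (induction b arbitrary: i a y rule: fa_induct)
  case (add x x')
  then show ?case by (simp add: M_embed_simps distrib_left distrib_right ordered_add)
next
  case (scale c x)
  then show ?case
    using fa_subspace_const[OF ordered_subspace]
    by (simp add: M_embed_simps fa.left_central[of "genL i a"] mult.assoc)
next
  case one
  then show ?case by (simp add: M_embed_simps)
next
  case (var v x)
  let ?L = "\<lambda>i j. lmul (genL i j :: (('n \<times> 'n) + ('n \<times> 'n), 'k) free_alg)"
  let ?M = "first_leg (\<lambda>i j. lmul (genM i j :: (('n \<times> 'n) + ('n \<times> 'n), 'k) free_alg))"
  let ?D = "first_leg genL \<cdot> gnum fa_const (leg 1 R) \<cdot> first_leg genM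
    - gnum fa_const (leg 1 S) \<cdot> first_leg genM \<cdot> gbar fa_const F genL 2"
  let ?x = "M_embed x * y"
  have *: "mat_in 2 ordered (app_mat ?x (gnum lmul D))" if "mat_in 2 J D"
    for D :: "('n, (('n \<times> 'n) + ('n \<times> 'n), 'k) free_alg) tmat"
    using that by (auto simp: mat_in_def gnum_def intro!: ordered_J rel_ideal_right)
  have "gnum lmul ?D = first_leg ?L \<cdot> gnum endo_const (leg 1 R) \<cdot> ?M
      - gnum endo_const (leg 1 S) \<cdot> ?M \<cdot> gbar endo_const F ?L 2"
    unfolding endo_const_eq by (simp only: gnum_hom_diff[OF unital_hom_lmul] gnum_hom_tmul[OF
        unital_hom_lmul]
        gnum_hom_first_leg[OF unital_hom_lmul] gnum_hom_gbar[OF unital_hom_lmul] gnum_gnum)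
  moreover have "mat_in 2 ordered (app_mat ?x (gnum lmul ?D))"
    by (rule *[OF cross_BR])
  moreover have "genM i j * app (?L a k) ?x \<in> ordered" for i j a k
    using ordered_M_mult[OF var.IH[OF var.prems], of "fa_var (i, j)"] by (simp add: M_embed_simps)
  ultimately have "app (?L i a) (genM b k * ?x) \<in> ordered" for b k
    by (intro skew_cross_solve[OF skew ordered_subspace]) auto
  then show ?case by (cases v) (simp add: M_embed_simps mult.assoc)
qed

lemma ordered_L_mult: "x \<in> ordered \<Longrightarrow> genL i a * x \<in> ordered"
proof -
  assume "x \<in> ordered"
  then obtain ps where ps: "x - (\<Sum>(b, a)\<leftarrow>ps. M_embed b * L_embed a) \<in> J"
    by (auto simp: ordered_def)
  have *: "genL i a * (M_embed b * L_embed c) \<in> ordered" for b c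
  proof (rule ordered_L_M)
    fix i a
    show "genL i a * L_embed c \<in> ordered"
      using ordered_prod[of 1 "fa_var (i, a) * c"] by (simp add: M_embed_simps L_embed_simps)
  qed
  have "genL i a * (\<Sum>(b, a)\<leftarrow>ps. M_embed b * L_embed a) \<in> ordered"
    using ordered_subspace by (induction ps) (auto simp: distrib_left * ordered_add fa_subspace_def)
  from ordered_add[OF this ordered_J[OF rel_ideal_left[OF ps, of "genL i a"]]]
  show ?thesis by (simp add: right_diff_distrib)
qed

lemma ordered_L_embed_M_embed: "L_embed a * M_embed b \<in> ordered"
proof (induction a rule: fa_induct)
  case (add x y)
  then show ?case by (simp add: L_embed_simps distrib_right ordered_add)
next
  case (scale c x)
  then show ?case using fa_subspace_const[OF ordered_subspace]
      by (simp add: L_embed_simps mult.assoc)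
next
  case one
  show ?case using ordered_prod[of b 1] by (simp add: L_embed_simps)
next
  case (var v x)
  then show ?case using ordered_L_mult by (cases v) (simp add: L_embed_simps mult.assoc)
qed

end

section \<open>Homogeneous components and the formula for the action of L\<close>

context compatible
begin

text \<open>X_{bar p+1} is X_1 conjugated by F_p ... F_1; this form avoids the inverse of the
  chain.\<close>

lemma gbar_rev_chain:
  assumes "p < K"
  shows "at_bar K X (Suc p) * at_level K (gnum \<phi> (rev_chain F p))
    = at_level K (gnum \<phi> (rev_chain F p)) * at_level K (first_leg X)"
  using assms
proof (induction p)
  case (Suc p)
  have inv: "at_leg K (Suc p) Fi * at_leg K (Suc p) F = 1"
    using Suc.prems by (intro at_leg_inverse F_inv) auto
  have rev: "at_level K (gnum \<phi> (rev_chain F (Suc p)))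
      = at_leg K (Suc p) F * at_level K (gnum \<phi> (rev_chain F p))"
    by (simp add: gnum_tmul at_level_tmul at_leg_def)
  have bar: "at_bar K X (Suc (Suc p))
      = at_leg K (Suc p) F * at_bar K X (Suc p) * at_leg K (Suc p) Fi"
    by (rule at_bar_Suc) simp
  have "at_bar K X (Suc (Suc p)) * at_level K (gnum \<phi> (rev_chain F (Suc p)))
    = at_leg K (Suc p) F * at_bar K X (Suc p) * (at_leg K (Suc p) Fi * at_leg K (Suc p) F)
        * at_level K (gnum \<phi> (rev_chain F p))"
    unfolding rev bar by (simp only: mult.assoc)
  also have "\<dots> = at_leg K (Suc p) F * (at_bar K X (Suc p) * at_level K (gnum \<phi> (rev_chain F p)))"
    by (simp only: inv mult_1_right mult.assoc)
  also have "\<dots> = at_leg K (Suc p) F * (at_level K (gnum \<phi> (rev_chain F p))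
      * at_level K (first_leg X))"
    using Suc by simp
  finally show ?case unfolding rev by (simp only: mult.assoc)
qed simp

end

context braided
begin

text \<open>Taken in the free algebra, because the spanning property holds there already, before any
  relation is imposed.\<close>

definition bar_span :: "nat \<Rightarrow> ('n \<times> 'n, 'k) free_alg set" where
  "bar_span p = {x. \<exists>c. x = (\<Sum>xs\<in>tidx p. \<Sum>ys\<in>tidx p. fa_const (c xs ys)
      * gbar_prod fa_const F gen p xs ys)}"

lemma bar_span_subspace: "fa_subspace (bar_span p)"
proof -
  have "0 \<in> bar_span p"
    unfolding bar_span_def by (auto intro!: exI[of _ "\<lambda>_ _. 0"])
  moreover have "x + y \<in> bar_span p" if "x \<in> bar_span p" "y \<in> bar_span p" for x y
  proof -
    from that obtain c d where
      "x = (\<Sum>xs\<in>tidx p. \<Sum>ys\<in>tidx p. fa_const (c xs ys) * gbar_prod fa_const F gen p xs ys)"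
      "y = (\<Sum>xs\<in>tidx p. \<Sum>ys\<in>tidx p. fa_const (d xs ys) * gbar_prod fa_const F gen p xs ys)"
      unfolding bar_span_def by blast
    then have "x + y = (\<Sum>xs\<in>tidx p. \<Sum>ys\<in>tidx p. fa_const (c xs ys + d xs ys)
        * gbar_prod fa_const F gen p xs ys)"
      by (simp add: fa_const_add distrib_right sum.distrib)
    then show ?thesis unfolding bar_span_def by (auto intro!: exI[of _ "\<lambda>xs ys. c xs ys + d xs ys"])
  qed
  moreover have "fa_const e * x \<in> bar_span p" if "x \<in> bar_span p" for e x
  proof -
    from that obtain c where
      "x = (\<Sum>xs\<in>tidx p. \<Sum>ys\<in>tidx p. fa_const (c xs ys) * gbar_prod fa_const F gen p xs ys)"
      unfolding bar_span_def by blast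
    then have "fa_const e * x = (\<Sum>xs\<in>tidx p. \<Sum>ys\<in>tidx p. fa_const (e * c xs ys)
        * gbar_prod fa_const F gen p xs ys)"
      by (simp add: fa_const_mult sum_distrib_left mult.assoc)
    then show ?thesis unfolding bar_span_def by (auto intro!: exI[of _ "\<lambda>xs ys. e * c xs ys"])
  qed
  ultimately show ?thesis unfolding fa_subspace_def by blast
qed

lemma bar_span_entry: "mat_in p (bar_span p) (gbar_prod fa_const F gen p)"
  unfolding mat_in_def
proof (intro ballI)
  fix us vs :: "'n list" assume "us \<in> tidx p" "vs \<in> tidx p"
  then have "(\<Sum>xs\<in>tidx p. \<Sum>ys\<in>tidx p. fa_const (if xs = us \<and> ys
      = vs then 1 else 0) * gbar_prod fa_const F gen p xs ys)
    = (\<Sum>xs\<in>tidx p. if xs = us then gbar_prod fa_const F gen p us vs else 0)"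
    by (intro sum.cong refl) (auto simp: if_distrib[of fa_const] if_distrib[of "\<lambda>x. x
        * _"] sum.delta cong: if_cong)
  also have "\<dots> = gbar_prod fa_const F gen p us vs"
    using \<open>us \<in> tidx p\<close> by (simp add: sum.delta)
  finally show "gbar_prod fa_const F gen p us vs \<in> bar_span p"
    unfolding bar_span_def by (auto intro!: exI[of _ "\<lambda>xs ys. if xs = us \<and> ys = vs then 1 else 0"])
qed

text \<open>Let N_p = M_{bar 1} ... M_{bar p} and C = F_p ... F_1. From M_{bar p+1} C = C M_1 the
  entries of N_p C M_1 lie in the span; skew-invertibility of F removes C, the unknowns being
  products of entries of N_p with generators.\<close>

lemma bar_span_step:
  assumes skew: "skew_inverse F \<Psi>'" and x: "x \<in> bar_span p"
  shows "x * gen b k \<in> bar_span (Suc p)"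
proof -
  let ?N = "\<lambda>p. gbar_prod fa_const F gen p :: ('n, ('n \<times> 'n, 'k) free_alg) tmat"
  let ?C = "gnum fa_const (rev_chain F p) :: ('n, ('n \<times> 'n, 'k) free_alg) tmat"
  have "?N p is as * gen b k \<in> bar_span (Suc p)" if len: "length is = p" "length as = p" for "is" as
  proof (rule rev_chain_solve[OF skew bar_span_subspace, where p = p
      and u = "\<lambda>as b. ?N p is as * gen b k"])
    fix cs :: "'n list" and j assume cs: "length cs = p"
    have "teq (Suc p) (gbar fa_const F gen (Suc p) \<cdot> ?C) (?C \<cdot> first_leg gen)"
      using free.gbar_rev_chain[of p "Suc p" gen]
          by (simp add: teq_iff_at_level at_level_tmul del: gbar.simps)
    then have N: "teq (Suc p) (?N (Suc p) \<cdot> ?C) (?N p \<cdot> (?C \<cdot> first_leg gen))"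
      unfolding gbar_prod.simps tmul_assoc by (rule teq_tmul[OF teq_refl])
    have "mat_in (Suc p) (bar_span (Suc p)) (?N (Suc p) \<cdot> ?C)"
      by (intro mat_in_const_right bar_span_subspace bar_span_entry)
    then have "(?N p \<cdot> (?C \<cdot> first_leg gen)) (is @ [j]) (k # cs) \<in> bar_span (Suc p)"
      unfolding mat_in_teq[OF N] by (rule mat_inD) (use len cs in auto)
    also have "(?N p \<cdot> (?C \<cdot> first_leg gen)) (is @ [j]) (k # cs)
      = (\<Sum>as\<in>tidx p. \<Sum>b\<in>UNIV. fa_const (rev_chain F p (as @ [j]) (b # cs)) * (?N p is as
          * gen b k))"
      using len cs
      by (simp add: local_tmul_entry[OF fa.local_gbar_prod[OF order_refl]] tmul_first_leg gnum_def
          sum_distrib_left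
          fa.left_central[of "?N p is _"] mult.assoc)
    finally show "(\<Sum>as\<in>tidx p. \<Sum>b\<in>UNIV. fa_const (rev_chain F p (as @ [j]) (b # cs)) * (?N p is as
        * gen b k)) \<in> bar_span (Suc p)" .
  qed (use len in auto)
  moreover obtain c where "x = (\<Sum>xs\<in>tidx p. \<Sum>ys\<in>tidx p. fa_const (c xs ys) * ?N p xs ys)"
    using x unfolding bar_span_def by blast
  ultimately show ?thesis
    by (auto simp: sum_distrib_right mult.assoc intro!: fa_subspace_sum[OF bar_span_subspace]
        fa_subspace_const[OF bar_span_subspace])
qed

lemma homogeneous_bar_span:
  assumes "skew_inverse F \<Psi>'" "x \<in> homogeneous p"
  shows "x \<in> bar_span p"
proof -
  have w: "Poly_Mapping.single w 1 \<in> bar_span (length w)" for w :: "('n \<times> 'n) list"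
  proof (induction w rule: rev_induct)
    case Nil
    show ?case
      using mat_inD[OF bar_span_entry[of 0], of "[]" "[]"] by (simp add: tone_def one_free)
  next
    case (snoc v w)
    have "Poly_Mapping.single (w @ [v]) 1
        = Poly_Mapping.single w 1 * (gen (fst v) (snd v) :: ('n \<times> 'n, 'k) free_alg)"
      by (simp add: gen_def fa_var_def single_mult)
    then show ?case using bar_span_step[OF assms(1) snoc] by simp
  qed
  have "(\<Sum>w\<in>Poly_Mapping.keys x. fa_const (Poly_Mapping.lookup x w) * Poly_Mapping.single w 1)
      \<in> bar_span p"
    using assms(2) w
    by (intro fa_subspace_sum[OF bar_span_subspace] fa_subspace_const[OF bar_span_subspace])
      (force simp: homogeneous_def)
  then show ?thesis
    using fa_sum_words[of x] by (simp add: single_eq_const_mult[symmetric])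
qed

text \<open>In the exchange relation L passes one generator M and leaves exactly one behind, so the
  degree is kept.\<close>

lemma L_word_homogeneous: "L_word w i a \<in> homogeneous (length w)"
proof (induction w arbitrary: i a)
  case Nil
  show ?case by (auto simp: one_free homogeneous_def)
next
  case (Cons v w)
  have "gen i j * L_word w a k \<in> homogeneous (length (v # w))" for i j a k
    using homogeneous_mult[OF homogeneous_single[of "[(i, j)]" 1 1] Cons[of a k]]
    by (simp add: gen_def fa_var_def)
  note * = cross_rhs_in[OF homogeneous_subspace this, where A = "leg 1 S" and B = "leg 1 F"
      and C = "leg 1 Fi"]
  show ?case
    unfolding L_word.simps gbar_2 tmul_assoc
    by (intro fa_subspace_sum[OF homogeneous_subspace] fa_subspace_const[OF homogeneous_subspace]
        mat_inD[OF *]) auto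
qed

lemma Lop_homogeneous: "x \<in> homogeneous p \<Longrightarrow> app (Lop i a) x \<in> homogeneous p"
proof -
  assume x: "x \<in> homogeneous p"
  have "app (Lop i a) x = (\<Sum>w\<in>Poly_Mapping.keys x. fa_const (Poly_Mapping.lookup x w)
      * L_word w i a)"
    by (simp add: Lop_def lin_endo_def Abs_fa_endo_inverse fa_lin_add fa_lin_const_mult)
      (simp add: fa_lin_def)
  also have "\<dots> \<in> homogeneous p"
    using x L_word_homogeneous
    by (intro fa_subspace_sum[OF homogeneous_subspace] fa_subspace_const[OF homogeneous_subspace])
      (force simp: homogeneous_def)
  finally show ?thesis .
qed

text \<open>L_1 acts on 1 as the identity matrix, which is unchanged by conjugation with
  F_k.\<close>

lemma app_one_gbar: "1 \<le> k \<Longrightarrow> k \<le> K \<Longrightarrow> teq K (app_mat 1 (gbar endo_const F Lop k))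
    (gnum fa_const tone)"
proof (induction k rule: dec_induct)
  case base
  show ?case
  proof (rule teqI)
    fix xs ys :: "'n list" assume "length xs = K" "length ys = K"
    then obtain x xs' y ys' where "xs = x # xs'" "ys = y # ys'"
      using base by (cases xs; cases ys) auto
    then show "app_mat 1 (gbar endo_const F Lop 1) xs ys = gnum fa_const tone xs ys"
      by (simp add: app_mat_first_leg first_leg_def Lop_one tone_def gnum_def)
  qed
next
  case (step k)
  have "teq K (gnum fa_const (leg k F) \<cdot> (app_mat 1 (gbar endo_const F Lop k)
      \<cdot> gnum fa_const (leg k Fi)))
      (gnum fa_const (leg k F) \<cdot> (gnum fa_const tone \<cdot> gnum fa_const (leg k Fi)))"
    using step by (intro teq_tmul[OF teq_refl] teq_tmul[OF _ teq_refl]) simp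
  moreover have "teq K (gnum fa_const (leg k F \<cdot> leg k Fi)) (gnum fa_const tone)"
    by (rule gnum_teq, rule leg_inverse[OF F_inv(1)]) (use step in auto)
  ultimately have "teq K (gnum fa_const (leg k F) \<cdot> (app_mat 1 (gbar endo_const F Lop k)
      \<cdot> gnum fa_const (leg k Fi)))
      (gnum fa_const tone)"
    unfolding fa.gnum_tone tone_tmul fa.gnum_tmul by (rule teq_trans)
  moreover have "app_mat 1 (gbar endo_const F Lop (Suc k))
      = gnum fa_const (leg k F) \<cdot> (app_mat 1 (gbar endo_const F Lop k) \<cdot> gnum fa_const (leg k Fi))"
    using step by (simp add: tmul_assoc app_mat_const app_mat_const_right)
  ultimately show ?case by simp
qed

text \<open>This is \<open>cross_chain\<close> evaluated at 1, where L_{bar p+1} becomes the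
  identity. R_p reaches the factor p + 1, hence the level \<open>Suc p\<close>. The formula holds
  already in the free algebra.\<close>

lemma L_action_formula:
  "teq (Suc p) (\<lambda>xs ys. \<Sum>zs\<in>tidx (length xs). app (first_leg Lop xs zs) ((num (leg_chain R p)
      \<cdot> bar_prod F gen p) zs ys))
    (tscale (\<eta> ^ p) (num (leg_chain Ri p) \<cdot> bar_prod F gen p))"
proof -
  let ?N = "gbar_prod fa_const F gen p" and ?b = "gbar endo_const F Lop (Suc p)"
  have N: "gbar_prod endo_const F Mop p = gnum lmul ?N"
    by (simp add: gnum_hom_gbar_prod[OF unital_hom_lmul] endo_const_eq Mop_def[abs_def])
  have C: "gnum endo_const A = gnum lmul (gnum fa_const A)" for A :: "('n, 'k) tmat"
    by (simp add: gnum_gnum endo_const_eq)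
  have 1: "(\<lambda>xs ys. \<Sum>zs\<in>tidx (length xs). app (first_leg Lop xs zs) ((num (leg_chain R p)
      \<cdot> bar_prod F gen p) zs ys))
    = app_mat 1 (first_leg Lop \<cdot> gnum endo_const (leg_chain R p) \<cdot> gbar_prod endo_const F Mop p)"
    unfolding N C tmul_assoc gnum_hom_tmul[OF unital_hom_lmul, symmetric]
    by (intro ext, subst gnum_def, subst tmul_def) (simp add: app_sum app_simps gnum_def[of lmul]
        num_eq_gnum bar_prod_eq_gbar_prod)
  have 2: "teq (Suc p) (app_mat 1 (first_leg Lop \<cdot> gnum endo_const (leg_chain R p)
      \<cdot> gbar_prod endo_const F Mop p))
    (app_mat 1 (gnum endo_const (leg_chain S p) \<cdot> gbar_prod endo_const F Mop p \<cdot> ?b))"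
    using cross_chain[of p "Suc p"]
        by (intro gnum_teq) (simp add: teq_iff_at_level at_level_tmul del: gbar.simps)
  have 3: "app_mat 1 (gnum endo_const (leg_chain S p) \<cdot> gbar_prod endo_const F Mop p \<cdot> ?b)
    = gnum fa_const (leg_chain S p) \<cdot> (?N \<cdot> app_mat 1 ?b)"
    unfolding N tmul_assoc app_mat_const app_mat_lmul ..
  have "teq (Suc p) (app_mat 1 ?b) tone"
    using app_one_gbar[of "Suc p" "Suc p"] by (simp del: gbar.simps)
  then have 4: "teq (Suc p) (gnum fa_const (leg_chain S p) \<cdot> (?N
      \<cdot> app_mat 1 ?b)) (gnum fa_const (leg_chain S p) \<cdot> ?N)"
    by (intro teq_tmul[OF teq_refl] teq_trans[OF teq_tmul[OF teq_refl] teq_tmul_tone])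
  \<comment> \<open>Each of the \<open>p\<close> factors S contributes one \<eta>.\<close>
  have 5: "gnum fa_const (leg_chain S p) \<cdot> ?N
      = tscale (\<eta> ^ p) (num (leg_chain Ri p) \<cdot> bar_prod F gen p)"
    by (intro ext) (simp add: tscale_def tmul_def num_eq_gnum gnum_def leg_chain_smult2
        bar_prod_eq_gbar_prod
        fa_const_mult sum_distrib_left mult.assoc)
  show ?thesis
    using teq_trans[OF 2[unfolded 3] 4] unfolding 1 5 .
qed

section \<open>The action on classes and the module laws\<close>

lemma cls_simps:
  "carrier (QMA R F) = range (QMA_cls R F)" "carrier (REA R) = range (REA_cls R)"
  "REA_cls R a \<otimes>\<^bsub>REA R\<^esub> REA_cls R a' = REA_cls R (a * a')"
  "REA_cls R a \<oplus>\<^bsub>REA R\<^esub> REA_cls R a' = REA_cls R (a + a')"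
  "c \<odot>\<^bsub>REA R\<^esub> REA_cls R a = REA_cls R (fa_const c * a)"
  "\<one>\<^bsub>REA R\<^esub> = REA_cls R 1"
  "QMA_cls R F b \<oplus>\<^bsub>QMA R F\<^esub> QMA_cls R F b' = QMA_cls R F (b + b')"
  "c \<odot>\<^bsub>QMA R F\<^esub> QMA_cls R F b = QMA_cls R F (fa_const c * b)"
  "\<one>\<^bsub>QMA R F\<^esub> = QMA_cls R F 1"
  by (simp_all add: QMA_def REA_def QMA_cls_def REA_cls_def presented_simps)

lemma QMA_cls_eq: "QMA_cls R F x = QMA_cls R F y \<longleftrightarrow> x - y \<in> I"
  by (simp add: QMA_cls_def I_def cls_eq_iff)

text \<open>Exhibiting the value as the operator of \<open>a\<close> applied to \<open>b\<close>
  settles existence and uniqueness together, and makes the action computable on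
  representatives.\<close>

lemma action_value_iff:
  "action_value \<eta> R F (REA_cls R a) (QMA_cls R F b) c \<longleftrightarrow> c = QMA_cls R F (app (\<Phi> (L_embed a)) b)"
proof
  assume "action_value \<eta> R F (REA_cls R a) (QMA_cls R F b) c"
  then obtain N :: nat and bs as where
    mem: "\<And>i. i < N \<Longrightarrow> bs i \<in> range (QMA_cls R F) \<and> as i \<in> range (REA_cls R)"
    and eq: "REA_to_BR \<eta> R F (REA_cls R a) \<otimes>\<^bsub>BR \<eta> R F\<^esub> QMA_to_BR \<eta> R F (QMA_cls R F b) =
      (\<Oplus>\<^bsub>BR \<eta> R F\<^esub>i\<in>{..<N}. QMA_to_BR \<eta> R F (bs i) \<otimes>\<^bsub>BR \<eta> R F\<^esub> REA_to_BR \<eta> R F (as i))"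
    and c: "c = (\<Oplus>\<^bsub>QMA R F\<^esub>i\<in>{..<N}. counit R (as i) \<odot>\<^bsub>QMA R F\<^esub> bs i)"
    unfolding action_value_def cls_simps(1,2) by blast
  from mem have "\<forall>i. \<exists>b a. i < N \<longrightarrow> bs i = QMA_cls R F b \<and> as i = REA_cls R a" by blast
  then obtain b' a' where ab: "\<And>i. i < N \<Longrightarrow> bs i = QMA_cls R F (b' i) \<and> as i = REA_cls R (a' i)"
    by metis
  have c': "c = QMA_cls R F (\<Sum>i<N. fa_const (counit_free (a' i)) * b' i)"
    unfolding c QMA_def QMA_cls_def
    by (rule finsum_presented) (use ab in \<open>auto simp: counit_cls cls_simps presented_simps simp
        flip: QMA_def QMA_cls_def\<close>)
  have "cls (BR_rels \<eta> R F) (L_embed a * M_embed b) =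
     (\<Oplus>\<^bsub>BR \<eta> R F\<^esub>i\<in>{..<N}. QMA_to_BR \<eta> R F (bs i) \<otimes>\<^bsub>BR \<eta> R F\<^esub> REA_to_BR \<eta> R F (as i))"
    using eq by (simp add: REA_to_BR_cls QMA_to_BR_cls BR_def presented_simps)
  also have "\<dots> = cls (BR_rels \<eta> R F) (\<Sum>i<N. M_embed (b' i) * L_embed (a' i))"
    unfolding BR_def by (rule finsum_presented) (use ab in \<open>auto simp: REA_to_BR_cls QMA_to_BR_cls
        presented_simps\<close>)
  finally have "L_embed a * M_embed b - (\<Sum>i<N. M_embed (b' i) * L_embed (a' i)) \<in> J"
    by (simp add: cls_eq_iff)
  \<comment> \<open>On 1, the image of \<open>a' i\<close> acts by its counit and that of
    \<open>b' i\<close> by left multiplication, so the reordered sum becomes the value computed from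
    it.\<close>
  from \<Phi>_J[OF this, of 1] have "app (\<Phi> (L_embed a)) b - (\<Sum>i<N. b' i * fa_const (counit_free (a' i)))
      \<in> I"
    by (simp add: unital_hom_diff[OF \<Phi>_hom] unital_hom_sum[OF \<Phi>_hom] \<Phi>_simps app_simps app_sum
        \<Phi>_M_embed \<Phi>_L_embed_one)
  then show "c = QMA_cls R F (app (\<Phi> (L_embed a)) b)"
    unfolding c' QMA_cls_eq I_def using rel_ideal_uminus by (force simp: fa_const_central)
next
  assume c: "c = QMA_cls R F (app (\<Phi> (L_embed a)) b)"
  \<comment> \<open>Some reordered expression exists; evaluating it at 1 shows below that its value
    is \<open>c\<close>.\<close>
  obtain ps where ps: "L_embed a * M_embed b - (\<Sum>(b, a)\<leftarrow>ps. M_embed b * L_embed a) \<in> J"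
    using ordered_L_embed_M_embed by (auto simp: ordered_def)
  define bs as where "bs i = QMA_cls R F (fst (ps ! i))" and "as i = REA_cls R (snd (ps ! i))" for i
  let ?N = "length ps"
  have sum: "(\<Sum>(b, a)\<leftarrow>ps. f b a) = (\<Sum>i<?N. f (fst (ps ! i)) (snd (ps ! i)))"
    for f :: "_ \<Rightarrow> _ \<Rightarrow> 'z::comm_monoid_add"
    by (simp add: sum_list_sum_nth atLeast0LessThan case_prod_beta)
  have "(\<Oplus>\<^bsub>BR \<eta> R F\<^esub>i\<in>{..<?N}. QMA_to_BR \<eta> R F (bs i) \<otimes>\<^bsub>BR \<eta> R F\<^esub> REA_to_BR \<eta> R F (as i))
    = (\<Oplus>\<^bsub>BR \<eta> R F\<^esub>i\<in>{..<?N}. cls (BR_rels \<eta> R F) (M_embed (fst (ps ! i)) * L_embed (snd (ps ! i))))"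
    by (simp add: bs_def as_def QMA_to_BR_cls REA_to_BR_cls BR_def presented_simps)
  also have "\<dots> = cls (BR_rels \<eta> R F) (\<Sum>i<?N. M_embed (fst (ps ! i)) * L_embed (snd (ps ! i)))"
    unfolding BR_def by (rule finsum_presented) simp_all
  also have "\<dots> = cls (BR_rels \<eta> R F) (L_embed a * M_embed b)"
    using rel_ideal_uminus[OF ps] unfolding cls_eq_iff sum by simp
  finally have 1: "REA_to_BR \<eta> R F (REA_cls R a) \<otimes>\<^bsub>BR \<eta> R F\<^esub> QMA_to_BR \<eta> R F (QMA_cls R F b)
      = (\<Oplus>\<^bsub>BR \<eta> R F\<^esub>i\<in>{..<?N}. QMA_to_BR \<eta> R F (bs i) \<otimes>\<^bsub>BR \<eta> R F\<^esub> REA_to_BR \<eta> R F (as i))"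
    by (simp add: QMA_to_BR_cls REA_to_BR_cls BR_def presented_simps)
  have "(\<Oplus>\<^bsub>QMA R F\<^esub>i\<in>{..<?N}. counit R (as i) \<odot>\<^bsub>QMA R F\<^esub> bs i)
    = (\<Oplus>\<^bsub>QMA R F\<^esub>i\<in>{..<?N}. QMA_cls R F (fa_const (counit_free (snd (ps ! i))) * fst (ps ! i)))"
    by (simp add: bs_def as_def counit_cls cls_simps)
  also have "\<dots> = QMA_cls R F (\<Sum>i<?N. fa_const (counit_free (snd (ps ! i))) * fst (ps ! i))"
    unfolding QMA_def QMA_cls_def by (rule finsum_presented) simp_all
  also have "\<dots> = c"
    unfolding c QMA_cls_eq
    using \<Phi>_J[OF rel_ideal_uminus[OF ps], of 1]
    by (simp add: sum unital_hom_diff[OF \<Phi>_hom] unital_hom_sum[OF \<Phi>_hom] \<Phi>_simps app_simps app_sum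
        \<Phi>_M_embed \<Phi>_L_embed_one fa_const_central)
  finally show "action_value \<eta> R F (REA_cls R a) (QMA_cls R F b) c"
    unfolding action_value_def cls_simps(1,2)
    by (intro exI[of _ ?N] exI[of _ bs] exI[of _ as]) (auto simp: 1 bs_def as_def)
qed

lemma action_cls: "action \<eta> R F (REA_cls R a) (QMA_cls R F b) = QMA_cls R F (app (\<Phi> (L_embed a)) b)"
  by (simp add: action_def action_value_iff)

text \<open>On representatives every law reduces to \<open>L_embed\<close> and \<open>\<Phi>\<close>
  being homomorphisms into linear operators.\<close>

lemma module_structure: "left_module_structure (REA R) (QMA R F) (action \<eta> R F)"
  unfolding left_module_structure_def cls_simps(1,2)
  by (simp add: cls_simps action_cls L_embed_simps \<Phi>_simps app_simps app_add app_const)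

end

text \<open>Injectivity makes M(R,F) a subalgebra of B_r, and the unique existence of a value is
  what the definite description in \<open>action\<close> rests on. The matrix identity concerns the
  entries of M_{bar 1} ... M_{bar p}; the clause on linear combinations says that they span the
  component of degree p. The class \<open>real_normed_field\<close> contains the real and the
  complex numbers.\<close>

theorem proposition10:
  fixes R F :: "'k::real_normed_field ^ ('n::finite \<times> 'n) ^ ('n \<times> 'n)"
    and q \<eta> :: 'k and m :: nat
  assumes "GL_type m q R"
    and "R_matrix F"
    and "strictly_skew_invertible R"
    and "strictly_skew_invertible F"
    and "compatible_pair R F"
    and "\<eta> \<noteq> 0"
  shows
    "inj_on (QMA_to_BR \<eta> R F) (carrier (QMA R F)) \<and>
     (\<forall>a\<in>carrier (REA R). \<forall>b\<in>carrier (QMA R F). \<exists>!c. action_value \<eta> R F a b c) \<and>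
     left_module_structure (REA R) (QMA R F) (action \<eta> R F) \<and>
     (\<forall>a\<in>carrier (REA R). action \<eta> R F a \<one>\<^bsub>QMA R F\<^esub> = counit R a \<odot>\<^bsub>QMA R F\<^esub> \<one>\<^bsub>QMA R F\<^esub>) \<and>
     (\<forall>p\<ge>1.
        (\<forall>i j. \<forall>b\<in>QMA_component R F p.
           action \<eta> R F (REA_cls R (gen i j)) b \<in> QMA_component R F p) \<and>
        (\<forall>b\<in>QMA_component R F p. \<exists>c.
           b = QMA_cls R F (\<Sum>xs\<in>tidx p. \<Sum>ys\<in>tidx p. fa_const (c xs ys) * bar_prod F gen p xs ys)) \<and>
        teq (p + 1)
          (L1_action \<eta> R F (num (leg_chain R p) \<cdot> bar_prod F gen p))
          (\<lambda>xs ys. QMA_cls R F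
             (tscale (\<eta> ^ p) (num (leg_chain (matrix_inv R) p) \<cdot> bar_prod F gen p) xs ys)))"
proof -
  obtain \<Psi> \<Psi>' where skews: "skew_inverse R \<Psi>" "skew_inverse F \<Psi>'"
    using assms(3,4) unfolding strictly_skew_invertible_def by blast
  interpret braided R F \<Psi> \<eta>
    by unfold_locales (use assms(1,2,5) skews in \<open>simp_all add: GL_type_def Hecke_type_def\<close>)
  have component: "QMA_component R F p = QMA_cls R F ` homogeneous p" for p
    by (simp add: QMA_component_def homogeneous_def)
  have gen: "action \<eta> R F (REA_cls R (gen i j)) (QMA_cls R F x)
      = QMA_cls R F (app (Lop i j) x)" for i j x
    by (simp add: action_cls gen_def L_embed_simps \<Phi>_simps)
  have inj: "inj_on (QMA_to_BR \<eta> R F) (carrier (QMA R F))"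
  proof (rule inj_onI)
    fix b b' assume "b \<in> carrier (QMA R F)" "b' \<in> carrier (QMA R F)" and eq: "QMA_to_BR \<eta> R F b
        = QMA_to_BR \<eta> R F b'"
    then obtain x x' where x: "b = QMA_cls R F x" "b' = QMA_cls R F x'"
      unfolding cls_simps(1) by blast
    with eq have "M_embed x - M_embed x' \<in> J"
      by (simp add: QMA_to_BR_cls cls_eq_iff)
    from \<Phi>_J[OF this, of 1] show "b = b'"
      by (simp add: x QMA_cls_eq unital_hom_diff[OF \<Phi>_hom] \<Phi>_M_embed app_simps)
  qed
  have unique: "\<exists>!c. action_value \<eta> R F a b c" if "a \<in> carrier (REA R)" "b
      \<in> carrier (QMA R F)" for a b
    using that unfolding cls_simps(1,2) by (auto simp: action_value_iff)
  have action_one: "action \<eta> R F a \<one>\<^bsub>QMA R F\<^esub> = counit R a \<odot>\<^bsub>QMA R F\<^esub> \<one>\<^bsub>QMA R F\<^esub>" if "a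
      \<in> carrier (REA R)" for a
    using that unfolding cls_simps(2)
        by (auto simp: cls_simps(8,9) action_cls counit_cls \<Phi>_L_embed_one)
  have graded: "action \<eta> R F (REA_cls R (gen i j)) b \<in> QMA_component R F p" if "b
      \<in> QMA_component R F p" for i j b p
    using that by (auto simp: component gen Lop_homogeneous)
  have spanned: "\<exists>c. b = QMA_cls R F (\<Sum>xs\<in>tidx p. \<Sum>ys\<in>tidx p. fa_const (c xs ys)
      * bar_prod F gen p xs ys)"
    if "b \<in> QMA_component R F p" for b p
  proof -
    from that obtain x where x: "b = QMA_cls R F x" "x \<in> homogeneous p" unfolding component by blast
    then have "x \<in> bar_span p" by (intro homogeneous_bar_span[OF skews(2)])
    then show ?thesis unfolding bar_span_def x(1) bar_prod_eq_gbar_prod by blast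
  qed
  have formula: "teq (p + 1) (L1_action \<eta> R F (num (leg_chain R p) \<cdot> bar_prod F gen p))
      (\<lambda>xs ys. QMA_cls R F (tscale (\<eta> ^ p) (num (leg_chain (matrix_inv R) p)
          \<cdot> bar_prod F gen p) xs ys))" for p
  proof (rule teqI)
    fix xs ys :: "'n list" assume len: "length xs = p + 1" "length ys = p + 1"
    let ?X = "num (leg_chain R p) \<cdot> bar_prod F gen p"
    have L: "\<Phi> (L_embed (first_leg gen xs zs)) = first_leg Lop xs zs" for zs
      by (simp add: first_leg_def gen_def L_embed_simps \<Phi>_simps unital_hom_zero[OF L_embed_hom]
          unital_hom_zero[OF \<Phi>_hom])
    have "L1_action \<eta> R F ?X xs ys = QMA_cls R F (\<Sum>zs\<in>tidx (length xs). app (first_leg Lop xs zs)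
        (?X zs ys))"
      unfolding L1_action_def action_cls L unfolding QMA_def QMA_cls_def
          by (rule finsum_presented) simp_all
    also have "(\<Sum>zs\<in>tidx (length xs). app (first_leg Lop xs zs) (?X zs ys))
        = tscale (\<eta> ^ p) (num (leg_chain Ri p) \<cdot> bar_prod F gen p) xs ys"
      using teqD[OF L_action_formula[of p], of xs ys] len by simp
    finally show "L1_action \<eta> R F ?X xs ys
      = QMA_cls R F (tscale (\<eta> ^ p) (num (leg_chain (matrix_inv R) p) \<cdot> bar_prod F gen p) xs ys)" .
  qed
  show ?thesis
    by (intro conjI ballI allI impI)
      (assumption | rule inj unique module_structure action_one graded spanned formula)+
qed

end
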